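(* Let $1\le r\le n$ and let $\boldsymbol\lambda=(\lambda_1\ge\dots\ge\lambda_r\ge0)$ be a partition with $\lambda_1\le n-r$. Let $\mathcal E_n(z,w^{-1})=\sum_{i,j=0}^{n-1}X^i(c)\otimes\partial^j(s)\,z^iw^{-j}$. Then $$\mathcal E_n(z,w^{-1})\big(\Delta_{\boldsymbol\lambda}(H_{r,n}(c))\big)=\frac{z^{r-1}}{w^{r-1}}\Big(1+\sum_{i=1}^{n-1}s_iw^i\Big)\,\pi_{r,n}\!\left(\frac{\mathbf c(z)}{E_r(z)}\,\Delta_{\boldsymbol\lambda}(\mathbf w^{-1}(c),\overline\sigma_-(z)H_r(c))\right),$$ where $\pi_{r,n}$ is applied coefficientwise.
   Context: **Rings.** Let $n\ge1$, $B_0(c)=\mathbb Q[c_1,\dots,c_n]$ (polynomial ring), $c_0=1$, $c_i=0$ for $i>n$, $\mathbf c(z)=1-c_1z+\cdots+(-1)^nc_nz^n$, and $\frac1{\mathbf c(w)}=\sum_{i\ge0}s_iw^i$ (so $s_0=1$). Let $V(c)=B_0(c)[X]$ and $X^j(c)=\sum_{i=0}^{j}(-1)^ic_iX^{j-i}$ for $j\ge0$; the $X^j(c)$ form a $B_0(c)$-basis of $V(c)$. Let $B_r(c)=B_0(c)[e_1,\dots,e_r]$ (polynomial ring), $E_r(z)=1-e_1z+\cdots+(-1)^re_rz^r$, and define $h_j(c)\in B_r(c)$ by $\sum_{j\in\mathbb Z}h_j(c)z^j=\mathbf c(z)/E_r(z)\in B_r(c)[[z]]$ (so $h_j(c)=0$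 for $j<0$). For a partition $\boldsymbol\lambda$ of length at most $r$ let $\Delta_{\boldsymbol\lambda}(H_r(c))=\det\big(h_{\lambda_j-j+k}(c)\big)_{1\le k,j\le r}$ ($k$ = row, $j$ = column). Let $I_{r,n}(c)=(h_{n-r+1}(c),\dots,h_n(c))\subset B_r(c)$, $B_{r,n}(c)=B_r(c)/I_{r,n}(c)$, $\pi_{r,n}:B_r(c)\to B_{r,n}(c)$ the projection, and $\Delta_{\boldsymbol\lambda}(H_{r,n}(c))=\pi_{r,n}(\Delta_{\boldsymbol\lambda}(H_r(c)))$. The elements $\Delta_{\boldsymbol\lambda}(H_{r,n}(c))$ with $\lambda_1\le n-r$ form a $B_0(c)$-basis of $B_{r,n}(c)$. **The $gl(V_n(c))$-action.** Let $V_n(c)=V(c)/(X^n(c))$, free over $B_0(c)$ with basis (the classes of) $X^0(c),\dots,X^{n-1}(c)$, and let $(\partial^j(s))_{0\le j\le n-1}$ be the dual basis of $V_n(c)^*$, so $\partial^j(s)(X^i(c))=\delta_{ij}$. For $v\in V_n(c)$ and $\partial\in V_n(c)^*$, the element $v\otimes\partial\in gl(V_n(c))=V_n(c)\otimes V_n(c)^*$ acts on $\bigwedge^rV_n(c)$ by $u\mapsto v\wedge(\partial\lrcorner u)$, where $\partial\lrcorner(u_1\wedge\cdots\wedge u_r)=\sum_{k=1}^r(-1)^{k-1}\partial(u_k)\,u_1\wedge\cdots\wedge\widehat{u_k}\wedge\cdots\wedge u_r$. This action is transported to $B_{r,n}(c)$ through the $B_0(c)$-module isomorphism $B_{r,n}(c)\to\bigwedge^rV_n(c)$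 sending $\Delta_{\boldsymbol\lambda}(H_{r,n}(c))$ (with $\lambda_1\le n-r$) to $X^{r-1+\lambda_1}(c)\wedge X^{r-2+\lambda_2}(c)\wedge\cdots\wedge X^{\lambda_r}(c)$. The generating function $\mathcal E_n(z,w^{-1})$ acts coefficientwise, giving a map $B_{r,n}(c)\to B_{r,n}(c)[z,w^{-1}]$. **The determinant.** For $m\ge0$ let $w^{-m}(c)$ be the value of the polynomial $X^m(c)$ at $X=w^{-1}$, i.e. $w^{-m}(c)=\sum_{i=0}^m(-1)^ic_iw^{-m+i}$. Put $\overline\sigma_-(z)h_j(c)=h_j(c)-h_{j-1}(c)z^{-1}$. Then $\Delta_{\boldsymbol\lambda}(\mathbf w^{-1}(c),\overline\sigma_-(z)H_r(c))$ is $w^{r-1}$ times the determinant of the $r\times r$ matrix whose first row is $\big(w^{-r+1-\lambda_1}(c),\,w^{-r+2-\lambda_2}(c),\dots,w^{-\lambda_r}(c)\big)$ and whose $(k,j)$ entry, for $2\le k\le r$ and $1\le j\le r$, is $\overline\sigma_-(z)h_{\lambda_j-j+k}(c)$.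
   Formalization: The identity is proved only for coefficients of z^a w^b with b ≤ 0 (positive powers of w discarded); read literally it fails for n ≥ 2, e.g. r=1, λ=0: the left side has no positive powers of w, the right side has the term s_1 w = c_1 w. *)

theory Defs
  imports
    "HOL-Library.Poly_Mapping"
    "HOL-Computational_Algebra.Formal_Laurent_Series"
    "HOL-Algebra.Module"
    "HOL-Algebra.QuotRing"
    "Jordan_Normal_Form.Determinant"
begin

section \<open>Polynomial rings\<close>

text \<open>
  A polynomial in variables indexed by natural numbers, with coefficients in \<open>'a\<close>, is a finitely
  supported map from monomials (finitely supported exponent vectors) to \<open>'a\<close>. The polynomial ring
  in the variables with indices \<open>1, \<dots>, N\<close> over a subring \<open>K\<close> of \<open>'a\<close> is cut out by its carrier.
\<close>

type_synonym 'a mpol = "(nat \<Rightarrow>\<^sub>0 nat) \<Rightarrow>\<^sub>0 'a"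
type_synonym b0 = "rat mpol"
type_synonym br = "b0 mpol"

definition ring_on :: "'a::comm_ring_1 set \<Rightarrow> 'a ring" where
  "ring_on S = \<lparr>carrier = S, mult = (*), one = 1, zero = 0, add = (+)\<rparr>"

definition mpol_ring :: "'a::comm_ring_1 set \<Rightarrow> nat \<Rightarrow> 'a mpol ring" where
  "mpol_ring K N = ring_on {p. (\<forall>m. Poly_Mapping.lookup p m \<in> K) \<and>
     (\<forall>m \<in> Poly_Mapping.keys p. Poly_Mapping.keys m \<subseteq> {1..N})}"

text \<open>\<open>B\<^sub>0(c)\<close> and \<open>B\<^sub>r(c) = B\<^sub>0(c)[e\<^sub>1, \<dots>, e\<^sub>r]\<close>.\<close>

definition B0 :: "nat \<Rightarrow> b0 ring" where
  "B0 n = mpol_ring UNIV n"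

definition Br :: "nat \<Rightarrow> nat \<Rightarrow> br ring" where
  "Br n r = mpol_ring (carrier (B0 n)) r"

definition cst :: "'a \<Rightarrow> ('a::zero) mpol" where
  "cst a = Poly_Mapping.single 0 a"

text \<open>
  The sequence \<open>1, x\<^sub>1, \<dots>, x\<^sub>N, 0, 0, \<dots>\<close>: it gives the \<open>c\<^sub>i\<close> (for \<open>N = n\<close>, in \<^typ>\<open>b0\<close>) and the
  \<open>e\<^sub>i\<close> (for \<open>N = r\<close>, in \<^typ>\<open>br\<close>); \<open>alt_gf N\<close> is \<open>1 - x\<^sub>1 z + \<dots> + (-1)\<^sup>N x\<^sub>N z\<^sup>N\<close>, that is
  \<open>c(z)\<close> respectively \<open>E\<^sub>r(z)\<close>.
\<close>

definition vars :: "nat \<Rightarrow> nat \<Rightarrow> ('a::comm_ring_1) mpol" where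
  "vars N i = (if i = 0 then 1
     else if i \<le> N then Poly_Mapping.single (Poly_Mapping.single i 1) 1 else 0)"

definition alt_gf :: "nat \<Rightarrow> ('a::comm_ring_1) mpol fps" where
  "alt_gf N = Abs_fps (\<lambda>i. (- 1) ^ i * vars N i)"

definition cc :: "nat \<Rightarrow> nat \<Rightarrow> b0" where
  "cc n i = vars n i"

definition ss :: "nat \<Rightarrow> nat \<Rightarrow> b0" where
  "ss n i = fps_nth (fps_right_inverse (alt_gf n) 1) i"

definition cE :: "nat \<Rightarrow> nat \<Rightarrow> br fps" where
  "cE n r = Abs_fps (\<lambda>i. cst (fps_nth (alt_gf n) i)) * fps_right_inverse (alt_gf r) 1"

definition hc :: "nat \<Rightarrow> nat \<Rightarrow> int \<Rightarrow> br" where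
  "hc n r j = (if j < 0 then 0 else fps_nth (cE n r) (nat j))"

section \<open>Modules\<close>

definition mod_hom ::
  "'k ring \<Rightarrow> ('k, 'm) module \<Rightarrow> ('k, 'p) module \<Rightarrow> ('m \<Rightarrow> 'p) set" where
  "mod_hom R M N = {f \<in> carrier M \<rightarrow> carrier N.
     (\<forall>x \<in> carrier M. \<forall>y \<in> carrier M. f (x \<oplus>\<^bsub>M\<^esub> y) = f x \<oplus>\<^bsub>N\<^esub> f y) \<and>
     (\<forall>k \<in> carrier R. \<forall>x \<in> carrier M. f (k \<odot>\<^bsub>M\<^esub> x) = k \<odot>\<^bsub>N\<^esub> f x)}"

definition mod_iso ::
  "'k ring \<Rightarrow> ('k, 'm) module \<Rightarrow> ('k, 'p) module \<Rightarrow> ('m \<Rightarrow> 'p) set" where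
  "mod_iso R M N = {f \<in> mod_hom R M N. bij_betw f (carrier M) (carrier N)}"

definition dual_mod :: "'k ring \<Rightarrow> ('k, 'm) module \<Rightarrow> ('m \<Rightarrow> 'k) set" where
  "dual_mod R M = {f \<in> carrier M \<rightarrow> carrier R.
     (\<forall>x \<in> carrier M. \<forall>y \<in> carrier M. f (x \<oplus>\<^bsub>M\<^esub> y) = f x \<oplus>\<^bsub>R\<^esub> f y) \<and>
     (\<forall>k \<in> carrier R. \<forall>x \<in> carrier M. f (k \<odot>\<^bsub>M\<^esub> x) = k \<otimes>\<^bsub>R\<^esub> f x)}"

text \<open>
  The quotient ring \<open>A / I\<close> as a module over \<open>K\<close>, the scalars acting through \<open>\<iota> : K \<rightarrow> A\<close>.
\<close>

definition quot_alg :: "('k \<Rightarrow> 'a) \<Rightarrow> 'a ring \<Rightarrow> 'a set \<Rightarrow> ('k, 'a set) module" where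
  "quot_alg \<iota> A I =
     \<lparr>carrier = carrier (A Quot I), mult = mult (A Quot I), one = one (A Quot I),
      zero = zero (A Quot I), add = add (A Quot I),
      smult = (\<lambda>k C. (I +>\<^bsub>A\<^esub> \<iota> k) \<otimes>\<^bsub>A Quot I\<^esub> C)\<rparr>"

text \<open>
  Modules are records extending rings, so the ring multiplication of a mere module is left
  unspecified.
\<close>

definition quot_mod :: "('k, 'm) module \<Rightarrow> 'm set \<Rightarrow> ('k, 'm set) module" where
  "quot_mod M N =
     \<lparr>carrier = a_rcosets\<^bsub>M\<^esub> N, mult = undefined, one = undefined,
      zero = N, add = set_add M,
      smult = (\<lambda>k C. \<Union>x\<in>C. N +>\<^bsub>M\<^esub> (k \<odot>\<^bsub>M\<^esub> x))\<rparr>"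

definition free_mod :: "'k ring \<Rightarrow> 's set \<Rightarrow> ('k, 's \<Rightarrow> 'k) module" where
  "free_mod R S =
     \<lparr>carrier = {f. (\<forall>x. f x \<in> carrier R) \<and> finite {x. f x \<noteq> \<zero>\<^bsub>R\<^esub>} \<and> (\<forall>x. x \<notin> S \<longrightarrow> f x = \<zero>\<^bsub>R\<^esub>)},
      mult = undefined, one = undefined,
      zero = (\<lambda>x. \<zero>\<^bsub>R\<^esub>), add = (\<lambda>f g x. f x \<oplus>\<^bsub>R\<^esub> g x),
      smult = (\<lambda>k f x. k \<otimes>\<^bsub>R\<^esub> f x)\<rparr>"

definition free_gen :: "'k ring \<Rightarrow> 's \<Rightarrow> 's \<Rightarrow> 'k" where
  "free_gen R x = (\<lambda>y. if y = x then \<one>\<^bsub>R\<^esub> else \<zero>\<^bsub>R\<^esub>)"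

section \<open>Exterior powers\<close>

text \<open>
  The \<open>r\<close>-th exterior power of \<open>M\<close>: the free module on all \<open>r\<close>-tuples of elements of \<open>M\<close>, modulo
  the submodule generated by the relations of multilinearity and alternation.
\<close>

definition tuples :: "('k, 'm) module \<Rightarrow> nat \<Rightarrow> 'm list set" where
  "tuples M r = {us. length us = r \<and> set us \<subseteq> carrier M}"

abbreviation tuple_mod ::
  "'k ring \<Rightarrow> ('k, 'm) module \<Rightarrow> nat \<Rightarrow> ('k, 'm list \<Rightarrow> 'k) module" where
  "tuple_mod R M r \<equiv> free_mod R (tuples M r)"

definition ext_gens :: "'k ring \<Rightarrow> ('k, 'm) module \<Rightarrow> nat \<Rightarrow> ('m list \<Rightarrow> 'k) set" where
  "ext_gens R M r =
     {free_gen R (us[i := x \<oplus>\<^bsub>M\<^esub> y]) \<ominus>\<^bsub>tuple_mod R M r\<^esub>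
        (free_gen R (us[i := x]) \<oplus>\<^bsub>tuple_mod R M r\<^esub> free_gen R (us[i := y])) | us i x y.
        us \<in> tuples M r \<and> i < r \<and> x \<in> carrier M \<and> y \<in> carrier M} \<union>
     {free_gen R (us[i := k \<odot>\<^bsub>M\<^esub> x]) \<ominus>\<^bsub>tuple_mod R M r\<^esub>
        (k \<odot>\<^bsub>tuple_mod R M r\<^esub> free_gen R (us[i := x])) | us i k x.
        us \<in> tuples M r \<and> i < r \<and> k \<in> carrier R \<and> x \<in> carrier M} \<union>
     {free_gen R us | us i j. us \<in> tuples M r \<and> i < j \<and> j < r \<and> us ! i = us ! j}"

definition ext_rels :: "'k ring \<Rightarrow> ('k, 'm) module \<Rightarrow> nat \<Rightarrow> ('m list \<Rightarrow> 'k) set" where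
  "ext_rels R M r = \<Inter>{N. submodule N R (tuple_mod R M r) \<and> ext_gens R M r \<subseteq> N}"

definition ext_power ::
  "'k ring \<Rightarrow> ('k, 'm) module \<Rightarrow> nat \<Rightarrow> ('k, ('m list \<Rightarrow> 'k) set) module" where
  "ext_power R M r = quot_mod (tuple_mod R M r) (ext_rels R M r)"

text \<open>\<open>wedge R M [u\<^sub>1, \<dots>, u\<^sub>r]\<close> is \<open>u\<^sub>1 \<and> \<dots> \<and> u\<^sub>r\<close>.\<close>

definition wedge :: "'k ring \<Rightarrow> ('k, 'm) module \<Rightarrow> 'm list \<Rightarrow> ('m list \<Rightarrow> 'k) set" where
  "wedge R M us =
     ext_rels R M (length us) +>\<^bsub>tuple_mod R M (length us)\<^esub> free_gen R us"

text \<open>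
  The linear maps \<open>u \<mapsto> \<partial> \<rightharpoonup> u\<close> (contraction, lowering the degree by one) and \<open>u \<mapsto> v \<and> u\<close> (raising
  it by one); their values on the generators \<open>u\<^sub>1 \<and> \<dots> \<and> u\<^sub>r\<close> determine them. Positions in a list
  start at 0, so that the sign \<open>(-1)\<^bsup>k-1\<^esup>\<close> of the \<open>k\<close>-th factor becomes \<open>(-1)\<^sup>k\<close>.
\<close>

definition contract ::
  "'k ring \<Rightarrow> ('k, 'm) module \<Rightarrow> nat \<Rightarrow> ('m \<Rightarrow> 'k) \<Rightarrow> ('m list \<Rightarrow> 'k) set \<Rightarrow> ('m list \<Rightarrow> 'k) set"
  where
  "contract R M r d =
     (SOME f. f \<in> mod_hom R (ext_power R M r) (ext_power R M (r - 1)) \<and>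
        (\<forall>us \<in> tuples M r. f (wedge R M us) =
           (\<Oplus>\<^bsub>ext_power R M (r - 1)\<^esub> k\<in>{..<r}.
              (((\<ominus>\<^bsub>R\<^esub> \<one>\<^bsub>R\<^esub>) [^]\<^bsub>R\<^esub> k) \<otimes>\<^bsub>R\<^esub> d (us ! k)) \<odot>\<^bsub>ext_power R M (r - 1)\<^esub>
                wedge R M (take k us @ drop (Suc k) us))))"

definition wedge_left ::
  "'k ring \<Rightarrow> ('k, 'm) module \<Rightarrow> nat \<Rightarrow> 'm \<Rightarrow> ('m list \<Rightarrow> 'k) set \<Rightarrow> ('m list \<Rightarrow> 'k) set"
  where
  "wedge_left R M r v =
     (SOME f. f \<in> mod_hom R (ext_power R M r) (ext_power R M (Suc r)) \<and>
        (\<forall>us \<in> tuples M r. f (wedge R M us) = wedge R M (v # us)))"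

text \<open>The action of \<open>v \<otimes> \<partial> \<in> gl(M)\<close> on the \<open>r\<close>-th exterior power, for \<open>r \<ge> 1\<close>.\<close>

definition gl_act ::
  "'k ring \<Rightarrow> ('k, 'm) module \<Rightarrow> nat \<Rightarrow> 'm \<Rightarrow> ('m \<Rightarrow> 'k) \<Rightarrow>
     ('m list \<Rightarrow> 'k) set \<Rightarrow> ('m list \<Rightarrow> 'k) set" where
  "gl_act R M r v d u = wedge_left R M (r - 1) v (contract R M r d u)"

section \<open>The module \<open>V\<^sub>n(c)\<close> and the dual basis\<close>

definition Xc :: "nat \<Rightarrow> nat \<Rightarrow> b0 poly" where
  "Xc n j = (\<Sum>i\<le>j. Polynomial.monom ((- 1) ^ i * cc n i) (j - i))"

definition Vring :: "nat \<Rightarrow> b0 poly ring" where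
  "Vring n = ring_on {p. \<forall>i. Polynomial.coeff p i \<in> carrier (B0 n)}"

definition Videal :: "nat \<Rightarrow> b0 poly set" where
  "Videal n = Idl\<^bsub>Vring n\<^esub> {Xc n n}"

definition Vn :: "nat \<Rightarrow> (b0, b0 poly set) module" where
  "Vn n = quot_alg (\<lambda>k. [:k:]) (Vring n) (Videal n)"

definition Xcl :: "nat \<Rightarrow> nat \<Rightarrow> b0 poly set" where
  "Xcl n j = Videal n +>\<^bsub>Vring n\<^esub> Xc n j"

definition dual_s :: "nat \<Rightarrow> nat \<Rightarrow> b0 poly set \<Rightarrow> b0" where
  "dual_s n j = (SOME f. f \<in> dual_mod (B0 n) (Vn n) \<and>
     (\<forall>i<n. f (Xcl n i) = (if i = j then 1 else 0)))"

section \<open>The ring \<open>B\<^bsub>r,n\<^esub>(c)\<close> and its identification with the exterior power\<close>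

definition Irn :: "nat \<Rightarrow> nat \<Rightarrow> br set" where
  "Irn n r = Idl\<^bsub>Br n r\<^esub> {hc n r (int j) | j. n - r + 1 \<le> j \<and> j \<le> n}"

definition Brn :: "nat \<Rightarrow> nat \<Rightarrow> (b0, br set) module" where
  "Brn n r = quot_alg cst (Br n r) (Irn n r)"

definition proj :: "nat \<Rightarrow> nat \<Rightarrow> br \<Rightarrow> br set" where
  "proj n r b = Irn n r +>\<^bsub>Br n r\<^esub> b"

text \<open>
  Partitions with at most \<open>r\<close> parts, padded with zeros to length \<open>r\<close>; \<open>\<lambda>\<^sub>j\<close> is \<open>lam ! (j - 1)\<close>.
  Matrix indices start at 0 too; this leaves \<open>\<lambda>\<^sub>j - j + k\<close> unchanged and turns \<open>r - j + \<lambda>\<^sub>j\<close> into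
  \<open>r - 1 - j + lam ! j\<close>.
\<close>

definition box_partitions :: "nat \<Rightarrow> nat \<Rightarrow> nat list set" where
  "box_partitions r n = {lam. length lam = r \<and> sorted_wrt (\<ge>) lam \<and> (\<forall>p \<in> set lam. p \<le> n - r)}"

definition Delta :: "nat \<Rightarrow> nat \<Rightarrow> nat list \<Rightarrow> br" where
  "Delta n r lam = det (mat r r (\<lambda>(k, j). hc n r (int (lam ! j) - int j + int k)))"

definition wedge_of :: "nat \<Rightarrow> nat \<Rightarrow> nat list \<Rightarrow> (b0 poly set list \<Rightarrow> b0) set" where
  "wedge_of n r lam = wedge (B0 n) (Vn n) (map (\<lambda>j. Xcl n (r - 1 - j + lam ! j)) [0..<r])"

text \<open>
  The isomorphism sending each \<open>\<Delta>\<^sub>\<lambda>\<close> with \<open>\<lambda>\<^sub>1 \<le> n - r\<close> to the corresponding wedge. Since these \<open>\<Delta>\<^sub>\<lambda>\<close> form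
  a basis, the choice is unique on the carrier.
\<close>

definition phi :: "nat \<Rightarrow> nat \<Rightarrow> br set \<Rightarrow> (b0 poly set list \<Rightarrow> b0) set" where
  "phi n r = (SOME f. f \<in> mod_iso (B0 n) (Brn n r) (ext_power (B0 n) (Vn n) r) \<and>
     (\<forall>lam \<in> box_partitions r n. f (proj n r (Delta n r lam)) = wedge_of n r lam))"

definition gl_act_Brn ::
  "nat \<Rightarrow> nat \<Rightarrow> b0 poly set \<Rightarrow> (b0 poly set \<Rightarrow> b0) \<Rightarrow> br set \<Rightarrow> br set" where
  "gl_act_Brn n r v d x =
     inv_into (carrier (Brn n r)) (phi n r) (gl_act (B0 n) (Vn n) r v d (phi n r x))"

text \<open>
  \<open>gen_E n r x a b\<close> is the coefficient of \<open>z\<^sup>a w\<^sup>b\<close> in \<open>\<E>\<^sub>n(z, w\<^sup>-\<^sup>1)(x)\<close>, for integers \<open>a\<close>, \<open>b\<close>; only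
  \<open>0 \<le> a \<le> n - 1\<close> and \<open>0 \<le> -b \<le> n - 1\<close> occur.
\<close>

definition gen_E :: "nat \<Rightarrow> nat \<Rightarrow> br set \<Rightarrow> int \<Rightarrow> int \<Rightarrow> br set" where
  "gen_E n r x a b =
     (if 0 \<le> a \<and> a \<le> int n - 1 \<and> 0 \<le> - b \<and> - b \<le> int n - 1
      then gl_act_Brn n r (Xcl n (nat a)) (dual_s n (nat (- b))) x
      else \<zero>\<^bsub>Brn n r\<^esub>)"

section \<open>Laurent series in \<open>z\<close> and \<open>w\<close>\<close>

text \<open>
  The right-hand side is evaluated in \<open>B\<^sub>r(c)((z))((w))\<close> (the outer Laurent variable is \<open>w\<close>, the
  inner one \<open>z\<close>) and then projected to \<open>B\<^bsub>r,n\<^esub>(c)\<close> coefficient by coefficient. The projection is a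
  homomorphism of \<open>B\<^sub>0(c)\<close>-algebras, so it does not matter whether it is applied before or after
  multiplying by a Laurent polynomial in \<open>z\<close>, \<open>w\<close> over \<open>B\<^sub>0(c)\<close>.

  Pitfall: \<open>\<E>\<^sub>n(z, w\<^sup>-\<^sup>1)\<close> takes values in \<open>B\<^bsub>r,n\<^esub>(c)[z, w\<^sup>-\<^sup>1]\<close>, and an identity with a product such as
  \<open>(1 + s\<^sub>1 w + \<dots> + s\<^bsub>n-1\<^esub> w\<^bsup>n-1\<^esup>) w\<^bsup>-m\<^esup>(c) = w\<^bsup>-m\<^esup> + (positive powers of w)\<close> is to be read there, that is,
  with the positive powers of \<open>w\<close> discarded. For \<open>r = 1\<close>, \<open>n \<ge> 2\<close> and the empty partition, for
  example, the product is \<open>1 + s\<^sub>1 w + \<dots> + s\<^bsub>n-1\<^esub> w\<^bsup>n-1\<^esup>\<close>, whereas \<open>\<E>\<^sub>n\<close> contributes only \<open>1\<close>.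
\<close>

type_synonym zw = "br fls fls"

definition coeff_zw :: "zw \<Rightarrow> int \<Rightarrow> int \<Rightarrow> br" where
  "coeff_zw F a b = fls_nth (fls_nth F b) a"

definition zvar :: zw where "zvar = fls_const fls_X"
definition zinv :: zw where "zinv = fls_const fls_X_inv"
definition wvar :: zw where "wvar = fls_X"
definition winv :: zw where "winv = fls_X_inv"

definition br_zw :: "br \<Rightarrow> zw" where
  "br_zw b = fls_const (fls_const b)"

definition b0_zw :: "b0 \<Rightarrow> zw" where
  "b0_zw b = br_zw (cst b)"

definition cE_zw :: "nat \<Rightarrow> nat \<Rightarrow> zw" where
  "cE_zw n r = fls_const (fps_to_fls (cE n r))"

text \<open>\<open>wneg n m\<close> is \<open>w\<^bsup>-m\<^esup>(c)\<close>, and \<open>sigma_h n r j\<close> is the image of \<open>h\<^sub>j(c)\<close> under \<open>\<sigma>\<^sub>-(z)\<close> (with a bar).\<close>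

definition wneg :: "nat \<Rightarrow> nat \<Rightarrow> zw" where
  "wneg n m = poly (map_poly b0_zw (Xc n m)) winv"

definition sigma_h :: "nat \<Rightarrow> nat \<Rightarrow> int \<Rightarrow> zw" where
  "sigma_h n r j = br_zw (hc n r j) - br_zw (hc n r (j - 1)) * zinv"

definition Delta_w :: "nat \<Rightarrow> nat \<Rightarrow> nat list \<Rightarrow> zw" where
  "Delta_w n r lam = wvar ^ (r - 1) *
     det (mat r r (\<lambda>(k, j). if k = 0 then wneg n (r - 1 - j + lam ! j)
        else sigma_h n r (int (lam ! j) - int j + int k)))"

end

theory Submission
  imports Defs
begin

text \<open>
  Both sides are compared coefficient by coefficient, and the bridge between them is one family of
  determinants. Write \<open>1 / E\<^sub>r(z) = \<Sum>\<^sub>j p\<^sub>j z\<^sup>j\<close>. For polynomials \<open>f\<^sub>0, \<dots>, f\<^bsub>r-1\<^esub>\<close> in \<open>X\<close> let \<open>D(f)\<close> be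
  the determinant of the columns \<open>L(f\<^sub>j)\<close>, where \<open>L\<close> is linear and \<open>X\<^sup>m\<close> goes to the column with
  entries \<open>p\<^bsub>m-r+1+k\<^esub>\<close>, \<open>0 \<le> k < r\<close>. Then \<open>X\<^sup>m(c)\<close> goes to the column with entries
  \<open>h\<^bsub>m-r+1+k\<^esub>(c)\<close>, so the Schur determinants are the \<open>D\<close> of the basis vectors \<open>X\<^sup>m(c)\<close>. Being
  multilinear and alternating, \<open>D\<close> induces a map \<open>\<psi>\<close> from the exterior power of \<open>V\<^sub>n(c)\<close> to
  \<open>B\<^bsub>r,n\<^esub>(c)\<close> (\<open>psi_exists\<close>), and the identification of the two modules is its inverse
  (\<open>phi_inverse\<close>). That \<open>\<psi>\<close> is bijective is the statement that the Schur determinants of the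
  partitions in the box form a basis:

  \<^item> They span. Multiplication by \<open>X\<close> acts on the columns \<open>L(f)\<close> by the companion matrix \<open>A\<close> with
    \<open>det (1 - z A) = E\<^sub>r(z)\<close>, whence \<open>E\<^sub>r(z) D(f) = D((1 - z X) f)\<close> (\<open>alt_gf_h_det\<close>). So the span of
    the \<open>D(f)\<close> is closed under multiplication by the \<open>e\<^sub>i\<close>; it contains \<open>1\<close>. The same argument shows
    that \<open>I\<^bsub>r,n\<^esub>(c)\<close> lies in the span of the \<open>D(f)\<close> with an argument divisible by \<open>X\<^sup>n(c)\<close>.

  \<^item> They are independent. Replace the \<open>e\<^sub>i\<close> by elementary symmetric polynomials in \<open>x\<^sub>1, \<dots>, x\<^sub>r\<close>.
    Up to the Vandermonde factor, \<open>D(f)\<close> becomes \<open>det (f\<^sub>j(x\<^sub>i))\<close> (\<open>antisym_lift_h_det\<close>), and applying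
    the functionals dual to the \<open>X\<^sup>a(c)\<close> in every variable yields the coordinates of
    \<open>f\<^sub>0 \<and> \<dots> \<and> f\<^bsub>r-1\<^esub>\<close> (\<open>pluecker_h_det\<close>). They vanish if some \<open>f\<^sub>j\<close> is divisible by \<open>X\<^sup>n(c)\<close>.

  Now let \<open>m\<^sub>j = r - 1 - j + \<lambda>\<^sub>j\<close>, counting \<open>j\<close> from \<open>0\<close>. On the left, the coefficient of
  \<open>z\<^sup>a w\<^bsup>-q\<^esup>\<close> is \<open>\<psi>\<close> of \<open>X\<^sup>a(c) \<and> (\<partial>\<^sup>q(s) contracted with X\<^bsup>m\<^sub>0\<^esup>(c) \<and> \<dots>)\<close>, that is the sum over the \<open>k\<close>
  with \<open>m\<^sub>k = q\<close> of \<open>(-1)\<^sup>k D(X\<^sup>a(c), \<dots>)\<close> with \<open>X\<^bsup>m\<^sub>k\<^esup>(c)\<close> omitted (\<open>gl_act_Delta\<close>). On the right,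
  expand the determinant along its first row. The factor \<open>1 + s\<^sub>1 w + \<dots>\<close> reduces the entry
  \<open>w\<^bsup>-m\<^esup>(c)\<close> to \<open>w\<^bsup>-m\<^esup>\<close> up to positive powers of \<open>w\<close> (\<open>s_wneg_nth\<close>), and the minor belonging to \<open>k\<close>,
  multiplied by \<open>z\<^bsup>r-1\<^esup> c(z) / E\<^sub>r(z)\<close>, is the generating function in \<open>a\<close> of the same determinants,
  because row operations with \<open>z\<^sup>-\<^sup>1\<close> clear a first column of the form \<open>(z\<^bsup>r-1-i\<^esup>)\<^sub>i\<close> (\<open>repl_det_nth\<close>).
  So the coefficients at \<open>w\<^sup>b\<close>, \<open>b \<le> 0\<close>, already agree in \<open>B\<^sub>r(c)\<close> where the left-hand side is given by
  such determinants, and for \<open>a < 0\<close> or \<open>a \<ge> n\<close> the determinants lie in \<open>I\<^bsub>r,n\<^esub>(c)\<close>.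
\<close>

section \<open>Homomorphisms and quotients of modules\<close>

lemma mod_homI:
  assumes "\<And>x. x \<in> carrier M \<Longrightarrow> f x \<in> carrier N"
    and "\<And>x y. x \<in> carrier M \<Longrightarrow> y \<in> carrier M \<Longrightarrow> f (x \<oplus>\<^bsub>M\<^esub> y) = f x \<oplus>\<^bsub>N\<^esub> f y"
    and "\<And>k x. k \<in> carrier R \<Longrightarrow> x \<in> carrier M \<Longrightarrow> f (k \<odot>\<^bsub>M\<^esub> x) = k \<odot>\<^bsub>N\<^esub> f x"
  shows "f \<in> mod_hom R M N"
  using assms by (auto simp: mod_hom_def)

lemma mod_hom_closed: "f \<in> mod_hom R M N \<Longrightarrow> x \<in> carrier M \<Longrightarrow> f x \<in> carrier N"
  and mod_hom_add: "f \<in> mod_hom R M N \<Longrightarrow> x \<in> carrier M \<Longrightarrow> y \<in> carrier M \<Longrightarrow>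
    f (x \<oplus>\<^bsub>M\<^esub> y) = f x \<oplus>\<^bsub>N\<^esub> f y"
  and mod_hom_smult: "f \<in> mod_hom R M N \<Longrightarrow> k \<in> carrier R \<Longrightarrow> x \<in> carrier M \<Longrightarrow>
    f (k \<odot>\<^bsub>M\<^esub> x) = k \<odot>\<^bsub>N\<^esub> f x"
  by (auto simp: mod_hom_def)

lemma mod_hom_zero:
  assumes "module R M" "module R N" "f \<in> mod_hom R M N"
  shows "f \<zero>\<^bsub>M\<^esub> = \<zero>\<^bsub>N\<^esub>"
proof -
  interpret M: module R M by fact
  interpret N: module R N by fact
  have "f (\<zero>\<^bsub>R\<^esub> \<odot>\<^bsub>M\<^esub> \<zero>\<^bsub>M\<^esub>) = \<zero>\<^bsub>R\<^esub> \<odot>\<^bsub>N\<^esub> f \<zero>\<^bsub>M\<^esub>"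
    using assms(3) by (intro mod_hom_smult) auto
  thus ?thesis using mod_hom_closed[OF assms(3) M.zero_closed] by simp
qed

lemma mod_hom_minus:
  assumes "module R M" "module R N" "f \<in> mod_hom R M N" "x \<in> carrier M" "y \<in> carrier M"
  shows "f (x \<ominus>\<^bsub>M\<^esub> y) = f x \<ominus>\<^bsub>N\<^esub> f y"
proof -
  interpret M: module R M by fact
  interpret N: module R N by fact
  have eq: "\<ominus>\<^bsub>M\<^esub> y = (\<ominus>\<^bsub>R\<^esub> \<one>\<^bsub>R\<^esub>) \<odot>\<^bsub>M\<^esub> y" using assms by (simp add: M.smult_l_minus)
  have "f (\<ominus>\<^bsub>M\<^esub> y) = (\<ominus>\<^bsub>R\<^esub> \<one>\<^bsub>R\<^esub>) \<odot>\<^bsub>N\<^esub> f y"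
    unfolding eq using assms by (intro mod_hom_smult[OF assms(3)]) auto
  also have "\<dots> = \<ominus>\<^bsub>N\<^esub> f y" using mod_hom_closed[OF assms(3,5)] by (simp add: N.smult_l_minus)
  finally show ?thesis using assms by (simp add: a_minus_def mod_hom_add[OF assms(3)])
qed

lemma mod_hom_finsum:
  assumes "module R M" "module R N" "f \<in> mod_hom R M N" "finite A" "g \<in> A \<rightarrow> carrier M"
  shows "f (\<Oplus>\<^bsub>M\<^esub>i\<in>A. g i) = (\<Oplus>\<^bsub>N\<^esub>i\<in>A. f (g i))"
  using assms(4,5)
proof (induction A)
  case empty
  interpret M: module R M by fact
  interpret N: module R N by fact
  show ?case using mod_hom_zero[OF assms(1-3)] by simp
next
  case (insert a A)
  interpret M: module R M by fact
  interpret N: module R N by fact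
  show ?case using insert mod_hom_closed[OF assms(3)]
    by (simp add: mod_hom_add[OF assms(3)] Pi_def)
qed

lemma mod_hom_compose:
  assumes "f \<in> mod_hom R M N" "g \<in> mod_hom R N P"
  shows "(\<lambda>x. g (f x)) \<in> mod_hom R M P"
  by (rule mod_homI) (simp_all add: mod_hom_closed[OF assms(1)] mod_hom_closed[OF assms(2)]
      mod_hom_add[OF assms(1)] mod_hom_add[OF assms(2)]
      mod_hom_smult[OF assms(1)] mod_hom_smult[OF assms(2)])

text \<open>
  Uniqueness statements below take this form: two homomorphisms that agree on a generating set have
  an equalizer that is a submodule containing the generators, hence everything.
\<close>

lemma mod_hom_equalizer:
  assumes "module R M" "module R N" "f \<in> mod_hom R M N" "g \<in> mod_hom R M N"
  shows "submodule {x \<in> carrier M. f x = g x} R M"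
proof -
  interpret M: module R M by fact
  interpret N: module R N by fact
  have neg: "h (\<ominus>\<^bsub>M\<^esub> x) = \<ominus>\<^bsub>N\<^esub> h x" if "h \<in> mod_hom R M N" "x \<in> carrier M" for h x
    using mod_hom_minus[OF assms(1,2) that(1) M.zero_closed that(2)] that mod_hom_closed[OF that]
      mod_hom_zero[OF assms(1,2) that(1)]
    by (simp add: a_minus_def)
  show ?thesis
    using assms(3,4)
    by (intro M.submoduleI) (auto simp: neg mod_hom_zero[OF assms(1,2)]
        mod_hom_add[OF assms(3)] mod_hom_add[OF assms(4)]
        mod_hom_smult[OF assms(3)] mod_hom_smult[OF assms(4)])
qed

text \<open>
  The module axioms are closure conditions and equations, and negatives map to negatives, so all of
  them pass to the image of a map that respects the operations. Both kinds of quotient, \<open>quot_mod\<close> and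
  \<open>quot_alg\<close>, receive their module structure from this one lemma.
\<close>

lemma module_surj_image:
  assumes "module R M" and surj: "p ` carrier M = carrier Q"
    and add: "\<And>x y. x \<in> carrier M \<Longrightarrow> y \<in> carrier M \<Longrightarrow> p (x \<oplus>\<^bsub>M\<^esub> y) = p x \<oplus>\<^bsub>Q\<^esub> p y"
    and sm: "\<And>k x. k \<in> carrier R \<Longrightarrow> x \<in> carrier M \<Longrightarrow> p (k \<odot>\<^bsub>M\<^esub> x) = k \<odot>\<^bsub>Q\<^esub> p x"
    and zero: "p \<zero>\<^bsub>M\<^esub> = \<zero>\<^bsub>Q\<^esub>"
  shows "module R Q" and "p \<in> mod_hom R M Q"
proof -
  interpret M: module R M by fact
  have car: "x \<in> carrier Q \<longleftrightarrow> (\<exists>y\<in>carrier M. x = p y)" for x using surj by auto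
  show "module R Q"
  proof (rule moduleI)
    show "abelian_group Q"
    proof (rule abelian_groupI)
      show "\<exists>y\<in>carrier Q. y \<oplus>\<^bsub>Q\<^esub> x = \<zero>\<^bsub>Q\<^esub>" if x: "x \<in> carrier Q" for x
      proof -
        obtain y where y: "y \<in> carrier M" "x = p y" using x car[of x] by blast
        have "p (\<ominus>\<^bsub>M\<^esub> y) \<oplus>\<^bsub>Q\<^esub> x = \<zero>\<^bsub>Q\<^esub>"
          using y by (simp add: add[symmetric] M.l_neg zero)
        thus ?thesis using y car by blast
      qed
    qed (auto simp: car add[symmetric] zero[symmetric] M.a_ac)
  qed (auto simp: car add[symmetric] sm[symmetric] M.smult_l_distr M.smult_r_distr
      M.smult_assoc1 M.R.cring_axioms)
  show "p \<in> mod_hom R M Q"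
    by (rule mod_homI) (auto simp: car add sm)
qed

text \<open>
  The only way in which homomorphisms out of a quotient are constructed below.
\<close>

lemma mod_hom_factor:
  assumes "module R M" "p \<in> mod_hom R M Q" "p ` carrier M = carrier Q" "h \<in> mod_hom R M N"
    and wd: "\<And>x y. x \<in> carrier M \<Longrightarrow> y \<in> carrier M \<Longrightarrow> p x = p y \<Longrightarrow> h x = h y"
  obtains f where "f \<in> mod_hom R Q N" "\<And>x. x \<in> carrier M \<Longrightarrow> f (p x) = h x"
proof -
  interpret M: module R M by fact
  define f where "f = (\<lambda>q. h (inv_into (carrier M) p q))"
  have f: "f (p x) = h x" if "x \<in> carrier M" for x
    unfolding f_def by (rule wd) (use that in \<open>auto intro: inv_into_into f_inv_into_f\<close>)
  have car: "x \<in> carrier Q \<longleftrightarrow> (\<exists>y\<in>carrier M. x = p y)" for x using assms(3) by auto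
  have "f \<in> mod_hom R Q N"
    by (rule mod_homI) (auto simp: car mod_hom_add[OF assms(2), symmetric] f
        mod_hom_smult[OF assms(2), symmetric] mod_hom_closed[OF assms(4)]
        mod_hom_add[OF assms(4)] mod_hom_smult[OF assms(4)])
  thus ?thesis using that f by blast
qed

lemma submodule_abelian_subgroup:
  assumes "module R M" "submodule N R M"
  shows "abelian_subgroup N M"
proof -
  interpret M: module R M by fact
  show ?thesis using submodule.axioms(1)[OF assms(2)]
    by (intro abelian_subgroupI3 additive_subgroup.intro) (auto intro: M.abelian_group_axioms)
qed

lemma coset_eq_iff:
  assumes "module R M" "submodule N R M" "x \<in> carrier M" "y \<in> carrier M"
  shows "N +>\<^bsub>M\<^esub> x = N +>\<^bsub>M\<^esub> y \<longleftrightarrow> x \<ominus>\<^bsub>M\<^esub> y \<in> N"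
proof -
  interpret abelian_subgroup N M using assms submodule_abelian_subgroup by blast
  have "N +>\<^bsub>M\<^esub> x = N +>\<^bsub>M\<^esub> y \<longleftrightarrow> x \<in> N +>\<^bsub>M\<^esub> y"
    using assms a_repr_independence'[of x y] a_repr_independence'[of y x] a_rcos_self[of x] by auto
  thus ?thesis using a_rcos_module[OF assms(4,3)] by (simp add: a_minus_def)
qed

lemma quot_mod_props:
  assumes "module R M" "submodule N R M"
  shows "module R (quot_mod M N)" "(\<lambda>x. N +>\<^bsub>M\<^esub> x) \<in> mod_hom R M (quot_mod M N)"
    "(\<lambda>x. N +>\<^bsub>M\<^esub> x) ` carrier M = carrier (quot_mod M N)"
proof -
  interpret M: module R M by fact
  interpret sub: submodule N R M by fact
  interpret N: abelian_subgroup N M using assms submodule_abelian_subgroup by blast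
  show surj: "(\<lambda>x. N +>\<^bsub>M\<^esub> x) ` carrier M = carrier (quot_mod M N)"
    by (auto simp: quot_mod_def A_RCOSETS_def')
  have sm: "N +>\<^bsub>M\<^esub> (k \<odot>\<^bsub>M\<^esub> x) = k \<odot>\<^bsub>quot_mod M N\<^esub> (N +>\<^bsub>M\<^esub> x)"
    if k: "k \<in> carrier R" and x: "x \<in> carrier M" for k x
  proof -
    have "x \<in> N +>\<^bsub>M\<^esub> x" using x N.a_rcos_self by blast
    moreover have "N +>\<^bsub>M\<^esub> (k \<odot>\<^bsub>M\<^esub> y) = N +>\<^bsub>M\<^esub> (k \<odot>\<^bsub>M\<^esub> x)" if y: "y \<in> N +>\<^bsub>M\<^esub> x" for y
    proof -
      have yc: "y \<in> carrier M" using y x N.a_elemrcos_carrier by blast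
      have "y \<ominus>\<^bsub>M\<^esub> x \<in> N" using y x yc N.a_rcos_module by (simp add: a_minus_def)
      hence "k \<odot>\<^bsub>M\<^esub> (y \<ominus>\<^bsub>M\<^esub> x) \<in> N" using k by simp
      moreover have "k \<odot>\<^bsub>M\<^esub> (y \<ominus>\<^bsub>M\<^esub> x) = k \<odot>\<^bsub>M\<^esub> y \<ominus>\<^bsub>M\<^esub> k \<odot>\<^bsub>M\<^esub> x"
        using k x yc by (simp add: a_minus_def M.smult_r_distr M.smult_r_minus)
      ultimately show ?thesis using coset_eq_iff[OF assms] k x yc by simp
    qed
    ultimately have ne: "N +>\<^bsub>M\<^esub> x \<noteq> {}" and ball: "\<forall>y\<in>N +>\<^bsub>M\<^esub> x. N +>\<^bsub>M\<^esub> (k \<odot>\<^bsub>M\<^esub> y) = N +>\<^bsub>M\<^esub> (k \<odot>\<^bsub>M\<^esub> x)"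
      by blast+
    hence "(\<Union>y\<in>N +>\<^bsub>M\<^esub> x. N +>\<^bsub>M\<^esub> (k \<odot>\<^bsub>M\<^esub> y)) = N +>\<^bsub>M\<^esub> (k \<odot>\<^bsub>M\<^esub> x)"
      by (intro equalityI subsetI) blast+
    thus ?thesis by (simp add: quot_mod_def)
  qed
  have add: "N +>\<^bsub>M\<^esub> (x \<oplus>\<^bsub>M\<^esub> y) = (N +>\<^bsub>M\<^esub> x) \<oplus>\<^bsub>quot_mod M N\<^esub> (N +>\<^bsub>M\<^esub> y)"
    if "x \<in> carrier M" "y \<in> carrier M" for x y
    using that by (simp add: quot_mod_def N.a_rcos_sum)
  have zero: "N +>\<^bsub>M\<^esub> \<zero>\<^bsub>M\<^esub> = \<zero>\<^bsub>quot_mod M N\<^esub>"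
    by (simp add: quot_mod_def N.a_subset)
  show "module R (quot_mod M N)" "(\<lambda>x. N +>\<^bsub>M\<^esub> x) \<in> mod_hom R M (quot_mod M N)"
    using module_surj_image[where p = "\<lambda>x. N +>\<^bsub>M\<^esub> x", OF assms(1) surj add sm zero] by blast+
qed

section \<open>Exterior powers\<close>

lemma free_mod_module:
  assumes "cring R"
  shows "module R (free_mod R S)"
proof -
  interpret R: cring R by fact
  have fin: "finite {x. f x \<oplus>\<^bsub>R\<^esub> g x \<noteq> \<zero>\<^bsub>R\<^esub>}"
    if "finite {x. f x \<noteq> \<zero>\<^bsub>R\<^esub>}" "finite {x. g x \<noteq> \<zero>\<^bsub>R\<^esub>}" for f g :: "'b \<Rightarrow> 'a"
    by (rule finite_subset[OF _ finite_UnI[OF that]]) auto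
  have fin': "finite {x. k \<otimes>\<^bsub>R\<^esub> g x \<noteq> \<zero>\<^bsub>R\<^esub>}"
    if "finite {x. g x \<noteq> \<zero>\<^bsub>R\<^esub>}" "k \<in> carrier R" for k and g :: "'b \<Rightarrow> 'a"
    by (rule finite_subset[OF _ that(1)]) (use that in auto)
  show ?thesis
  proof (rule moduleI)
    show "abelian_group (free_mod R S)"
    proof (rule abelian_groupI)
      fix x assume x: "x \<in> carrier (free_mod R S)"
      have "finite {y. \<ominus>\<^bsub>R\<^esub> x y \<noteq> \<zero>\<^bsub>R\<^esub>}"
        by (rule finite_subset[of _ "{y. x y \<noteq> \<zero>\<^bsub>R\<^esub>}"]) (use x in \<open>auto simp: free_mod_def\<close>)
      thus "\<exists>y\<in>carrier (free_mod R S). y \<oplus>\<^bsub>free_mod R S\<^esub> x = \<zero>\<^bsub>free_mod R S\<^esub>"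
        using x by (intro bexI[of _ "\<lambda>y. \<ominus>\<^bsub>R\<^esub> x y"]) (auto simp: free_mod_def R.l_neg)
    qed (auto simp: free_mod_def R.a_ac fin)
  qed (auto simp: free_mod_def R.a_ac R.m_ac R.l_distr R.r_distr fin' R.cring_axioms)
qed

lemma free_gen_closed:
  assumes "cring R" "x \<in> S"
  shows "free_gen R x \<in> carrier (free_mod R S)"
proof -
  interpret R: cring R by fact
  have "{y. (if y = x then \<one>\<^bsub>R\<^esub> else \<zero>\<^bsub>R\<^esub>) \<noteq> \<zero>\<^bsub>R\<^esub>} \<subseteq> {x}" by auto
  hence "finite {y. (if y = x then \<one>\<^bsub>R\<^esub> else \<zero>\<^bsub>R\<^esub>) \<noteq> \<zero>\<^bsub>R\<^esub>}" using finite_subset by blast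
  thus ?thesis using assms(2) by (auto simp: free_mod_def free_gen_def)
qed

definition lin_ext :: "'k ring \<Rightarrow> ('k, 'p) module \<Rightarrow> ('s \<Rightarrow> 'p) \<Rightarrow> ('s \<Rightarrow> 'k) \<Rightarrow> 'p" where
  "lin_ext R N g f = (\<Oplus>\<^bsub>N\<^esub>x\<in>{x. f x \<noteq> \<zero>\<^bsub>R\<^esub>}. f x \<odot>\<^bsub>N\<^esub> g x)"

text \<open>
  The support of \<open>f\<close> changes under addition and scaling; summing over a larger finite set makes the
  sums comparable.
\<close>

lemma lin_ext_eq:
  assumes "module R N" "g \<in> S \<rightarrow> carrier N" "f \<in> carrier (free_mod R S)"
    and "finite A" "A \<subseteq> S" "{x. f x \<noteq> \<zero>\<^bsub>R\<^esub>} \<subseteq> A"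
  shows "lin_ext R N g f = (\<Oplus>\<^bsub>N\<^esub>x\<in>A. f x \<odot>\<^bsub>N\<^esub> g x)"
proof -
  interpret N: module R N by fact
  show ?thesis unfolding lin_ext_def
    using assms(2-)
    by (intro N.add.finprod_mono_neutral_cong_left) (auto simp: free_mod_def Pi_def)
qed

text \<open>
  The universal property of the free module.
\<close>

lemma lin_ext_hom:
  assumes "module R N" "g \<in> S \<rightarrow> carrier N"
  shows "lin_ext R N g \<in> mod_hom R (free_mod R S) N"
    and "x \<in> S \<Longrightarrow> lin_ext R N g (free_gen R x) = g x"
proof -
  interpret N: module R N by fact
  let ?F = "free_mod R S"
  interpret F: module R ?F by (rule free_mod_module) (rule N.R.cring_axioms)
  let ?s = "\<lambda>f. {x. f x \<noteq> \<zero>\<^bsub>R\<^esub>}"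
  have fin: "finite (?s f)" "?s f \<subseteq> S" if "f \<in> carrier ?F" for f
    using that by (auto simp: free_mod_def)
  have car: "f x \<in> carrier R" if "f \<in> carrier ?F" for f x
    using that by (auto simp: free_mod_def)
  have pt: "(f \<oplus>\<^bsub>?F\<^esub> h) x = f x \<oplus>\<^bsub>R\<^esub> h x" "(k \<odot>\<^bsub>?F\<^esub> f) x = k \<otimes>\<^bsub>R\<^esub> f x" for f h k x
    by (simp_all add: free_mod_def)
  have g: "g x \<in> carrier N" if "x \<in> S" for x using that assms(2) by auto
  show "lin_ext R N g \<in> mod_hom R ?F N"
  proof (rule mod_homI)
    fix f assume f: "f \<in> carrier ?F"
    show "lin_ext R N g f \<in> carrier N" unfolding lin_ext_def
      using car[OF f] g fin[OF f] by (intro N.finsum_closed) auto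
  next
    fix f h assume f: "f \<in> carrier ?F" and h: "h \<in> carrier ?F"
    let ?A = "?s f \<union> ?s h"
    have A: "finite ?A" "?A \<subseteq> S" using fin f h by auto
    have "lin_ext R N g (f \<oplus>\<^bsub>?F\<^esub> h) = (\<Oplus>\<^bsub>N\<^esub>x\<in>?A. (f \<oplus>\<^bsub>?F\<^esub> h) x \<odot>\<^bsub>N\<^esub> g x)"
    proof (rule lin_ext_eq[OF assms F.a_closed[OF f h] A])
      show "{x. (f \<oplus>\<^bsub>?F\<^esub> h) x \<noteq> \<zero>\<^bsub>R\<^esub>} \<subseteq> ?A"
        by (auto simp: free_mod_def)
    qed
    also have "\<dots> = (\<Oplus>\<^bsub>N\<^esub>x\<in>?A. f x \<odot>\<^bsub>N\<^esub> g x \<oplus>\<^bsub>N\<^esub> h x \<odot>\<^bsub>N\<^esub> g x)"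
      using car f h g A by (intro N.finsum_cong') (auto simp: pt N.smult_l_distr)
    also have "\<dots> = (\<Oplus>\<^bsub>N\<^esub>x\<in>?A. f x \<odot>\<^bsub>N\<^esub> g x) \<oplus>\<^bsub>N\<^esub> (\<Oplus>\<^bsub>N\<^esub>x\<in>?A. h x \<odot>\<^bsub>N\<^esub> g x)"
      using car f h g A by (intro N.finsum_addf) auto
    also have "\<dots> = lin_ext R N g f \<oplus>\<^bsub>N\<^esub> lin_ext R N g h"
      using f h A by (subst (1 2) lin_ext_eq[OF assms, where A = ?A]) auto
    finally show "lin_ext R N g (f \<oplus>\<^bsub>?F\<^esub> h) = \<dots>" .
  next
    fix k f assume k: "k \<in> carrier R" and f: "f \<in> carrier ?F"
    have "lin_ext R N g (k \<odot>\<^bsub>?F\<^esub> f) = (\<Oplus>\<^bsub>N\<^esub>x\<in>?s f. (k \<odot>\<^bsub>?F\<^esub> f) x \<odot>\<^bsub>N\<^esub> g x)"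
    proof (rule lin_ext_eq[OF assms F.smult_closed[OF k f] fin[OF f]])
      show "{x. (k \<odot>\<^bsub>?F\<^esub> f) x \<noteq> \<zero>\<^bsub>R\<^esub>} \<subseteq> ?s f"
        using k by (auto simp: free_mod_def)
    qed
    also have "\<dots> = (\<Oplus>\<^bsub>N\<^esub>x\<in>?s f. k \<odot>\<^bsub>N\<^esub> (f x \<odot>\<^bsub>N\<^esub> g x))"
      using car[OF f] k g fin[OF f] by (intro N.finsum_cong') (auto simp: pt N.smult_assoc1)
    also have "\<dots> = k \<odot>\<^bsub>N\<^esub> lin_ext R N g f" unfolding lin_ext_def
      using car[OF f] k g fin[OF f] by (intro N.finsum_smult_ldistr[symmetric]) auto
    finally show "lin_ext R N g (k \<odot>\<^bsub>?F\<^esub> f) = \<dots>" .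
  qed
  show "lin_ext R N g (free_gen R x) = g x" if "x \<in> S"
  proof -
    have "lin_ext R N g (free_gen R x) = (\<Oplus>\<^bsub>N\<^esub>y\<in>{x}. free_gen R x y \<odot>\<^bsub>N\<^esub> g y)"
      using that free_gen_closed[OF N.R.cring_axioms that]
      by (intro lin_ext_eq[OF assms]) (auto simp: free_gen_def)
    thus ?thesis using that g by (simp add: free_gen_def)
  qed
qed

lemma free_mod_span:
  assumes "cring R" "submodule N R (free_mod R S)" "\<And>x. x \<in> S \<Longrightarrow> free_gen R x \<in> N"
  shows "N = carrier (free_mod R S)"
proof -
  interpret R: cring R by fact
  let ?F = "free_mod R S"
  interpret F: module R ?F by (rule free_mod_module) fact
  interpret N: submodule N R ?F by fact
  have "f \<in> N" if "finite A" "f \<in> carrier ?F" "{x. f x \<noteq> \<zero>\<^bsub>R\<^esub>} = A" for A f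
    using that
  proof (induction A arbitrary: f)
    case empty
    hence "f = \<zero>\<^bsub>?F\<^esub>" by (auto simp: free_mod_def)
    thus ?case using N.one_closed by simp
  next
    case (insert a A)
    define h where "h = (\<lambda>x. if x = a then \<zero>\<^bsub>R\<^esub> else f x)"
    have f: "f x \<in> carrier R" "x \<notin> S \<Longrightarrow> f x = \<zero>\<^bsub>R\<^esub>" for x
      using insert.prems(1) by (auto simp: free_mod_def)
    have hs: "{x. h x \<noteq> \<zero>\<^bsub>R\<^esub>} = A"
      using insert.prems(2) insert.hyps(2) by (auto simp: h_def)
    hence hc: "h \<in> carrier ?F" using insert.hyps(1) f by (auto simp: h_def free_mod_def)
    have a: "a \<in> S" using f(2)[of a] insert.prems(2) by auto
    have "f = h \<oplus>\<^bsub>?F\<^esub> f a \<odot>\<^bsub>?F\<^esub> free_gen R a"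
      using f by (auto simp: free_mod_def h_def free_gen_def)
    moreover have "h \<in> N" using insert.IH hc hs by blast
    moreover have "f a \<odot>\<^bsub>?F\<^esub> free_gen R a \<in> N" using assms(3)[OF a] f by simp
    ultimately show ?case using F.submoduleE(5)[OF assms(2)] by metis
  qed
  hence "carrier ?F \<subseteq> N" by (auto simp: free_mod_def)
  thus ?thesis using F.submoduleE(1)[OF assms(2)] by blast
qed

lemma tuples_update [simp]:
  "us \<in> tuples M r \<Longrightarrow> x \<in> carrier M \<Longrightarrow> us[i := x] \<in> tuples M r"
  by (auto simp: tuples_def dest: set_update_subset_insert[THEN subsetD])

lemma tuples_nth [simp]: "us \<in> tuples M r \<Longrightarrow> i < r \<Longrightarrow> us ! i \<in> carrier M"
  by (auto simp: tuples_def)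

lemma tuples_length: "us \<in> tuples M r \<Longrightarrow> length us = r"
  by (auto simp: tuples_def)

definition multilinear ::
  "'k ring \<Rightarrow> ('k, 'm) module \<Rightarrow> nat \<Rightarrow> ('k, 'p) module \<Rightarrow> ('m list \<Rightarrow> 'p) \<Rightarrow> bool" where
  "multilinear R M r N g \<longleftrightarrow> g \<in> tuples M r \<rightarrow> carrier N \<and>
     (\<forall>us \<in> tuples M r. \<forall>i<r. \<forall>x \<in> carrier M. \<forall>y \<in> carrier M.
        g (us[i := x \<oplus>\<^bsub>M\<^esub> y]) = g (us[i := x]) \<oplus>\<^bsub>N\<^esub> g (us[i := y])) \<and>
     (\<forall>us \<in> tuples M r. \<forall>i<r. \<forall>k \<in> carrier R. \<forall>x \<in> carrier M.
        g (us[i := k \<odot>\<^bsub>M\<^esub> x]) = k \<odot>\<^bsub>N\<^esub> g (us[i := x]))"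

text \<open>
  Only neighbouring entries are compared. This is what can be checked directly for a contraction, and
  it is enough: for multilinear maps it implies vanishing on any repetition
  (\<open>adj_alternating_imp_zero\<close>).
\<close>

definition adj_alternating ::
  "('k, 'm) module \<Rightarrow> nat \<Rightarrow> ('k, 'p) module \<Rightarrow> ('m list \<Rightarrow> 'p) \<Rightarrow> bool" where
  "adj_alternating M r N g \<longleftrightarrow>
     (\<forall>us \<in> tuples M r. \<forall>i. Suc i < r \<longrightarrow> us ! i = us ! Suc i \<longrightarrow> g us = \<zero>\<^bsub>N\<^esub>)"

lemma multilinearD:
  assumes "multilinear R M r N g" "us \<in> tuples M r"
  shows "g us \<in> carrier N"
    and "i < r \<Longrightarrow> x \<in> carrier M \<Longrightarrow> y \<in> carrier M \<Longrightarrow>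
      g (us[i := x \<oplus>\<^bsub>M\<^esub> y]) = g (us[i := x]) \<oplus>\<^bsub>N\<^esub> g (us[i := y])"
    and "i < r \<Longrightarrow> k \<in> carrier R \<Longrightarrow> x \<in> carrier M \<Longrightarrow>
      g (us[i := k \<odot>\<^bsub>M\<^esub> x]) = k \<odot>\<^bsub>N\<^esub> g (us[i := x])"
  using assms by (auto simp: multilinear_def)

text \<open>
  Polarization: with \<open>a\<close>, \<open>b\<close> the two neighbouring entries, expand the value \<open>0\<close> at the tuple that
  carries \<open>a + b\<close> in both places.
\<close>

lemma adj_alternating_swap:
  assumes "module R M" "module R N" "multilinear R M r N g" "adj_alternating M r N g"
    and us: "us \<in> tuples M r" "Suc i < r"
  shows "g (us[i := us ! Suc i, Suc i := us ! i]) = \<ominus>\<^bsub>N\<^esub> g us"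
proof -
  note [simp] = tuples_length
  interpret M: module R M by fact
  interpret N: module R N by fact
  note ml = multilinearD[OF assms(3)]
  have alt: "g ws = \<zero>\<^bsub>N\<^esub>" if "ws \<in> tuples M r" "ws ! i = ws ! Suc i" for ws
    using assms(4) that us by (auto simp: adj_alternating_def)
  define a b where "a = us ! i" and "b = us ! Suc i"
  have ab: "a \<in> carrier M" "b \<in> carrier M" using us by (auto simp: a_def b_def)
  define G where "G = (\<lambda>x y. g (us[i := x, Suc i := y]))"
  have cl: "G x y \<in> carrier N" if "x \<in> carrier M" "y \<in> carrier M" for x y
    unfolding G_def using that us by (intro ml(1)) auto
  have al: "G x x = \<zero>\<^bsub>N\<^esub>" if "x \<in> carrier M" for x
    unfolding G_def using that us by (intro alt) auto
  have r: "G x (y \<oplus>\<^bsub>M\<^esub> z) = G x y \<oplus>\<^bsub>N\<^esub> G x z"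
    if "x \<in> carrier M" "y \<in> carrier M" "z \<in> carrier M" for x y z
    unfolding G_def using that us by (intro ml(2)) auto
  have l: "G (y \<oplus>\<^bsub>M\<^esub> z) x = G y x \<oplus>\<^bsub>N\<^esub> G z x"
    if "x \<in> carrier M" "y \<in> carrier M" "z \<in> carrier M" for x y z
    using ml(2)[of "us[Suc i := x]" i y z] that us
    by (simp add: G_def list_update_swap)
  have "\<zero>\<^bsub>N\<^esub> = G (a \<oplus>\<^bsub>M\<^esub> b) (a \<oplus>\<^bsub>M\<^esub> b)" using al ab by simp
  also have "\<dots> = (G a a \<oplus>\<^bsub>N\<^esub> G b a) \<oplus>\<^bsub>N\<^esub> (G a b \<oplus>\<^bsub>N\<^esub> G b b)"
    using ab by (simp add: l r del: al)
  also have "\<dots> = G a b \<oplus>\<^bsub>N\<^esub> G b a" using ab by (simp add: al cl N.M.a_comm)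
  finally have "G b a = \<ominus>\<^bsub>N\<^esub> G a b" using ab cl by (metis N.M.minus_equality N.M.a_comm)
  moreover have "us[i := a, Suc i := b] = us" by (simp add: a_def b_def)
  ultimately show ?thesis by (simp add: G_def a_def b_def)
qed

text \<open>
  Neighbouring swaps, each of which only changes the sign, bring the two equal entries together.
\<close>

lemma adj_alternating_imp_zero:
  assumes "module R M" "module R N" "multilinear R M r N g" "adj_alternating M r N g"
    and "us \<in> tuples M r" "i < j" "j < r" "us ! i = us ! j"
  shows "g us = \<zero>\<^bsub>N\<^esub>"
proof -
  note [simp] = tuples_length
  interpret N: module R N by fact
  have "g us = \<zero>\<^bsub>N\<^esub>" if "us \<in> tuples M r" "i + Suc d < r" "us ! i = us ! (i + Suc d)" for d us
    using that
  proof (induction d arbitrary: us)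
    case 0
    thus ?case using assms(4) by (auto simp: adj_alternating_def)
  next
    case (Suc d)
    define j where "j = i + Suc d"
    define ws where "ws = us[j := us ! Suc j, Suc j := us ! j]"
    have ws: "ws \<in> tuples M r" using Suc.prems by (auto simp: ws_def j_def)
    have "g ws = \<zero>\<^bsub>N\<^esub>"
      by (rule Suc.IH[OF ws]) (use Suc.prems in \<open>auto simp: ws_def j_def nth_list_update\<close>)
    moreover have "g ws = \<ominus>\<^bsub>N\<^esub> g us" unfolding ws_def
      using Suc.prems by (intro adj_alternating_swap[OF assms(1-4)]) (auto simp: j_def)
    moreover have g: "g us \<in> carrier N" using multilinearD(1)[OF assms(3)] Suc.prems by blast
    ultimately show ?case using N.M.r_neg[OF g] by simp
  qed
  from this[of us "j - i - 1"] show ?thesis using assms by simp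
qed

context
  fixes R :: "'k ring" and M :: "('k, 'm) module"
  assumes M: "module R M"
begin

interpretation M: module R M by (rule M)

abbreviation (input) "TM \<equiv> tuple_mod R M"
abbreviation (input) "EP \<equiv> ext_power R M"

lemma tuple_mod_module: "module R (TM r)"
  by (rule free_mod_module) (rule M.R.cring_axioms)

lemma ext_gens_subset: "ext_gens R M r \<subseteq> carrier (TM r)"
proof -
  interpret T: module R "TM r" by (rule tuple_mod_module)
  have [simp]: "free_gen R us \<in> carrier (TM r)" if "us \<in> tuples M r" for us
    using free_gen_closed[OF M.R.cring_axioms that] .
  show ?thesis unfolding ext_gens_def
    by (auto intro!: T.minus_closed T.a_closed T.smult_closed)
qed

lemma ext_rels_submodule: "submodule (ext_rels R M r) R (TM r)"
  and ext_gens_rels: "ext_gens R M r \<subseteq> ext_rels R M r"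
  and ext_rels_least:
    "submodule N R (TM r) \<Longrightarrow> ext_gens R M r \<subseteq> N \<Longrightarrow> ext_rels R M r \<subseteq> N"
proof -
  interpret T: module R "TM r" by (rule tuple_mod_module)
  let ?S = "{N. submodule N R (TM r) \<and> ext_gens R M r \<subseteq> N}"
  have car: "carrier (TM r) \<in> ?S"
    using T.carrier_is_submodule ext_gens_subset by blast
  note sub = T.submoduleE
  have z: "\<zero>\<^bsub>TM r\<^esub> \<in> N" if "N \<in> ?S" for N
    using that submodule.axioms(1)[of N R "TM r"] subgroup.one_closed by force
  show "submodule (ext_rels R M r) R (TM r)"
  proof (rule T.submoduleI)
    show "ext_rels R M r \<subseteq> carrier (TM r)"
      using car unfolding ext_rels_def by blast
  qed (use z sub(3-5) in \<open>simp_all add: ext_rels_def\<close>)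
  show "ext_gens R M r \<subseteq> ext_rels R M r"
    unfolding ext_rels_def by blast
  show "ext_rels R M r \<subseteq> N" if "submodule N R (TM r)" "ext_gens R M r \<subseteq> N"
    unfolding ext_rels_def using that by blast
qed

lemma ext_power_module: "module R (EP r)"
  unfolding ext_power_def
  using quot_mod_props(1)[OF tuple_mod_module[of r] ext_rels_submodule[of r]] .

lemma ext_proj_hom:
  "(\<lambda>x. ext_rels R M r +>\<^bsub>TM r\<^esub> x) \<in> mod_hom R (TM r) (EP r)"
  unfolding ext_power_def
  using quot_mod_props(2)[OF tuple_mod_module[of r] ext_rels_submodule[of r]] .

lemma ext_proj_surj:
  "(\<lambda>x. ext_rels R M r +>\<^bsub>TM r\<^esub> x) ` carrier (TM r) = carrier (EP r)"
  unfolding ext_power_def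
  using quot_mod_props(3)[OF tuple_mod_module[of r] ext_rels_submodule[of r]] .

lemma wedge_eq: "us \<in> tuples M r \<Longrightarrow>
    wedge R M us = ext_rels R M r +>\<^bsub>TM r\<^esub> free_gen R us"
  unfolding wedge_def using tuples_length by metis

lemma wedge_multilinear: "multilinear R M r (EP r) (wedge R M)"
  and wedge_alternating: "adj_alternating M r (EP r) (wedge R M)"
proof -
  interpret T: module R "TM r" by (rule tuple_mod_module)
  interpret E: module R "EP r" by (rule ext_power_module)
  note hom = ext_proj_hom[of r]
  note quot = coset_eq_iff[OF tuple_mod_module ext_rels_submodule]
  have [simp]: "free_gen R us \<in> carrier (TM r)" if "us \<in> tuples M r" for us
    using free_gen_closed[OF M.R.cring_axioms that] .
  show "multilinear R M r (EP r) (wedge R M)"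
    unfolding multilinear_def
  proof (intro conjI ballI allI impI)
    show "wedge R M \<in> tuples M r \<rightarrow> carrier (EP r)"
      by (auto simp: wedge_eq[of _ r] mod_hom_closed[OF hom])
  next
    fix us i x y assume *: "us \<in> tuples M r" "i < r" "x \<in> carrier M" "y \<in> carrier M"
    have "free_gen R (us[i := x \<oplus>\<^bsub>M\<^esub> y]) \<ominus>\<^bsub>TM r\<^esub>
        (free_gen R (us[i := x]) \<oplus>\<^bsub>TM r\<^esub> free_gen R (us[i := y])) \<in> ext_rels R M r"
      by (rule subsetD[OF ext_gens_rels]) (use * in \<open>unfold ext_gens_def, blast\<close>)
    thus "wedge R M (us[i := x \<oplus>\<^bsub>M\<^esub> y]) =
        wedge R M (us[i := x]) \<oplus>\<^bsub>EP r\<^esub> wedge R M (us[i := y])"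
      using * by (simp add: wedge_eq[of _ r] mod_hom_add[OF hom, symmetric] quot)
  next
    fix us i k x assume *: "us \<in> tuples M r" "i < r" "k \<in> carrier R" "x \<in> carrier M"
    have "free_gen R (us[i := k \<odot>\<^bsub>M\<^esub> x]) \<ominus>\<^bsub>TM r\<^esub>
        (k \<odot>\<^bsub>TM r\<^esub> free_gen R (us[i := x])) \<in> ext_rels R M r"
      by (rule subsetD[OF ext_gens_rels]) (use * in \<open>unfold ext_gens_def, blast\<close>)
    thus "wedge R M (us[i := k \<odot>\<^bsub>M\<^esub> x]) = k \<odot>\<^bsub>EP r\<^esub> wedge R M (us[i := x])"
      using * by (simp add: wedge_eq[of _ r] mod_hom_smult[OF hom, symmetric] quot)
  qed
  have zz: "\<ominus>\<^bsub>TM r\<^esub> \<zero>\<^bsub>TM r\<^esub> = \<zero>\<^bsub>TM r\<^esub>"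
    using T.M.r_neg[OF T.M.zero_closed] T.M.l_zero[OF T.M.a_inv_closed[OF T.M.zero_closed]] by simp
  show "adj_alternating M r (EP r) (wedge R M)"
    unfolding adj_alternating_def
  proof (intro ballI allI impI)
    fix us i assume *: "us \<in> tuples M r" "Suc i < r" "us ! i = us ! Suc i"
    have "free_gen R us \<in> ext_rels R M r"
      by (rule subsetD[OF ext_gens_rels]) (use * in \<open>unfold ext_gens_def, blast\<close>)
    hence "ext_rels R M r +>\<^bsub>TM r\<^esub> free_gen R us
        = ext_rels R M r +>\<^bsub>TM r\<^esub> \<zero>\<^bsub>TM r\<^esub>"
      using * T.M.zero_closed quot[where x = "free_gen R us" and y = "\<zero>\<^bsub>TM r\<^esub>"]
      by (simp add: T.M.minus_eq zz)
    thus "wedge R M us = \<zero>\<^bsub>EP r\<^esub>"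
      using * mod_hom_zero[OF tuple_mod_module ext_power_module hom] by (simp add: wedge_eq[of _ r])
  qed
qed

text \<open>
  The linear extension of \<open>g\<close> to the free module on all tuples vanishes on the generating relations,
  hence on the submodule they generate, and so factors through the quotient.
\<close>

lemma ext_power_universal:
  assumes "module R N" "multilinear R M r N g" "adj_alternating M r N g"
  obtains f where "f \<in> mod_hom R (EP r) N"
    "\<And>us. us \<in> tuples M r \<Longrightarrow> f (wedge R M us) = g us"
proof -
  interpret N: module R N by fact
  interpret T: module R "TM r" by (rule tuple_mod_module)
  note ml = multilinearD[OF assms(2)]
  have gS: "g \<in> tuples M r \<rightarrow> carrier N" using ml(1) by auto
  define h where "h = lin_ext R N g"
  have h: "h \<in> mod_hom R (TM r) N"
    and hg: "us \<in> tuples M r \<Longrightarrow> h (free_gen R us) = g us" for us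
    unfolding h_def using lin_ext_hom[OF assms(1) gS] by auto
  have [simp]: "free_gen R us \<in> carrier (TM r)" if "us \<in> tuples M r" for us
    using free_gen_closed[OF M.R.cring_axioms that] .
  note hm = mod_hom_minus[OF tuple_mod_module assms(1) h]
  define K where "K = {x \<in> carrier (TM r). h x = \<zero>\<^bsub>N\<^esub>}"
  have "submodule K R (TM r)"
    unfolding K_def using mod_hom_equalizer[OF tuple_mod_module assms(1) h, of "\<lambda>_. \<zero>\<^bsub>N\<^esub>"]
    by (auto simp: mod_hom_def)
  moreover have "ext_gens R M r \<subseteq> K"
  proof
    fix x assume x: "x \<in> ext_gens R M r"
    have "h x = \<zero>\<^bsub>N\<^esub>"
      using x unfolding ext_gens_def
      by (auto simp: hm hg mod_hom_add[OF h] mod_hom_smult[OF h] ml N.M.minus_eq N.M.r_neg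
          intro: adj_alternating_imp_zero[OF M assms])
    thus "x \<in> K" using x ext_gens_subset by (auto simp: K_def)
  qed
  ultimately have K: "ext_rels R M r \<subseteq> K" by (rule ext_rels_least)
  have wd: "h x = h y" if "x \<in> carrier (TM r)" "y \<in> carrier (TM r)"
    "ext_rels R M r +>\<^bsub>TM r\<^esub> x = ext_rels R M r +>\<^bsub>TM r\<^esub> y" for x y
  proof -
    have "h (x \<ominus>\<^bsub>TM r\<^esub> y) = \<zero>\<^bsub>N\<^esub>"
      using that coset_eq_iff[OF tuple_mod_module ext_rels_submodule] K by (auto simp: K_def)
    hence "h x \<ominus>\<^bsub>N\<^esub> h y = \<zero>\<^bsub>N\<^esub>" using hm[OF that(1,2)] by simp
    thus ?thesis using mod_hom_closed[OF h] that
      by (metis N.M.minus_eq N.M.minus_equality N.M.minus_minus N.M.a_inv_closed)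
  qed
  obtain f where f: "f \<in> mod_hom R (EP r) N"
    "\<And>x. x \<in> carrier (TM r) \<Longrightarrow> f (ext_rels R M r +>\<^bsub>TM r\<^esub> x) = h x"
    using mod_hom_factor[OF tuple_mod_module ext_proj_hom ext_proj_surj h wd] by blast
  show ?thesis by (rule that[OF f(1)]) (simp add: wedge_eq[of _ r] f(2) hg)
qed

lemma ext_power_span:
  assumes "submodule N R (EP r)" "\<And>us. us \<in> tuples M r \<Longrightarrow> wedge R M us \<in> N"
  shows "N = carrier (EP r)"
proof -
  interpret T: module R "TM r" by (rule tuple_mod_module)
  interpret E: module R "EP r" by (rule ext_power_module)
  let ?p = "\<lambda>x. ext_rels R M r +>\<^bsub>TM r\<^esub> x"
  note hom = ext_proj_hom[of r]
  note sub = E.submoduleE[OF assms(1)]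
  have z: "\<zero>\<^bsub>EP r\<^esub> \<in> N"
    using submodule.axioms(1)[OF assms(1)] subgroup.one_closed by force
  have neg: "?p (\<ominus>\<^bsub>TM r\<^esub> x) = \<ominus>\<^bsub>EP r\<^esub> ?p x" if "x \<in> carrier (TM r)" for x
    using mod_hom_minus[OF tuple_mod_module ext_power_module hom T.zero_closed that] that
      mod_hom_closed[OF hom that] mod_hom_zero[OF tuple_mod_module ext_power_module hom]
    by (simp add: a_minus_def)
  have "{x \<in> carrier (TM r). ?p x \<in> N} = carrier (TM r)"
  proof (rule free_mod_span[OF M.R.cring_axioms])
    show "submodule {x \<in> carrier (TM r). ?p x \<in> N} R (TM r)"
      by (rule T.submoduleI)
        (use z sub mod_hom_zero[OF tuple_mod_module ext_power_module hom] in
          \<open>auto simp: mod_hom_add[OF hom] mod_hom_smult[OF hom] neg\<close>)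
  next
    fix us assume us: "us \<in> tuples M r"
    have "?p (free_gen R us) \<in> N" using assms(2)[OF us] unfolding wedge_eq[OF us] .
    thus "free_gen R us \<in> {x \<in> carrier (TM r). ?p x \<in> N}"
      using free_gen_closed[OF M.R.cring_axioms us] by blast
  qed
  hence "?p ` carrier (TM r) \<subseteq> N" by blast
  thus ?thesis using sub(1) ext_proj_surj[of r] by blast
qed

lemma wedge_closed:
  assumes "us \<in> tuples M r"
  shows "wedge R M us \<in> carrier (EP r)"
  by (rule multilinearD(1)[OF wedge_multilinear assms])

text \<open>
  The defining choice of \<open>wedge_left\<close> is not vacuous, because \<open>v \<and> u\<^sub>1 \<and> \<dots> \<and> u\<^sub>r\<close> is multilinear and
  alternating in the \<open>u\<^sub>i\<close>.
\<close>

lemma wedge_left_props: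
  assumes v: "v \<in> carrier M"
  shows "wedge_left R M r v \<in> mod_hom R (EP r) (EP (Suc r))"
    and "us \<in> tuples M r \<Longrightarrow> wedge_left R M r v (wedge R M us) = wedge R M (v # us)"
proof -
  have cons: "v # us \<in> tuples M (Suc r)" if "us \<in> tuples M r" for us
    using v that by (auto simp: tuples_def)
  note ml = multilinearD[OF wedge_multilinear, of _ "Suc r"]
  have 1: "multilinear R M r (EP (Suc r)) (\<lambda>us. wedge R M (v # us))"
    unfolding multilinear_def
  proof (intro conjI ballI allI impI)
    show "(\<lambda>us. wedge R M (v # us)) \<in> tuples M r \<rightarrow> carrier (EP (Suc r))"
      by (intro Pi_I wedge_closed cons)
  next
    fix us i x y assume "us \<in> tuples M r" "i < r" "x \<in> carrier M" "y \<in> carrier M"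
    thus "wedge R M (v # us[i := x \<oplus>\<^bsub>M\<^esub> y]) =
      wedge R M (v # us[i := x]) \<oplus>\<^bsub>EP (Suc r)\<^esub> wedge R M (v # us[i := y])"
      using ml(2)[OF cons, of us "Suc i" x y] by simp
  next
    fix us i k x assume "us \<in> tuples M r" "i < r" "k \<in> carrier R" "x \<in> carrier M"
    thus "wedge R M (v # us[i := k \<odot>\<^bsub>M\<^esub> x]) =
      k \<odot>\<^bsub>EP (Suc r)\<^esub> wedge R M (v # us[i := x])"
      using ml(3)[OF cons, of us "Suc i" k x] by simp
  qed
  have 2: "adj_alternating M r (EP (Suc r)) (\<lambda>us. wedge R M (v # us))"
    unfolding adj_alternating_def
  proof (intro ballI allI impI)
    fix us i assume us: "us \<in> tuples M r" "Suc i < r" "us ! i = us ! Suc i"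
    show "wedge R M (v # us) = \<zero>\<^bsub>EP (Suc r)\<^esub>"
      using wedge_alternating[of "Suc r", unfolded adj_alternating_def,
        rule_format, OF cons[OF us(1)], of "Suc i"] us by simp
  qed
  obtain f where "f \<in> mod_hom R (EP r) (EP (Suc r))"
    "\<And>us. us \<in> tuples M r \<Longrightarrow> f (wedge R M us) = wedge R M (v # us)"
    using ext_power_universal[OF ext_power_module 1 2] by blast
  hence "\<exists>f. f \<in> mod_hom R (EP r) (EP (Suc r)) \<and>
    (\<forall>us \<in> tuples M r. f (wedge R M us) = wedge R M (v # us))"
    by blast
  from someI_ex[OF this, folded wedge_left_def]
  show "wedge_left R M r v \<in> mod_hom R (EP r) (EP (Suc r))"
    and "us \<in> tuples M r \<Longrightarrow> wedge_left R M r v (wedge R M us) = wedge R M (v # us)"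
    by auto
qed

lemma omit_closed:
  assumes "us \<in> tuples M r" "k < r"
  shows "take k us @ drop (Suc k) us \<in> tuples M (r - 1)"
  using assms by (auto simp: tuples_def dest: in_set_takeD in_set_dropD)

text \<open>
  Omitting the \<open>k\<close>-th entry turns an update at \<open>i \<noteq> k\<close> into an update of the shorter tuple; the
  position \<open>i'\<close> is \<open>i\<close> or \<open>i - 1\<close>.
\<close>

lemma omit_update:
  assumes "length us = r" "k < r" "i < r" "k \<noteq> i"
  obtains i' where "i' < r - 1"
    "\<And>x. take k (us[i := x]) @ drop (Suc k) (us[i := x]) = (take k us @ drop (Suc k) us)[i' := x]"
proof (cases "i < k")
  case True
  show ?thesis
    by (rule that[of i]) (use True assms in \<open>auto simp: take_update_swap list_update_append\<close>)
next
  case False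
  show ?thesis
    by (rule that[of "i - 1"])
      (use False assms in \<open>auto simp: drop_update_swap list_update_append\<close>)
qed

text \<open>
  The alternating sum that defines the contraction is multilinear, one term at a time. It is
  alternating: if the entries \<open>i\<close> and \<open>i + 1\<close> agree, every term omitting another entry still contains
  the repetition, and the two remaining terms have the same wedge with opposite coefficients. So the
  universal property supplies the map that \<open>contract\<close> chooses.
\<close>

lemma contract_props:
  assumes d: "d \<in> dual_mod R M"
  shows "contract R M r d \<in> mod_hom R (EP r) (EP (r - 1))"
    and "us \<in> tuples M r \<Longrightarrow> contract R M r d (wedge R M us) =
      (\<Oplus>\<^bsub>EP (r - 1)\<^esub> k\<in>{..<r}.
        (((\<ominus>\<^bsub>R\<^esub> \<one>\<^bsub>R\<^esub>) [^]\<^bsub>R\<^esub> k) \<otimes>\<^bsub>R\<^esub> d (us ! k)) \<odot>\<^bsub>EP (r - 1)\<^esub>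
          wedge R M (take k us @ drop (Suc k) us))"
proof -
  note One_nat_def [simp del]
  let ?E = "EP (r - 1)"
  let ?om = "\<lambda>k us. take k us @ drop (Suc k) us"
  let ?c = "\<lambda>k us. ((\<ominus>\<^bsub>R\<^esub> \<one>\<^bsub>R\<^esub>) [^]\<^bsub>R\<^esub> (k::nat)) \<otimes>\<^bsub>R\<^esub> d (us ! k)"
  let ?t = "\<lambda>k us. ?c k us \<odot>\<^bsub>?E\<^esub> wedge R M (?om k us)"
  let ?g = "\<lambda>us. (\<Oplus>\<^bsub>?E\<^esub> k\<in>{..<r}. ?t k us)"
  interpret E: module R ?E by (rule ext_power_module)
  note ml = multilinearD[OF wedge_multilinear, of _ "r - 1"]
  have dc: "d x \<in> carrier R" if "x \<in> carrier M" for x using d that by (auto simp: dual_mod_def)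
  have da: "d (x \<oplus>\<^bsub>M\<^esub> y) = d x \<oplus>\<^bsub>R\<^esub> d y" if "x \<in> carrier M" "y \<in> carrier M" for x y
    using d that by (auto simp: dual_mod_def)
  have ds: "d (k \<odot>\<^bsub>M\<^esub> x) = k \<otimes>\<^bsub>R\<^esub> d x" if "k \<in> carrier R" "x \<in> carrier M" for k x
    using d that by (auto simp: dual_mod_def)
  have cc: "?c k us \<in> carrier R" if "us \<in> tuples M r" "k < r" for us k
    using that dc by auto
  have wc: "wedge R M (?om k us) \<in> carrier ?E" if "us \<in> tuples M r" "k < r" for us k
    using wedge_closed[OF omit_closed[OF that]] .
  have tc: "?t k us \<in> carrier ?E" if "us \<in> tuples M r" "k < r" for us k
    by (rule E.smult_closed[OF cc[OF that] wc[OF that]])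
  have om_same: "?om i (us[i := x]) = ?om i us" for i us and x :: 'm by simp
  have 1: "multilinear R M r ?E ?g"
    unfolding multilinear_def
  proof (intro conjI ballI allI impI)
    show "?g \<in> tuples M r \<rightarrow> carrier ?E" by (intro Pi_I E.finsum_closed tc) auto
  next
    fix us i x y assume us: "us \<in> tuples M r" and i: "i < r" and xy: "x \<in> carrier M" "y \<in> carrier M"
    note cl = M.a_closed[OF xy]
    have "?t k (us[i := x \<oplus>\<^bsub>M\<^esub> y]) = ?t k (us[i := x]) \<oplus>\<^bsub>?E\<^esub> ?t k (us[i := y])" if k: "k < r" for k
    proof (cases "k = i")
      case True
      have "?c i (us[i := x \<oplus>\<^bsub>M\<^esub> y]) = ?c i (us[i := x]) \<oplus>\<^bsub>R\<^esub> ?c i (us[i := y])"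
        using us i xy by (simp add: da dc M.R.r_distr tuples_length)
      moreover have "?c i (us[i := z]) \<in> carrier R" if "z \<in> carrier M" for z
        using us i that by (intro cc) auto
      ultimately show ?thesis
        unfolding True om_same using wc[OF us i] xy by (simp only: E.smult_l_distr)
    next
      case False
      have "length us = r" using us by (rule tuples_length)
      then obtain i' where i': "i' < r - 1" "\<And>x. ?om k (us[i := x]) = (?om k us)[i' := x]"
        using omit_update k i False by metis
      have c: "?c k (us[i := z]) = ?c k us" for z using False by simp
      have "wedge R M ((?om k us)[i' := x \<oplus>\<^bsub>M\<^esub> y]) =
          wedge R M ((?om k us)[i' := x]) \<oplus>\<^bsub>?E\<^esub> wedge R M ((?om k us)[i' := y])"
        by (rule ml(2)[OF omit_closed[OF us k] i'(1) xy])
      moreover have "wedge R M ((?om k us)[i' := z]) \<in> carrier ?E" if "z \<in> carrier M" for z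
        by (intro wedge_closed tuples_update omit_closed us k that)
      ultimately show ?thesis unfolding c i'(2) using cc[OF us k] xy by (simp only: E.smult_r_distr)
    qed
    hence "?g (us[i := x \<oplus>\<^bsub>M\<^esub> y]) = (\<Oplus>\<^bsub>?E\<^esub> k\<in>{..<r}. ?t k (us[i := x]) \<oplus>\<^bsub>?E\<^esub> ?t k (us[i := y]))"
      using us xy by (intro E.finsum_cong') (auto intro!: E.a_closed tc)
    also have "\<dots> = ?g (us[i := x]) \<oplus>\<^bsub>?E\<^esub> ?g (us[i := y])"
      using us xy by (intro E.finsum_addf) (auto intro!: tc)
    finally show "?g (us[i := x \<oplus>\<^bsub>M\<^esub> y]) = \<dots>" .
  next
    fix us i q x assume us: "us \<in> tuples M r" and i: "i < r" and q: "q \<in> carrier R" and x: "x \<in> carrier M"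
    have "?t k (us[i := q \<odot>\<^bsub>M\<^esub> x]) = q \<odot>\<^bsub>?E\<^esub> ?t k (us[i := x])" if k: "k < r" for k
    proof (cases "k = i")
      case True
      have "?c i (us[i := q \<odot>\<^bsub>M\<^esub> x]) = q \<otimes>\<^bsub>R\<^esub> ?c i (us[i := x])"
        using us i q x by (simp add: ds dc M.R.m_lcomm tuples_length)
      moreover have "?c i (us[i := x]) \<in> carrier R" using us i x by (intro cc) auto
      ultimately show ?thesis
        unfolding True om_same using wc[OF us i] q by (simp only: E.smult_assoc1)
    next
      case False
      have "length us = r" using us by (rule tuples_length)
      then obtain i' where i': "i' < r - 1" "\<And>x. ?om k (us[i := x]) = (?om k us)[i' := x]"
        using omit_update k i False by metis
      have c: "?c k (us[i := z]) = ?c k us" for z using False by simp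
      have w: "wedge R M ((?om k us)[i' := q \<odot>\<^bsub>M\<^esub> x]) = q \<odot>\<^bsub>?E\<^esub> wedge R M ((?om k us)[i' := x])"
        by (rule ml(3)[OF omit_closed[OF us k] i'(1) q x])
      have wcl: "wedge R M ((?om k us)[i' := x]) \<in> carrier ?E"
        by (intro wedge_closed tuples_update omit_closed us k x)
      have "?c k us \<odot>\<^bsub>?E\<^esub> (q \<odot>\<^bsub>?E\<^esub> wedge R M ((?om k us)[i' := x])) =
          q \<odot>\<^bsub>?E\<^esub> (?c k us \<odot>\<^bsub>?E\<^esub> wedge R M ((?om k us)[i' := x]))"
        using E.smult_assoc1[OF cc[OF us k] q wcl] E.smult_assoc1[OF q cc[OF us k] wcl]
          M.R.m_comm[OF cc[OF us k] q] by simp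
      thus ?thesis unfolding c i'(2) w .
    qed
    hence "?g (us[i := q \<odot>\<^bsub>M\<^esub> x]) = (\<Oplus>\<^bsub>?E\<^esub> k\<in>{..<r}. q \<odot>\<^bsub>?E\<^esub> ?t k (us[i := x]))"
      using us x q by (intro E.finsum_cong') (auto intro!: E.smult_closed tc)
    also have "\<dots> = q \<odot>\<^bsub>?E\<^esub> ?g (us[i := x])"
      using us x q by (intro E.finsum_smult_ldistr[symmetric]) (auto intro!: tc)
    finally show "?g (us[i := q \<odot>\<^bsub>M\<^esub> x]) = \<dots>" .
  qed
  have 2: "adj_alternating M r ?E ?g"
    unfolding adj_alternating_def
  proof (intro ballI allI impI)
    fix us i assume us: "us \<in> tuples M r" and i: "Suc i < r" and eq: "us ! i = us ! Suc i"
    have len: "length us = r" using us by (rule tuples_length)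
    have z: "?t k us = \<zero>\<^bsub>?E\<^esub>" if k: "k < r" "k \<noteq> i" "k \<noteq> Suc i" for k
    proof -
      define j where "j = (if i < k then i else i - 1)"
      have j: "Suc j < r - 1" using i k by (auto simp: j_def)
      have "?om k us ! j = ?om k us ! Suc j"
        using i k len eq by (auto simp: j_def nth_append min_def)
      hence "wedge R M (?om k us) = \<zero>\<^bsub>?E\<^esub>"
        using wedge_alternating[of "r - 1"] omit_closed[OF us k(1)] j
        unfolding adj_alternating_def by blast
      thus ?thesis using cc[OF us k(1)] by simp
    qed
    have "?om i us = ?om (Suc i) us"
      using i len eq
      by (intro nth_equalityI) (auto simp: nth_append min_def less_Suc_eq)
    hence w: "wedge R M (?om (Suc i) us) = wedge R M (?om i us)" by simp
    have c: "?c (Suc i) us = \<ominus>\<^bsub>R\<^esub> ?c i us"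
      using us i eq[symmetric] dc by (simp add: M.R.l_minus M.R.r_minus)
    have "?g us = (\<Oplus>\<^bsub>?E\<^esub> k\<in>{i, Suc i}. ?t k us)"
      using i us by (intro E.add.finprod_mono_neutral_cong_right) (auto simp del: nat_pow_Suc simp: z intro!: tc[OF us])
    also have "\<dots> = ?t i us \<oplus>\<^bsub>?E\<^esub> ?t (Suc i) us"
      using tc[OF us, of i] tc[OF us, of "Suc i"] i by (simp del: nat_pow_Suc)
    also have "\<dots> = \<zero>\<^bsub>?E\<^esub>"
      unfolding c w using cc[OF us, of i] wc[OF us, of i] i
      by (simp only: E.smult_l_minus E.smult_closed E.M.r_neg Suc_lessD)
    finally show "?g us = \<zero>\<^bsub>?E\<^esub>" .
  qed
  obtain f where "f \<in> mod_hom R (EP r) ?E"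
    "\<And>us. us \<in> tuples M r \<Longrightarrow> f (wedge R M us) = ?g us"
    using ext_power_universal[OF ext_power_module 1 2] by blast
  hence "\<exists>f. f \<in> mod_hom R (EP r) ?E \<and>
    (\<forall>us \<in> tuples M r. f (wedge R M us) = ?g us)"
    by blast
  from someI_ex[OF this, folded contract_def]
  show "contract R M r d \<in> mod_hom R (EP r) (EP (r - 1))"
    and "us \<in> tuples M r \<Longrightarrow> contract R M r d (wedge R M us) = ?g us"
    by auto
qed

text \<open>
  Wedges of basis vectors are sorted by neighbouring swaps. Swapping an ascent \<open>m\<^sub>i < m\<^sub>i\<^sub>+\<^sub>1\<close> lowers
  \<open>\<Sum>\<^sub>j j m\<^sub>j\<close>, so the process ends with a decreasing index list, unless a repetition makes the
  wedge vanish. Arbitrary tuples are then reached by replacing basis vectors by general vectors, one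
  position at a time.
\<close>

lemma wedge_span:
  fixes X :: "nat \<Rightarrow> 'm"
  assumes X: "\<And>i. i < n \<Longrightarrow> X i \<in> carrier M"
    and span: "\<And>N. submodule N R M \<Longrightarrow> X ` {..<n} \<subseteq> N \<Longrightarrow> N = carrier M"
    and N: "submodule N R (EP r)"
    and dec: "\<And>ms. length ms = r \<Longrightarrow> sorted_wrt (>) ms \<Longrightarrow> set ms \<subseteq> {..<n} \<Longrightarrow>
      wedge R M (map X ms) \<in> N"
  shows "N = carrier (EP r)"
proof -
  interpret E: module R "EP r" by (rule ext_power_module)
  note sub = E.submoduleE[OF N]
  have zN: "\<zero>\<^bsub>EP r\<^esub> \<in> N"
    using submodule.axioms(1)[OF N] subgroup.one_closed by force
  note ml = multilinearD[OF wedge_multilinear, of _ r]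
  have basis: "wedge R M (map X ms) \<in> N" if "length ms = r" "set ms \<subseteq> {..<n}" for ms
    using that
  proof (induction "\<Sum>j<r. j * ms ! j" arbitrary: ms rule: less_induct)
    case less
    have tup: "map X ms \<in> tuples M r" using less.prems X by (auto simp: tuples_def)
    show ?case
    proof (cases "\<exists>i. Suc i < r \<and> ms ! i \<le> ms ! Suc i")
      case False
      have "sorted_wrt (>) ms"
        using False less.prems by (subst sorted_wrt_iff_nth_Suc_transp) (auto simp: not_le transp_def)
      thus ?thesis using dec less.prems by blast
    next
      case True
      then obtain i where i: "Suc i < r" "ms ! i \<le> ms ! Suc i" by blast
      show ?thesis
      proof (cases "ms ! i = ms ! Suc i")
        case True
        hence "wedge R M (map X ms) = \<zero>\<^bsub>EP r\<^esub>"
          using wedge_alternating[of r] tup i less.prems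
          by (auto simp: adj_alternating_def)
        thus ?thesis using zN by simp
      next
        case neq: False
        define ms' where "ms' = ms[i := ms ! Suc i, Suc i := ms ! i]"
        have len: "length ms' = r" using less.prems by (simp add: ms'_def)
        have set': "set ms' = set ms" using i less.prems by (simp add: ms'_def)
        have "(\<Sum>j<r. j * ms' ! j) = (\<Sum>j\<in>{..<r} - {i, Suc i}. j * ms' ! j) + (\<Sum>j\<in>{i, Suc i}. j * ms' ! j)"
          using i by (intro sum.subset_diff) auto
        also have "(\<Sum>j\<in>{..<r} - {i, Suc i}. j * ms' ! j) = (\<Sum>j\<in>{..<r} - {i, Suc i}. j * ms ! j)"
          using i less.prems by (intro sum.cong) (auto simp: ms'_def)
        also have "(\<Sum>j\<in>{i, Suc i}. j * ms' ! j) < (\<Sum>j\<in>{i, Suc i}. j * ms ! j)"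
          using i neq less.prems by (auto simp: ms'_def)
        also have "(\<Sum>j\<in>{..<r} - {i, Suc i}. j * ms ! j) + (\<Sum>j\<in>{i, Suc i}. j * ms ! j) = (\<Sum>j<r. j * ms ! j)"
          using i by (intro sum.subset_diff[symmetric]) auto
        finally have "(\<Sum>j<r. j * ms' ! j) < (\<Sum>j<r. j * ms ! j)" by simp
        \<comment> \<open>The induction measure drops by \<open>m\<^sub>i\<^sub>+\<^sub>1 - m\<^sub>i\<close>.\<close>
        hence "wedge R M (map X ms') \<in> N" using less.hyps[of ms'] less.prems len set' by simp
        moreover have "map X ms' = (map X ms)[i := map X ms ! Suc i, Suc i := map X ms ! i]"
          using i less.prems by (simp add: ms'_def map_update)
        hence "wedge R M (map X ms') = \<ominus>\<^bsub>EP r\<^esub> wedge R M (map X ms)"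
          using adj_alternating_swap[OF M E.module_axioms wedge_multilinear wedge_alternating tup i(1)]
          by simp
        ultimately have "\<ominus>\<^bsub>EP r\<^esub> (\<ominus>\<^bsub>EP r\<^esub> wedge R M (map X ms)) \<in> N"
          using sub(3) by metis
        thus ?thesis using wedge_closed[OF tup] by simp
      qed
    qed
  qed
  have "wedge R M (map X ms @ us) \<in> N"
    if "length ms + length us = r" "set ms \<subseteq> {..<n}" "set us \<subseteq> carrier M" for ms us
    using that
  proof (induction us arbitrary: ms)
    case Nil
    thus ?case using basis by simp
  next
    case (Cons u us)
    let ?w = "\<lambda>v. wedge R M (map X ms @ v # us)"
    have tup: "map X ms @ v # us \<in> tuples M r" if "v \<in> carrier M" for v
      using Cons.prems that X by (auto simp: tuples_def)
    have upd: "map X ms @ v # us = (map X ms @ u # us)[length ms := v]" for v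
      by (simp add: list_update_append)
    have u: "u \<in> carrier M" and l: "length ms < r" using Cons.prems by auto
    have wa: "?w (x \<oplus>\<^bsub>M\<^esub> y) = ?w x \<oplus>\<^bsub>EP r\<^esub> ?w y" if "x \<in> carrier M" "y \<in> carrier M" for x y
      unfolding upd[of x] upd[of y] upd[of "x \<oplus>\<^bsub>M\<^esub> y"] by (rule ml(2)[OF tup[OF u] l that])
    have ws: "?w (k \<odot>\<^bsub>M\<^esub> x) = k \<odot>\<^bsub>EP r\<^esub> ?w x" if "k \<in> carrier R" "x \<in> carrier M" for k x
      unfolding upd[of x] upd[of "k \<odot>\<^bsub>M\<^esub> x"] by (rule ml(3)[OF tup[OF u] l that])
    have wc: "?w x \<in> carrier (EP r)" if "x \<in> carrier M" for x
      by (rule wedge_closed[OF tup[OF that]])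
    have "{v \<in> carrier M. ?w v \<in> N} = carrier M"
    proof (rule span)
      have *: "k \<odot>\<^bsub>M\<^esub> x \<in> {v \<in> carrier M. ?w v \<in> N}" if "k \<in> carrier R" "x \<in> {v \<in> carrier M. ?w v \<in> N}" for k x
        using that sub(4) by (simp add: ws)
      show "submodule {v \<in> carrier M. ?w v \<in> N} R M"
      proof (rule M.submoduleI)
        have "?w (\<zero>\<^bsub>R\<^esub> \<odot>\<^bsub>M\<^esub> u) = \<zero>\<^bsub>EP r\<^esub>"
          using wc[OF u] u by (subst ws) auto
        thus "\<zero>\<^bsub>M\<^esub> \<in> {v \<in> carrier M. ?w v \<in> N}" using u zN by simp
        show "\<ominus>\<^bsub>M\<^esub> x \<in> {v \<in> carrier M. ?w v \<in> N}" if "x \<in> {v \<in> carrier M. ?w v \<in> N}" for x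
          using *[of "\<ominus>\<^bsub>R\<^esub> \<one>\<^bsub>R\<^esub>" x] that by (simp add: M.smult_l_minus)
      qed (use * sub(5) in \<open>auto simp: wa\<close>)
      show "X ` {..<n} \<subseteq> {v \<in> carrier M. ?w v \<in> N}"
      proof safe
        fix i assume i: "i < n"
        show "X i \<in> carrier M" using X i by blast
        show "?w (X i) \<in> N" using Cons.IH[of "ms @ [i]"] Cons.prems i by simp
      qed
    qed
    thus ?case using u by blast
  qed
  from this[of "[]"] show ?thesis
    by (intro ext_power_span[OF N]) (auto simp: tuples_def)
qed

end

section \<open>Coefficients of power series at integer indices\<close>

text \<open>
  Coefficients at negative indices are \<open>0\<close>. With this convention, which is the one for \<open>h\<^sub>j(c)\<close>, the
  identities for products of power series hold with shifted indices and without case distinctions.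
\<close>

definition icoef :: "'a::zero fps \<Rightarrow> int \<Rightarrow> 'a" where
  "icoef F j = (if j < 0 then 0 else fps_nth F (nat j))"

lemma icoef_of_nat [simp]: "icoef F (int j) = fps_nth F j"
  by (simp add: icoef_def)

lemma icoef_neg [simp]: "j < 0 \<Longrightarrow> icoef F j = 0"
  by (simp add: icoef_def)

text \<open>
  The sum over \<open>i \<le> M\<close> is the full convolution as soon as every omitted term has a vanishing factor.
\<close>

lemma icoef_mult:
  fixes F G :: "'a::comm_ring_1 fps"
  assumes "\<And>i. i > M \<Longrightarrow> fps_nth F i = 0 \<or> int i > j"
  shows "(\<Sum>i\<le>M. fps_nth F i * icoef G (j - int i)) = icoef (F * G) j"
proof (cases "j < 0")
  case False
  define J where "J = nat j"
  have j: "j = int J" using False by (simp add: J_def)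
  have "(\<Sum>i\<le>M. fps_nth F i * icoef G (j - int i)) = (\<Sum>i\<le>M + J. fps_nth F i * icoef G (j - int i))"
  proof (rule sum.mono_neutral_left)
    show "\<forall>i\<in>{..M + J} - {..M}. fps_nth F i * icoef G (j - int i) = 0"
      using assms by (metis DiffD2 atMost_iff diff_less_0_iff_less icoef_neg mult_zero_left mult_zero_right not_le)
  qed auto
  also have "\<dots> = (\<Sum>i\<le>J. fps_nth F i * icoef G (j - int i))"
    by (rule sum.mono_neutral_right) (auto simp: j)
  also have "\<dots> = (\<Sum>i\<le>J. fps_nth F i * fps_nth G (J - i))"
    by (intro sum.cong) (auto simp: j icoef_def nat_diff_distrib')
  also have "\<dots> = icoef (F * G) j" by (simp add: j fps_mult_nth atLeast0AtMost)
  finally show ?thesis .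
qed auto

lemma vars_0 [simp]: "vars N 0 = 1" by (simp add: vars_def)

lemma vars_beyond [simp]: "i > N \<Longrightarrow> vars N i = 0" by (simp add: vars_def)

lemma alt_gf_nth [simp]: "fps_nth (alt_gf N) i = (- 1) ^ i * vars N i"
  by (simp add: alt_gf_def)

definition inv_gf :: "nat \<Rightarrow> ('a::comm_ring_1) mpol fps" where
  "inv_gf N = fps_right_inverse (alt_gf N) 1"

text \<open>
  For \<open>N = n\<close> over \<open>\<rat>\<close> the inverse series is \<open>\<Sum>\<^sub>i s\<^sub>i z\<^sup>i\<close>; for \<open>N = r\<close> over \<open>B\<^sub>0(c)\<close> its
  coefficients are the complete symmetric functions \<open>p\<^sub>j\<close> attached to \<open>e\<^sub>1, \<dots>, e\<^sub>r\<close>.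
\<close>

lemma alt_inv_gf: "alt_gf N * inv_gf N = 1"
  unfolding inv_gf_def by (rule fps_right_inverse) simp

lemma ss_eq: "ss n i = fps_nth (inv_gf n) i"
  by (simp add: ss_def inv_gf_def)

lemma alt_cE: "alt_gf r * cE n r = Abs_fps (\<lambda>i. cst (fps_nth (alt_gf n) i))"
  using alt_inv_gf[where 'a = b0, of r] by (simp add: cE_def inv_gf_def mult.left_commute)

lemma hc_eq: "hc n r j = icoef (cE n r) j"
  by (simp add: hc_def icoef_def)

lemma cst_0 [simp]: "cst 0 = 0" by (simp add: cst_def)
lemma cst_1 [simp]: "cst 1 = 1" by (simp add: cst_def)
lemma cst_add: "cst (a + b) = cst a + cst b" by (simp add: cst_def single_add)
lemma cst_mult: "cst (a * b) = cst a * cst (b :: 'a :: comm_ring_1)"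
  by (simp add: cst_def mult_single)
lemma cst_uminus: "cst (- a) = - cst (a :: 'a :: comm_ring_1)"
  by (simp add: cst_def single_uminus)
lemma cst_power: "cst (a ^ k) = cst (a :: 'a :: comm_ring_1) ^ k"
  by (induction k) (auto simp: cst_mult)
lemma cst_sign: "cst ((- 1) ^ i * a) = (- 1) ^ i * cst (a :: 'a :: comm_ring_1)"
  by (simp add: cst_mult cst_power cst_uminus)

abbreviation complete_h :: "nat \<Rightarrow> int \<Rightarrow> br" where "complete_h r \<equiv> icoef (inv_gf r)"
abbreviation s_coeff :: "nat \<Rightarrow> int \<Rightarrow> b0" where "s_coeff n \<equiv> icoef (inv_gf n)"

lemma hc_conv:
  assumes "\<And>i. i > M \<Longrightarrow> i > n \<or> int i > j"
  shows "(\<Sum>i\<le>M. (- 1) ^ i * cst (cc n i) * complete_h r (j - int i)) = hc n r j"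
proof -
  let ?F = "Abs_fps (\<lambda>i. cst (fps_nth (alt_gf n) i)) :: br fps"
  have "(\<Sum>i\<le>M. fps_nth ?F i * complete_h r (j - int i)) = icoef (?F * inv_gf r) j"
    by (rule icoef_mult) (use assms in force)
  thus ?thesis by (simp add: hc_eq cE_def inv_gf_def cst_sign cc_def)
qed

lemma s_coeff_conv:
  assumes "\<And>i. i > M \<Longrightarrow> i > n \<or> int i > j"
  shows "(\<Sum>i\<le>M. (- 1) ^ i * cc n i * s_coeff n (j - int i)) = (if j = 0 then 1 else 0)"
proof -
  have "(\<Sum>i\<le>M. fps_nth (alt_gf n) i * s_coeff n (j - int i)) = icoef (alt_gf n * inv_gf n) j"
    by (rule icoef_mult) (use assms in force)
  thus ?thesis by (auto simp: alt_inv_gf cc_def icoef_def)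
qed

lemma complete_h_conv: "(\<Sum>i\<le>r. (- 1) ^ i * vars r i * complete_h r (j - int i)) = (if j = 0 then 1 else 0)"
proof -
  have "(\<Sum>i\<le>r. fps_nth (alt_gf r) i * complete_h r (j - int i)) = icoef (alt_gf r * inv_gf r) j"
    by (rule icoef_mult) force
  thus ?thesis by (auto simp: alt_inv_gf icoef_def)
qed

text \<open>
  The product \<open>E\<^sub>r(z) \<cdot> (c(z) / E\<^sub>r(z)) = c(z)\<close> has degree \<open>n\<close>.
\<close>

lemma hc_rec:
  assumes "j > int n"
  shows "(\<Sum>i\<le>r. (- 1) ^ i * vars r i * hc n r (j - int i)) = 0"
proof -
  have "(\<Sum>i\<le>r. fps_nth (alt_gf r) i * icoef (cE n r) (j - int i)) = icoef (alt_gf r * cE n r) j"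
    by (rule icoef_mult) force
  thus ?thesis using assms by (auto simp: alt_cE icoef_def hc_eq)
qed

section \<open>Linear functionals on univariate polynomials\<close>

text \<open>
  The additive map on polynomials with \<open>a X\<^sup>m \<mapsto> \<phi>(a) u\<^sub>m\<close>. Evaluation at a point, the dual basis
  and the rows of the Schur determinants are all of this kind.
\<close>

definition poly_fun :: "('a::comm_ring_1 \<Rightarrow> 'b::comm_ring_1) \<Rightarrow> (nat \<Rightarrow> 'b) \<Rightarrow> 'a poly \<Rightarrow> 'b" where
  "poly_fun \<phi> u f = (\<Sum>m\<le>Polynomial.degree f. \<phi> (Polynomial.coeff f m) * u m)"

locale coeff_hom =
  fixes \<phi> :: "'a::comm_ring_1 \<Rightarrow> 'b::comm_ring_1"
  assumes zero [simp]: "\<phi> 0 = 0" and one [simp]: "\<phi> 1 = 1"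
    and add: "\<phi> (a + b) = \<phi> a + \<phi> b" and mult: "\<phi> (a * b) = \<phi> a * \<phi> b"
begin

lemma poly_fun_bound:
  assumes "Polynomial.degree f \<le> N"
  shows "poly_fun \<phi> u f = (\<Sum>m\<le>N. \<phi> (Polynomial.coeff f m) * u m)"
  unfolding poly_fun_def by (rule sum.mono_neutral_left) (use assms in \<open>auto simp: coeff_eq_0\<close>)

lemma poly_fun_add: "poly_fun \<phi> u (f + g) = poly_fun \<phi> u f + poly_fun \<phi> u g"
proof -
  let ?N = "max (Polynomial.degree f) (Polynomial.degree g)"
  show ?thesis
    by (subst (1 2 3) poly_fun_bound[of _ ?N])
      (auto simp: degree_add_le add distrib_right sum.distrib)
qed

lemma poly_fun_0 [simp]: "poly_fun \<phi> u 0 = 0" by (simp add: poly_fun_def)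

lemma poly_fun_sum: "poly_fun \<phi> u (\<Sum>i\<in>A. f i) = (\<Sum>i\<in>A. poly_fun \<phi> u (f i))"
  by (induction A rule: infinite_finite_induct) (auto simp: poly_fun_add)

lemma poly_fun_smult: "poly_fun \<phi> u (Polynomial.smult a f) = \<phi> a * poly_fun \<phi> u f"
  by (subst (1 2) poly_fun_bound[of _ "Polynomial.degree f"])
    (auto simp: degree_smult_le mult sum_distrib_left mult.assoc)

lemma poly_fun_monom: "poly_fun \<phi> u (Polynomial.monom a m) = \<phi> a * u m"
proof -
  have "poly_fun \<phi> u (Polynomial.monom a m) = (\<Sum>j\<le>m. \<phi> (Polynomial.coeff (Polynomial.monom a m) j) * u j)"
    by (rule poly_fun_bound) (rule degree_monom_le)
  also have "\<dots> = (\<Sum>j\<in>{m}. \<phi> (Polynomial.coeff (Polynomial.monom a m) j) * u j)"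
    by (rule sum.mono_neutral_right) auto
  finally show ?thesis by simp
qed

lemma poly_fun_uminus: "poly_fun \<phi> u (- f) = - poly_fun \<phi> u f"
  using poly_fun_add[of u f "- f"] by (simp add: eq_neg_iff_add_eq_0 add.commute)

lemma poly_fun_shift: "poly_fun \<phi> u (Polynomial.monom 1 t * f) = poly_fun \<phi> (\<lambda>m. u (t + m)) f"
proof -
  have "poly_fun \<phi> u (Polynomial.monom 1 t * f) =
      poly_fun \<phi> u (\<Sum>i\<le>Polynomial.degree f. Polynomial.monom (Polynomial.coeff f i) (t + i))"
    by (subst (1) poly_as_sum_of_monoms[of f, symmetric]) (simp add: sum_distrib_left mult_monom)
  also have "\<dots> = poly_fun \<phi> (\<lambda>m. u (t + m)) f"
    by (simp add: poly_fun_sum poly_fun_monom) (simp add: poly_fun_def)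
  finally show ?thesis .
qed

lemma poly_fun_lincomb: "poly_fun \<phi> (\<lambda>m. \<Sum>i\<in>A. a i * u i m) f = (\<Sum>i\<in>A. a i * poly_fun \<phi> (u i) f)"
proof -
  have "poly_fun \<phi> (\<lambda>m. \<Sum>i\<in>A. a i * u i m) f =
    (\<Sum>m\<le>Polynomial.degree f. \<Sum>i\<in>A. a i * (\<phi> (Polynomial.coeff f m) * u i m))"
    unfolding poly_fun_def sum_distrib_left by (intro sum.cong refl) (rule mult.left_commute)
  also have "\<dots> = (\<Sum>i\<in>A. a i * poly_fun \<phi> (u i) f)"
    unfolding poly_fun_def sum_distrib_left by (rule sum.swap)
  finally show ?thesis .
qed

end

lemma coeff_hom_cst: "coeff_hom (cst :: b0 \<Rightarrow> br)"
  by (rule coeff_hom.intro) (simp_all add: cst_add cst_mult)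

interpretation cst: coeff_hom "cst :: b0 \<Rightarrow> br"
  by (rule coeff_hom_cst)

lemma coeff_hom_id: "coeff_hom (\<lambda>x :: b0. x)"
  by (rule coeff_hom.intro) simp_all



lemma poly_fun_Xc_shift:
  fixes \<phi> :: "b0 \<Rightarrow> 'c::comm_ring_1"
  assumes "coeff_hom \<phi>"
  shows "poly_fun \<phi> u (Polynomial.monom 1 t * Xc n m) = (\<Sum>i\<le>m. \<phi> ((- 1) ^ i * cc n i) * u (t + m - i))"
proof -
  interpret coeff_hom \<phi> by fact
  have "poly_fun \<phi> u (Polynomial.monom 1 t * Xc n m) =
      (\<Sum>i\<le>m. \<phi> ((- 1) ^ i * cc n i) * u (t + (m - i)))"
    unfolding Xc_def poly_fun_shift poly_fun_sum poly_fun_monom ..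
  also have "\<dots> = (\<Sum>i\<le>m. \<phi> ((- 1) ^ i * cc n i) * u (t + m - i))"
    by (intro sum.cong) auto
  finally show ?thesis .
qed

section \<open>Substitution in multivariate polynomials\<close>

lemma mpol_sum_singles:
  "(p :: 'a::comm_ring_1 mpol) = (\<Sum>m\<in>Poly_Mapping.keys p. Poly_Mapping.single m (Poly_Mapping.lookup p m))"
  by (rule poly_mapping_eqI) (auto simp: lookup_sum lookup_single when_def sum.delta' in_keys_iff)

text \<open>
  Identities that are additive in \<open>p\<close> need to be checked on monomials only.
\<close>

lemma mpol_induct [case_names zero single add]:
  fixes p :: "'a::comm_ring_1 mpol"
  assumes "P 0" "\<And>m a. P (Poly_Mapping.single m a)" "\<And>p q. P p \<Longrightarrow> P q \<Longrightarrow> P (p + q)"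
  shows "P p"
proof -
  have "P (\<Sum>m\<in>A. Poly_Mapping.single m (Poly_Mapping.lookup p m))" if "finite A" for A
    using that by (induction A rule: finite_induct) (use assms in auto)
  from this[OF finite_keys[of p]] show ?thesis unfolding mpol_sum_singles[of p, symmetric] .
qed

text \<open>
  The additive map with \<open>a x\<^sup>m \<mapsto> \<phi>(a) g(m)\<close> for all exponent vectors \<open>m\<close>.
\<close>

definition mpol_fun :: "('a::comm_ring_1 \<Rightarrow> 'b::comm_ring_1) \<Rightarrow> ((nat \<Rightarrow>\<^sub>0 nat) \<Rightarrow> 'b) \<Rightarrow> 'a mpol \<Rightarrow> 'b" where
  "mpol_fun \<phi> g p = (\<Sum>m\<in>Poly_Mapping.keys p. \<phi> (Poly_Mapping.lookup p m) * g m)"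

context coeff_hom
begin

lemma mpol_fun_bound:
  assumes "finite A" "Poly_Mapping.keys p \<subseteq> A"
  shows "mpol_fun \<phi> g p = (\<Sum>m\<in>A. \<phi> (Poly_Mapping.lookup p m) * g m)"
  unfolding mpol_fun_def by (rule sum.mono_neutral_left) (use assms in \<open>auto simp: in_keys_iff\<close>)

lemma mpol_fun_0 [simp]: "mpol_fun \<phi> g 0 = 0" by (simp add: mpol_fun_def)

lemma mpol_fun_add: "mpol_fun \<phi> g (p + q) = mpol_fun \<phi> g p + mpol_fun \<phi> g q"
proof -
  let ?A = "Poly_Mapping.keys p \<union> Poly_Mapping.keys q"
  have "Poly_Mapping.keys (p + q) \<subseteq> ?A" by (rule keys_add)
  thus ?thesis
    by (subst (1 2 3) mpol_fun_bound[of ?A]) (auto simp: lookup_add add distrib_right sum.distrib)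
qed

lemma mpol_fun_single: "mpol_fun \<phi> g (Poly_Mapping.single m a) = \<phi> a * g m"
  by (subst mpol_fun_bound[of "{m}"]) auto

lemma mpol_fun_sum: "mpol_fun \<phi> g (\<Sum>i\<in>A. p i) = (\<Sum>i\<in>A. mpol_fun \<phi> g (p i))"
  by (induction A rule: infinite_finite_induct) (auto simp: mpol_fun_add)

lemma mpol_fun_cst_mult: "mpol_fun \<phi> g (cst a * p) = \<phi> a * mpol_fun \<phi> g p"
proof (induction p rule: mpol_induct)
  case (single m b)
  show ?case by (simp add: cst_def mult_single mpol_fun_single mult mult.assoc)
qed (auto simp: distrib_left mpol_fun_add)

definition mon_eval :: "(nat \<Rightarrow> 'b) \<Rightarrow> (nat \<Rightarrow>\<^sub>0 nat) \<Rightarrow> 'b" where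
  "mon_eval x m = (\<Prod>i\<in>Poly_Mapping.keys m. x i ^ Poly_Mapping.lookup m i)"

lemma mon_eval_bound:
  assumes "finite A" "Poly_Mapping.keys m \<subseteq> A"
  shows "mon_eval x m = (\<Prod>i\<in>A. x i ^ Poly_Mapping.lookup m i)"
  unfolding mon_eval_def by (rule prod.mono_neutral_left) (use assms in \<open>auto simp: in_keys_iff\<close>)

lemma mon_eval_add: "mon_eval x (m + k) = mon_eval x m * mon_eval x k"
proof -
  let ?A = "Poly_Mapping.keys m \<union> Poly_Mapping.keys k"
  have "Poly_Mapping.keys (m + k) \<subseteq> ?A" by (rule keys_add)
  thus ?thesis
    by (subst (1 2 3) mon_eval_bound[of ?A]) (auto simp: lookup_add power_add prod.distrib)
qed

lemma mon_eval_single: "mon_eval x (Poly_Mapping.single i k) = x i ^ k"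
  by (subst mon_eval_bound[of "{i}"]) auto

lemma mon_eval_0 [simp]: "mon_eval x 0 = 1" by (simp add: mon_eval_def)

definition msubst :: "(nat \<Rightarrow> 'b) \<Rightarrow> 'a mpol \<Rightarrow> 'b" where
  "msubst x = mpol_fun \<phi> (mon_eval x)"

lemma msubst_mult: "msubst x (p * q) = msubst x p * msubst x q"
proof (induction p rule: mpol_induct)
  case (single m a)
  show ?case
  proof (induction q rule: mpol_induct)
    case (single k b)
    show ?case by (simp add: msubst_def mult_single mpol_fun_single mult mon_eval_add mult_ac)
  qed (auto simp: msubst_def distrib_left mpol_fun_add)
qed (auto simp: msubst_def distrib_right mpol_fun_add)

lemma msubst_cst [simp]: "msubst x (cst a) = \<phi> a"
  by (simp add: msubst_def cst_def mpol_fun_single)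

lemma msubst_hom: "comm_ring_hom (msubst x)"
proof
  show "msubst x 1 = 1" using msubst_cst[of x 1] by (simp del: msubst_cst)
qed (auto simp: msubst_mult, auto simp: msubst_def mpol_fun_add)

lemma msubst_vars: "msubst x (vars N i) = (if i = 0 then 1 else if i \<le> N then x i else 0)"
proof -
  interpret h: comm_ring_hom "msubst x" by (rule msubst_hom)
  show ?thesis by (auto simp: vars_def) (simp add: msubst_def mpol_fun_single mon_eval_single)
qed

end

section \<open>The coefficient rings as subrings\<close>

text \<open>
  The polynomial rings with finitely many variables are subrings of types with infinitely many
  variables. Stating membership separately keeps all computations in the ring operations of the type.
\<close>

definition is_subring :: "'a::comm_ring_1 set \<Rightarrow> bool" where
  "is_subring S \<longleftrightarrow> 0 \<in> S \<and> 1 \<in> S \<and> (\<forall>x\<in>S. \<forall>y\<in>S. x + y \<in> S \<and> x * y \<in> S) \<and> (\<forall>x\<in>S. - x \<in> S)"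

lemma is_subringD:
  assumes "is_subring S"
  shows "0 \<in> S" "1 \<in> S" "x \<in> S \<Longrightarrow> y \<in> S \<Longrightarrow> x + y \<in> S" "x \<in> S \<Longrightarrow> y \<in> S \<Longrightarrow> x * y \<in> S"
    "x \<in> S \<Longrightarrow> - x \<in> S"
  using assms by (auto simp: is_subring_def)

lemma is_subring_diff: "is_subring S \<Longrightarrow> x \<in> S \<Longrightarrow> y \<in> S \<Longrightarrow> x - y \<in> S"
  using is_subringD(3)[of S x "- y"] is_subringD(5)[of S y] by simp

lemma is_subring_sum: "is_subring S \<Longrightarrow> (\<And>i. i \<in> A \<Longrightarrow> f i \<in> S) \<Longrightarrow> sum f A \<in> S"
  by (induction A rule: infinite_finite_induct) (auto intro: is_subringD)

lemma is_subring_prod: "is_subring S \<Longrightarrow> (\<And>i. i \<in> A \<Longrightarrow> f i \<in> S) \<Longrightarrow> prod f A \<in> S"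
  by (induction A rule: infinite_finite_induct) (auto intro: is_subringD)

lemma is_subring_power: "is_subring S \<Longrightarrow> x \<in> S \<Longrightarrow> x ^ k \<in> S"
  by (induction k) (auto intro: is_subringD)

lemma is_subring_det:
  assumes "is_subring S" "\<And>i j. i < r \<Longrightarrow> j < r \<Longrightarrow> f i j \<in> S"
  shows "det (mat r r (\<lambda>(i, j). f i j)) \<in> S"
proof -
  have sgn: "of_int (sign p) \<in> S" for p :: "nat \<Rightarrow> nat"
    using is_subringD[OF assms(1)] by (cases p rule: sign_cases) auto
  have eq: "det (mat r r (\<lambda>(i, j). f i j)) =
      (\<Sum>p | p permutes {0..<r}. of_int (sign p) * (\<Prod>i = 0..<r. mat r r (\<lambda>(i, j). f i j) $$ (i, p i)))"
    by (rule det_def') simp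
  show ?thesis unfolding eq
  proof (intro is_subring_sum is_subring_prod is_subringD(4)[OF assms(1)] assms(1) sgn)
    fix p i assume p: "p \<in> {p. p permutes {0..<r}}" and i: "i \<in> {0..<r}"
    have "p i < r" using p i permutes_in_image[of p "{0..<r}" i] by auto
    thus "mat r r (\<lambda>(i, j). f i j) $$ (i, p i) \<in> S" using i assms(2) by simp
  qed
qed

lemma cring_ring_on:
  assumes "is_subring S"
  shows "cring (ring_on S)"
proof (rule cringI)
  note S = is_subringD[OF assms]
  show "abelian_group (ring_on S)"
    by (rule abelian_groupI) (use S in \<open>auto simp: ring_on_def add_ac intro: bexI[of _ "- _"]\<close>)
  show "Group.comm_monoid (ring_on S)"
    by (rule comm_monoidI) (use S in \<open>auto simp: ring_on_def mult_ac\<close>)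
qed (auto simp: ring_on_def distrib_right)

definition mpols :: "'a::comm_ring_1 set \<Rightarrow> nat \<Rightarrow> 'a mpol set" where
  "mpols K N = {p. (\<forall>m. Poly_Mapping.lookup p m \<in> K) \<and>
     (\<forall>m \<in> Poly_Mapping.keys p. Poly_Mapping.keys m \<subseteq> {1..N})}"

lemma mpols_single:
  assumes "is_subring K" "a \<in> K" "Poly_Mapping.keys m \<subseteq> {1..N}"
  shows "Poly_Mapping.single m a \<in> mpols K N"
  using assms is_subringD(1)[OF assms(1)]
  by (auto simp: mpols_def lookup_single when_def split: if_splits)

lemma mpols_add:
  assumes "is_subring K" "p \<in> mpols K N" "q \<in> mpols K N"
  shows "p + q \<in> mpols K N"
  using assms is_subringD(3)[OF assms(1)] keys_add[of p q]
  unfolding mpols_def mem_Collect_eq lookup_add by blast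

lemma mpols_sum:
  assumes "is_subring K" "\<And>i. i \<in> A \<Longrightarrow> f i \<in> mpols K N"
  shows "sum f A \<in> mpols K N"
  using assms(2)
proof (induction A rule: infinite_finite_induct)
  case (insert x A)
  thus ?case using mpols_add[OF assms(1)] by simp
qed (use is_subringD(1)[OF assms(1)] in \<open>auto simp: mpols_def\<close>)

lemma is_subring_mpols:
  assumes "is_subring K"
  shows "is_subring (mpols K N)"
proof -
  note K = is_subringD[OF assms]
  have "p * q \<in> mpols K N" if p: "p \<in> mpols K N" and q: "q \<in> mpols K N" for p q :: "'a mpol"
  proof -
    have "p * q = (\<Sum>m\<in>Poly_Mapping.keys p. Poly_Mapping.single m (Poly_Mapping.lookup p m)) *
        (\<Sum>k\<in>Poly_Mapping.keys q. Poly_Mapping.single k (Poly_Mapping.lookup q k))"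
      using mpol_sum_singles[of p] mpol_sum_singles[of q] by simp
    also have "\<dots> = (\<Sum>m\<in>Poly_Mapping.keys p. \<Sum>k\<in>Poly_Mapping.keys q.
        Poly_Mapping.single (m + k) (Poly_Mapping.lookup p m * Poly_Mapping.lookup q k))"
      by (simp add: sum_product mult_single)
    also have "\<dots> \<in> mpols K N"
    proof (intro mpols_sum[OF assms] mpols_single[OF assms] K)
      fix m k assume "m \<in> Poly_Mapping.keys p" "k \<in> Poly_Mapping.keys q"
      thus "Poly_Mapping.keys (m + k) \<subseteq> {1..N}"
        using p q keys_add[of m k] unfolding mpols_def by blast
    qed (use p q in \<open>auto simp: mpols_def\<close>)
    finally show ?thesis .
  qed
  moreover have "- p \<in> mpols K N" if "p \<in> mpols K N" for p :: "'a mpol"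
    using that K(5) by (auto simp: mpols_def in_keys_iff)
  moreover have "0 \<in> mpols K N" using K(1) by (simp add: mpols_def)
  moreover have "1 \<in> mpols K N" using K(1,2) by (auto simp: mpols_def lookup_one when_def)
  ultimately show ?thesis using mpols_add[OF assms] by (auto simp: is_subring_def)
qed

lemma mpols_cst: "is_subring K \<Longrightarrow> a \<in> K \<Longrightarrow> cst a \<in> mpols K N"
  unfolding cst_def by (rule mpols_single) auto

lemma mpols_vars: "is_subring K \<Longrightarrow> vars N i \<in> mpols K N"
  using is_subringD[OF is_subring_mpols[of K N]]
  by (auto simp: vars_def intro!: mpols_single is_subringD)

text \<open>
  The recursion for the coefficients of an inverse series with constant term \<open>1\<close> involves no division.
\<close>

lemma fps_inverse_subring:
  fixes F G :: "'a::comm_ring_1 fps"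
  assumes "is_subring S" "\<And>i. fps_nth F i \<in> S" "F * G = 1" "fps_nth F 0 = 1"
  shows "fps_nth G i \<in> S"
proof (induction i rule: less_induct)
  case (less i)
  have "fps_nth (F * G) i = fps_nth G i + (\<Sum>k\<in>{1..i}. fps_nth F k * fps_nth G (i - k))"
    by (simp add: fps_mult_nth sum.atLeast_Suc_atMost assms(4))
  hence "fps_nth G i = (if i = 0 then 1 else 0) - (\<Sum>k\<in>{1..i}. fps_nth F k * fps_nth G (i - k))"
    by (simp add: assms(3) eq_diff_eq)
  also have "\<dots> \<in> S"
    using is_subringD[OF assms(1)] less
    by (intro is_subring_diff is_subring_sum assms is_subringD(4)[OF assms(1)]) auto
  finally show ?case .
qed

lemma sign_mult_subring: "is_subring S \<Longrightarrow> x \<in> S \<Longrightarrow> (- 1) ^ i * x \<in> S"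
  by (cases "even i") (auto intro: is_subringD)

abbreviation B0_set :: "nat \<Rightarrow> b0 set" where "B0_set n \<equiv> mpols UNIV n"
abbreviation Br_set :: "nat \<Rightarrow> nat \<Rightarrow> br set" where "Br_set n r \<equiv> mpols (B0_set n) r"

lemma B0_set_subring: "is_subring (B0_set n)"
  by (rule is_subring_mpols) (simp add: is_subring_def)

lemma Br_set_subring: "is_subring (Br_set n r)"
  by (rule is_subring_mpols[OF B0_set_subring])

lemma B0_eq: "B0 n = ring_on (B0_set n)"
  by (simp add: B0_def mpol_ring_def mpols_def)

lemma B0_carrier: "carrier (B0 n) = B0_set n"
  by (simp add: B0_eq ring_on_def)

lemma Br_eq: "Br n r = ring_on (Br_set n r)"
  unfolding Br_def mpol_ring_def B0_carrier mpols_def[of "B0_set n" r] ..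

lemma cc_closed: "cc n i \<in> B0_set n"
  unfolding cc_def by (rule mpols_vars) (simp add: is_subring_def)

lemma s_coeff_closed: "s_coeff n j \<in> B0_set n"
proof -
  have "fps_nth (inv_gf n) i \<in> B0_set n" for i
    by (rule fps_inverse_subring[OF B0_set_subring _ alt_inv_gf])
      (auto intro!: sign_mult_subring[OF B0_set_subring] mpols_vars simp: is_subring_def)
  thus ?thesis using is_subringD(1)[OF B0_set_subring] by (simp add: icoef_def)
qed

lemma complete_h_closed: "complete_h r j \<in> Br_set n r"
proof -
  have "fps_nth (inv_gf r) i \<in> Br_set n r" for i
    by (rule fps_inverse_subring[OF Br_set_subring _ alt_inv_gf])
      (auto intro!: sign_mult_subring[OF Br_set_subring] mpols_vars B0_set_subring)
  thus ?thesis using is_subringD(1)[OF Br_set_subring] by (simp add: icoef_def)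
qed

lemma hc_closed: "hc n r j \<in> Br_set n r"
  unfolding hc_conv[of n n j r, symmetric, simplified]
  by (intro is_subring_sum Br_set_subring is_subringD(4)[OF Br_set_subring] sign_mult_subring mpols_cst
      B0_set_subring cc_closed complete_h_closed)

section \<open>Determinants\<close>

text \<open>
  Cofactors along column \<open>c\<close> do not see that column, so the three matrices share them.
\<close>

lemma det_col_linear:
  fixes A :: "'a::comm_ring_1 mat"
  assumes "A \<in> carrier_mat n n" "B \<in> carrier_mat n n" "C \<in> carrier_mat n n" "c < n"
    and "\<And>i j. i < n \<Longrightarrow> j < n \<Longrightarrow> j \<noteq> c \<Longrightarrow> B $$ (i, j) = A $$ (i, j) \<and> C $$ (i, j) = A $$ (i, j)"
    and "\<And>i. i < n \<Longrightarrow> A $$ (i, c) = B $$ (i, c) + x * C $$ (i, c)"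
  shows "det A = det B + x * det C"
proof -
  have del: "mat_delete B i c = mat_delete A i c" "mat_delete C i c = mat_delete A i c" if "i < n" for i
    using that assms(1-5) by (auto simp: mat_delete_def)
  hence cof: "cofactor B i c = cofactor A i c" "cofactor C i c = cofactor A i c" if "i < n" for i
    using that by (auto simp: cofactor_def)
  have "det A = (\<Sum>i<n. A $$ (i, c) * cofactor A i c)"
    by (rule laplace_expansion_column) fact+
  also have "\<dots> = (\<Sum>i<n. B $$ (i, c) * cofactor B i c) + x * (\<Sum>i<n. C $$ (i, c) * cofactor C i c)"
    using assms(6) by (simp add: cof distrib_right sum.distrib sum_distrib_left mult.assoc)
  also have "(\<Sum>i<n. B $$ (i, c) * cofactor B i c) = det B"
    by (rule laplace_expansion_column[symmetric]) fact+
  also have "(\<Sum>i<n. C $$ (i, c) * cofactor C i c) = det C"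
    by (rule laplace_expansion_column[symmetric]) fact+
  finally show ?thesis .
qed

text \<open>
  Splitting one column after the other writes the determinant as a sum of powers of \<open>z\<close> times
  determinants with constant columns. It will be applied to columns \<open>L(f\<^sub>j) - z L(X f\<^sub>j)\<close>; with
  \<open>f'\<^sub>j = - X f\<^sub>j\<close> no signs appear, and closure of \<open>T\<close> under addition suffices.
\<close>

lemma det_expand_columns:
  fixes v :: "nat \<Rightarrow> 'v \<Rightarrow> 'a::comm_ring_1"
  assumes T: "\<And>x y. x \<in> T \<Longrightarrow> y \<in> T \<Longrightarrow> x + y \<in> T" "0 \<in> T"
    and base: "\<And>g. (\<And>j. j < n \<Longrightarrow> g j = f j \<or> g j = f' j) \<Longrightarrow> det (mat n n (\<lambda>(i, j). v i (g j))) \<in> T"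
  shows "fps_nth (det (mat n n (\<lambda>(i, j). fps_const (v i (f j)) + fps_X * fps_const (v i (f' j))))) q \<in> T"
proof -
  define M where "M = (\<lambda>c g. mat n n (\<lambda>(i, j). if j < c then fps_const (v i (f j)) + fps_X * fps_const (v i (f' j))
      else fps_const (v i (g j))))"
  have "fps_nth (det (M c g)) q \<in> T" if "c \<le> n" "\<And>j. j < n \<Longrightarrow> g j = f j \<or> g j = f' j" for c g q
    using that
  proof (induction c arbitrary: g q)
    case 0
    have "M 0 g = map_mat fps_const (mat n n (\<lambda>(i, j). v i (g j)))"
      by (auto simp: M_def)
    moreover have "comm_ring_hom (fps_const :: 'a \<Rightarrow> 'a fps)"
      by unfold_locales auto
    ultimately have "det (M 0 g) = fps_const (det (mat n n (\<lambda>(i, j). v i (g j))))"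
      by (simp add: comm_ring_hom.hom_det)
    thus ?case using base[of g] 0 T(2) by simp
  next
    case (Suc c)
    have c: "c < n" using Suc.prems by simp
    let ?g1 = "g(c := f c)" and ?g2 = "g(c := f' c)"
    have "det (M (Suc c) g) = det (M c ?g1) + fps_X * det (M c ?g2)"
      by (rule det_col_linear[of _ n _ _ c]) (use c in \<open>auto simp: M_def less_Suc_eq\<close>)
    moreover have "fps_nth (det (M c ?g1)) q \<in> T" for q
      by (rule Suc.IH) (use Suc.prems in auto)
    moreover have "fps_nth (det (M c ?g2)) q \<in> T" for q
      by (rule Suc.IH) (use Suc.prems in auto)
    ultimately show ?case using T by simp
  qed
  from this[of n f q] have "fps_nth (det (M n f)) q \<in> T" by simp
  also have "M n f = mat n n (\<lambda>(i, j). fps_const (v i (f j)) + fps_X * fps_const (v i (f' j)))"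
    by (auto simp: M_def)
  finally show ?thesis .
qed

section \<open>Determinants of complete symmetric functions\<close>

text \<open>
  With \<open>1 / E\<^sub>r(z) = \<Sum>\<^sub>j p\<^sub>j z\<^sup>j\<close>, row \<open>k\<close> is the linear map \<open>X\<^sup>m \<mapsto> p\<^bsub>m-r+1+k\<^esub>\<close>. It is
  chosen so that \<open>X\<^sup>m(c) \<mapsto> h\<^bsub>m-r+1+k\<^esub>(c)\<close>, because \<open>c(z) \<cdot> 1 / E\<^sub>r(z)\<close> generates the \<open>h\<^sub>j(c)\<close>.
\<close>

definition h_row :: "nat \<Rightarrow> nat \<Rightarrow> b0 poly \<Rightarrow> br" where
  "h_row r k = poly_fun cst (\<lambda>m. complete_h r (int m - int r + 1 + int k))"

text \<open>
  This is the element of \<open>B\<^sub>r(c)\<close> attached to \<open>f\<^sub>0 \<and> \<dots> \<and> f\<^bsub>r-1\<^esub>\<close>, written \<open>D(f)\<close> in the comments: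
  it is multilinear and alternating in the polynomials \<open>f\<^sub>j\<close>, and \<open>f\<^sub>j = X\<^bsup>r-1-j+\<lambda>\<^sub>j\<^esup>(c)\<close> gives
  \<open>\<Delta>\<^sub>\<lambda>(H\<^sub>r(c))\<close>.
\<close>

definition h_det :: "nat \<Rightarrow> (nat \<Rightarrow> b0 poly) \<Rightarrow> br" where
  "h_det r f = det (mat r r (\<lambda>(k, j). h_row r k (f j)))"

abbreviation X_times :: "b0 poly \<Rightarrow> b0 poly" where "X_times f \<equiv> pCons 0 f"

text \<open>
  In both admitted cases the convolution is complete: for \<open>t = 0\<close> the terms with \<open>i > m\<close> involve
  \<open>p\<close> at negative indices, and for \<open>m = n\<close> they involve \<open>c\<^sub>i\<close> with \<open>i > n\<close>.
\<close>

lemma h_row_Xc_shift: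
  assumes "k < r" "t = 0 \<or> m = n"
  shows "h_row r k (Polynomial.monom 1 t * Xc n m) = hc n r (int t + int m - int r + 1 + int k)"
proof -
  have "h_row r k (Polynomial.monom 1 t * Xc n m) = (\<Sum>i\<le>m. cst ((- 1) ^ i * cc n i) * complete_h r (int (t + m - i) - int r + 1 + int k))"
    unfolding h_row_def by (rule poly_fun_Xc_shift[OF coeff_hom_cst])
  also have "\<dots> = (\<Sum>i\<le>m. (- 1) ^ i * cst (cc n i) * complete_h r ((int t + int m - int r + 1 + int k) - int i))"
    by (intro sum.cong refl arg_cong2[of _ _ _ _ "(*)"] arg_cong[of _ _ "complete_h r"])
      (auto simp: cst_sign of_nat_diff)
  also have "\<dots> = hc n r (int t + int m - int r + 1 + int k)"
    by (rule hc_conv) (use assms in auto)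
  finally show ?thesis .
qed

lemma h_row_Xc: "k < r \<Longrightarrow> h_row r k (Xc n m) = hc n r (int m - int r + 1 + int k)"
  using h_row_Xc_shift[of k r 0 m n] by simp

lemma h_row_uminus: "h_row r k (- f) = - h_row r k f"
  unfolding h_row_def by (rule cst.poly_fun_uminus)

lemma h_row_add: "h_row r k (f + g) = h_row r k f + h_row r k g"
  unfolding h_row_def by (rule cst.poly_fun_add)

lemma h_row_smult: "h_row r k (Polynomial.smult a f) = cst a * h_row r k f"
  unfolding h_row_def by (rule cst.poly_fun_smult)

lemma h_row_X_times: "h_row r k (X_times f) = h_row r (Suc k) f"
proof -
  have X: "X_times f = Polynomial.monom 1 1 * f" by (simp add: monom_altdef)
  have "(\<lambda>m. complete_h r (int (1 + m) - int r + 1 + int k)) = (\<lambda>m. complete_h r (int m - int r + 1 + int (Suc k)))"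
    by (intro ext arg_cong[of _ _ "complete_h r"]) simp
  thus ?thesis unfolding X h_row_def cst.poly_fun_shift by simp
qed

text \<open>
  This is \<open>E\<^sub>r(z) \<cdot> 1 / E\<^sub>r(z) = 1\<close>. Together with \<open>h_row_X_times\<close> it says that multiplication by \<open>X\<close>
  acts on the column \<open>(h_row r k f)\<^sub>k\<close> by a companion matrix.
\<close>

lemma h_row_rec:
  assumes "r \<ge> 1"
  shows "(\<Sum>i\<le>r. (- 1) ^ i * vars r i * h_row r (r - i) f) = 0"
proof -
  have "(\<Sum>i\<le>r. (- 1) ^ i * vars r i * h_row r (r - i) f) =
      poly_fun cst (\<lambda>m. \<Sum>i\<le>r. ((- 1) ^ i * vars r i) * complete_h r (int m - int r + 1 + int (r - i))) f"
    unfolding h_row_def cst.poly_fun_lincomb ..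
  also have "(\<lambda>m. \<Sum>i\<le>r. ((- 1) ^ i * vars r i) * complete_h r (int m - int r + 1 + int (r - i))) =
      (\<lambda>m. \<Sum>i\<le>r. (- 1) ^ i * vars r i * complete_h r (int (Suc m) - int i))"
    by (intro ext sum.cong refl arg_cong2[of _ _ _ _ "(*)"] arg_cong[of _ _ "complete_h r"]) (auto simp: of_nat_diff)
  also have "\<dots> = (\<lambda>m. 0)" by (subst complete_h_conv) auto
  finally show ?thesis by (simp add: poly_fun_def)
qed

text \<open>
  \<open>1 - z A\<close>, where \<open>A\<close> is that companion matrix.
\<close>

definition companion_pencil :: "nat \<Rightarrow> br fps mat" where
  "companion_pencil r = mat r r (\<lambda>(k, l). (if k = l then 1 else 0) +
     fps_X * (if Suc k < r then if l = Suc k then - 1 else 0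
              else fps_const ((- 1) ^ (r - l) * vars r (r - l))))"

text \<open>
  Right multiplication by the unitriangular matrix with entries \<open>z\<^bsup>j-l\<^esup>\<close>, the inverse of the
  bidiagonal part, turns all rows but the last into unit rows and collects \<open>E\<^sub>r(z)\<close> in the corner.
\<close>

lemma det_companion_pencil:
  assumes "r \<ge> 1"
  shows "det (companion_pencil r) = alt_gf r"
proof -
  \<comment> \<open>The inverse of \<open>1 - z N\<close>, where \<open>N\<close> is the nilpotent shift in the upper rows of \<open>A\<close>.\<close>
  define U :: "br fps mat" where "U = mat r r (\<lambda>(l, j). if l \<le> j then fps_X ^ (j - l) else 0)"
  have C: "companion_pencil r \<in> carrier_mat r r" and U: "U \<in> carrier_mat r r" by (auto simp: companion_pencil_def U_def)
  have CU: "companion_pencil r * U \<in> carrier_mat r r" using C U by simp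
  have detU: "det U = 1"
  proof -
    have "det U = prod_list (diag_mat U)"
      by (rule det_upper_triangular[OF _ U]) (auto simp: U_def)
    also have "diag_mat U = replicate r 1"
      by (rule nth_equalityI) (auto simp: diag_mat_def U_def)
    finally show ?thesis by simp
  qed
  have ent: "(companion_pencil r * U) $$ (k, j) = (\<Sum>l<r. companion_pencil r $$ (k, l) * U $$ (l, j))" if "k < r" "j < r" for k j
    using that C U by (simp add: scalar_prod_def atLeast0LessThan)
  have top: "(companion_pencil r * U) $$ (k, j) = (if k = j then 1 else 0)" if k: "Suc k < r" and j: "j < r" for k j
  proof -
    have "(companion_pencil r * U) $$ (k, j) = (\<Sum>l\<in>{k, Suc k}. companion_pencil r $$ (k, l) * U $$ (l, j))"
      unfolding ent[OF Suc_lessD[OF k] j]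
      by (rule sum.mono_neutral_right) (use k in \<open>auto simp: companion_pencil_def\<close>)
    also have "\<dots> = U $$ (k, j) - fps_X * U $$ (Suc k, j)"
      using k by (simp add: companion_pencil_def)
    also have "\<dots> = (if k = j then 1 else 0)"
    proof (cases "k < j")
      case True
      hence "j - k = Suc (j - Suc k)" by simp
      thus ?thesis using True k j by (simp add: U_def)
    qed (use k j in \<open>auto simp: U_def\<close>)
    finally show ?thesis .
  qed
  have last: "(companion_pencil r * U) $$ (r - 1, r - 1) = alt_gf r"
  proof -
    have "(companion_pencil r * U) $$ (r - 1, r - 1) = (\<Sum>l<r. (if l = r - 1 then 1 else 0) * fps_X ^ (r - 1 - l)
       + fps_const ((- 1) ^ (r - l) * vars r (r - l)) * fps_X ^ (r - l))"
      using assms unfolding ent[of "r - 1" "r - 1", OF _ _]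
      by (subst ent) (auto intro!: sum.cong simp: companion_pencil_def U_def Suc_diff_Suc distrib_right mult_ac simp flip: power_Suc)
    also have "\<dots> = 1 + (\<Sum>l<r. fps_const ((- 1) ^ (r - l) * vars r (r - l)) * fps_X ^ (r - l))"
      using assms by (simp add: sum.distrib if_distrib[of "\<lambda>x. x * _"] cong: if_cong)
    also have "(\<Sum>l<r. fps_const ((- 1) ^ (r - l) * vars r (r - l)) * fps_X ^ (r - l)) =
        (\<Sum>i\<in>{1..r}. fps_const ((- 1) ^ i * vars r i) * (fps_X ^ i :: br fps))"
      by (rule sum.reindex_bij_witness[of _ "\<lambda>i. r - i" "\<lambda>l. r - l"]) auto
    also have "1 + \<dots> = (\<Sum>i\<in>{0..r}. fps_const ((- 1) ^ i * vars r i) * (fps_X ^ i :: br fps))"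
      by (simp add: sum.atLeast_Suc_atMost)
    also have "\<dots> = alt_gf r"
      by (rule fps_ext) (auto simp: fps_sum_nth fps_X_power_iff if_distrib[of "\<lambda>x. _ * x"] sum.delta cong: if_cong)
    finally show ?thesis .
  qed
  have "det (companion_pencil r) = det (companion_pencil r * U)" by (simp add: det_mult[OF C U] detU)
  also have "\<dots> = prod_list (diag_mat (companion_pencil r * U))"
    by (rule det_lower_triangular[OF _ CU]) (use top in \<open>auto simp: less_Suc_eq\<close>)
  also have "\<dots> = (\<Prod>k<r. (companion_pencil r * U) $$ (k, k))"
    using carrier_matD[OF C] by (simp add: diag_mat_def prod.list_conv_set_nth atLeast0LessThan)
  also have "\<dots> = alt_gf r"
  proof -
    have "{..<r} = insert (r - 1) {..<r - 1}" using assms by auto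
    thus ?thesis using top last by (simp add: prod.insert)
  qed
  finally show ?thesis .
qed

text \<open>
  In short, \<open>E\<^sub>r(z) D(f) = D((1 - z X) f)\<close>: multiplication by \<open>e\<^sub>i\<close> corresponds to the \<open>i\<close>-th
  elementary symmetric function of the \<open>r\<close> commuting multiplications by \<open>X\<close> in the separate factors.
\<close>

lemma alt_gf_h_det:
  assumes "r \<ge> 1"
  shows "alt_gf r * fps_const (h_det r f) =
    det (mat r r (\<lambda>(k, j). fps_const (h_row r k (f j)) + fps_X * fps_const (h_row r k (- X_times (f j)))))"
proof -
  define L where "L = mat r r (\<lambda>(k, j). fps_const (h_row r k (f j)))"
  have L: "L \<in> carrier_mat r r" by (simp add: L_def)
  have C: "companion_pencil r \<in> carrier_mat r r" by (simp add: companion_pencil_def)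
  have "comm_ring_hom (fps_const :: br \<Rightarrow> br fps)" by unfold_locales auto
  moreover have "L = map_mat fps_const (mat r r (\<lambda>(k, j). h_row r k (f j)))" by (auto simp: L_def)
  ultimately have "det L = fps_const (h_det r f)"
    by (simp add: comm_ring_hom.hom_det h_det_def)
  hence "alt_gf r * fps_const (h_det r f) = det (companion_pencil r * L)"
    using det_mult[OF C L] det_companion_pencil[OF assms] by simp
  also have "companion_pencil r * L = mat r r (\<lambda>(k, j). fps_const (h_row r k (f j)) + fps_X * fps_const (h_row r k (- X_times (f j))))"
  proof -
    have "(companion_pencil r * L) $$ (k, j) = fps_const (h_row r k (f j)) + fps_X * fps_const (h_row r k (- X_times (f j)))"
      if k: "k < r" and j: "j < r" for k j
    proof -
    have "(companion_pencil r * L) $$ (k, j) = (\<Sum>l<r. companion_pencil r $$ (k, l) * L $$ (l, j))"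
      using k j C L by (simp add: scalar_prod_def atLeast0LessThan)
    also have "\<dots> = fps_const (h_row r k (f j)) + fps_X * (\<Sum>l<r. (if Suc k < r then if l = Suc k then - 1 else 0
              else fps_const ((- 1) ^ (r - l) * vars r (r - l))) * fps_const (h_row r l (f j)))"
      using k j by (simp add: companion_pencil_def L_def distrib_right sum.distrib if_distrib[of "\<lambda>x. x * _"]
          sum_distrib_left mult.assoc cong: if_cong)
    also have "(\<Sum>l<r. (if Suc k < r then if l = Suc k then - 1 else 0
              else fps_const ((- 1) ^ (r - l) * vars r (r - l))) * fps_const (h_row r l (f j)))
        = fps_const (h_row r k (- X_times (f j)))"
    proof (cases "Suc k < r")
      case True
      have "(\<Sum>l<r. (if l = Suc k then - 1 else 0) * fps_const (h_row r l (f j))) =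
        (\<Sum>l<r. if l = Suc k then - fps_const (h_row r l (f j)) else 0)"
        by (intro sum.cong) auto
      thus ?thesis using True by (simp only: if_True) (simp add: h_row_uminus h_row_X_times)
    next
      case False
      hence kr: "Suc k = r" using k by simp
      have "(\<Sum>l<r. fps_const ((- 1) ^ (r - l) * vars r (r - l)) * fps_const (h_row r l (f j)))
        = fps_const (\<Sum>l<r. (- 1) ^ (r - l) * vars r (r - l) * h_row r l (f j))"
        by (rule fps_ext) (simp add: fps_sum_nth)
      also have "(\<Sum>l<r. (- 1) ^ (r - l) * vars r (r - l) * h_row r l (f j)) =
        (\<Sum>i\<in>{1..r}. (- 1) ^ i * vars r i * h_row r (r - i) (f j))"
        by (rule sum.reindex_bij_witness[of _ "\<lambda>i. r - i" "\<lambda>l. r - l"]) auto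
      also have "\<dots> = (\<Sum>i\<le>r. (- 1) ^ i * vars r i * h_row r (r - i) (f j)) - h_row r r (f j)"
        by (simp add: sum.atLeast_Suc_atMost flip: atLeast0AtMost)
      also have "\<dots> = h_row r k (- X_times (f j))"
        using h_row_rec[OF assms, of "f j"] kr by (simp add: h_row_uminus h_row_X_times)
      finally show ?thesis using False by simp
    qed
    finally show ?thesis .
    qed
    thus ?thesis using C L by (intro eq_matI) (simp_all del: index_mult_mat(1))
  qed
  finally show ?thesis .
qed

section \<open>The span of the determinants is closed under \<open>e\<^sub>i\<close>\<close>

definition V_set :: "nat \<Rightarrow> b0 poly set" where
  "V_set n = {p. \<forall>i. Polynomial.coeff p i \<in> B0_set n}"

text \<open>
  The \<open>B\<^sub>0(c)\<close>-span of the \<open>D(f)\<close> that have at least one argument in \<open>J\<close>. If \<open>J\<close> consists of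
  all polynomials over \<open>B\<^sub>0(c)\<close>, this is \<open>B\<^sub>r(c)\<close>; taking for \<open>J\<close> the multiples of \<open>X\<^sup>n(c)\<close> yields a set containing the ideal
  \<open>I\<^bsub>r,n\<^esub>(c)\<close>.
\<close>

inductive_set h_det_span :: "nat \<Rightarrow> nat \<Rightarrow> b0 poly set \<Rightarrow> br set" for n r J where
  zero: "0 \<in> h_det_span n r J"
| step: "\<lbrakk>\<And>j. j < r \<Longrightarrow> f j \<in> V_set n; i < r; f i \<in> J; a \<in> B0_set n; y \<in> h_det_span n r J\<rbrakk> \<Longrightarrow>
    cst a * h_det r f + y \<in> h_det_span n r J"

lemma h_det_span_add: "x \<in> h_det_span n r J \<Longrightarrow> y \<in> h_det_span n r J \<Longrightarrow> x + y \<in> h_det_span n r J"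
  by (induction rule: h_det_span.induct) (auto simp: add.assoc intro: h_det_span.step)

lemma h_det_span_cst: "x \<in> h_det_span n r J \<Longrightarrow> a \<in> B0_set n \<Longrightarrow> cst a * x \<in> h_det_span n r J"
  by (induction rule: h_det_span.induct)
    (auto simp: distrib_left mult.assoc[symmetric] cst_mult[symmetric]
      intro!: h_det_span.intros is_subringD(4)[OF B0_set_subring])

lemma h_det_span_h_det: "(\<And>j. j < r \<Longrightarrow> f j \<in> V_set n) \<Longrightarrow> i < r \<Longrightarrow> f i \<in> J \<Longrightarrow> h_det r f \<in> h_det_span n r J"
  using h_det_span.step[of r f n i J 1, OF _ _ _ _ h_det_span.zero] is_subringD(2)[OF B0_set_subring] by simp

lemma h_det_span_sign: "x \<in> h_det_span n r J \<Longrightarrow> (- 1) ^ i * x \<in> h_det_span n r J"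
  using h_det_span_cst[of x n r J "(- 1) ^ i"] is_subring_power[OF B0_set_subring is_subringD(5)[OF B0_set_subring is_subringD(2)[OF B0_set_subring]]]
  by (simp add: cst_power cst_uminus)

lemma V_set_X_times: "f \<in> V_set n \<Longrightarrow> - X_times f \<in> V_set n"
  using is_subringD[OF B0_set_subring] by (auto simp: V_set_def coeff_pCons split: nat.splits)

text \<open>
  Compare coefficients in \<open>E\<^sub>r(z) D(f) = D((1 - z X) f)\<close>: each coefficient on the right is a sum of
  \<open>D(g)\<close> with \<open>g\<^sub>j \<in> {f\<^sub>j, - X f\<^sub>j}\<close>, and these keep an argument in \<open>J\<close>.
\<close>

lemma h_det_span_vars:
  assumes "r \<ge> 1" "\<And>f. f \<in> J \<Longrightarrow> - X_times f \<in> J" "x \<in> h_det_span n r J"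
  shows "vars r i * x \<in> h_det_span n r J"
  using assms(3)
proof (induction rule: h_det_span.induct)
  case zero
  show ?case by (simp add: h_det_span.zero)
next
  case (step f l a y)
  have "fps_nth (alt_gf r * fps_const (h_det r f)) i \<in> h_det_span n r J"
    unfolding alt_gf_h_det[OF assms(1)]
  proof (rule det_expand_columns[where v = "h_row r"])
    fix g assume g: "\<And>j. j < r \<Longrightarrow> g j = f j \<or> g j = - X_times (f j)"
    have "h_det r g \<in> h_det_span n r J"
    proof (rule h_det_span_h_det)
      show "g j \<in> V_set n" if "j < r" for j using g[OF that] step(1)[OF that] V_set_X_times by auto
      show "g l \<in> J" using g[OF step(2)] step(3) assms(2) by auto
    qed (rule step)
    thus "det (mat r r (\<lambda>(i, j). h_row r i (g j))) \<in> h_det_span n r J" by (simp add: h_det_def)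
  qed (auto intro: h_det_span_add h_det_span.zero)
  hence "(- 1) ^ i * ((- 1) ^ i * vars r i * h_det r f) \<in> h_det_span n r J"
    by (intro h_det_span_sign) simp
  hence "vars r i * h_det r f \<in> h_det_span n r J" by (simp add: mult.assoc[symmetric] flip: power_add)
  hence "cst a * (vars r i * h_det r f) + vars r i * y \<in> h_det_span n r J"
    using step by (intro h_det_span_add h_det_span_cst)
  thus ?case by (simp add: algebra_simps)
qed

lemma single_sum_prod:
  "finite A \<Longrightarrow> Poly_Mapping.single (\<Sum>i\<in>A. f i) (1::'a::comm_ring_1) = (\<Prod>i\<in>A. Poly_Mapping.single (f i) 1)"
  for f :: "nat \<Rightarrow> (nat \<Rightarrow>\<^sub>0 nat)"
  by (induction A rule: finite_induct) (auto simp: mult_single[symmetric, where a = "1::'a" and b = 1, simplified])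

lemma single_power:
  "Poly_Mapping.single (Poly_Mapping.single i k) (1::'a::comm_ring_1) = Poly_Mapping.single (Poly_Mapping.single i 1) 1 ^ k"
  for i :: nat and k :: nat
proof (induction k)
  case (Suc k)
  have "Poly_Mapping.single i (Suc k) = Poly_Mapping.single i 1 + Poly_Mapping.single i k"
    by (simp flip: single_add)
  thus ?case using Suc by (simp add: mult_single[symmetric, where a = "1::'a" and b = 1, simplified])
qed simp

lemma single_eq_prod_vars:
  fixes a :: "'a::comm_ring_1"
  assumes "Poly_Mapping.keys m \<subseteq> {1..N}"
  shows "Poly_Mapping.single m a = cst a * (\<Prod>i\<in>Poly_Mapping.keys m. vars N i ^ Poly_Mapping.lookup m i)"
proof -
  have m: "m = (\<Sum>i\<in>Poly_Mapping.keys m. Poly_Mapping.single i (Poly_Mapping.lookup m i))"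
    by (rule poly_mapping_eqI) (auto simp: lookup_sum lookup_single when_def sum.delta' in_keys_iff)
  have "Poly_Mapping.single m a = cst a * Poly_Mapping.single m 1"
    by (simp add: cst_def mult_single)
  also have "Poly_Mapping.single m 1 = (\<Prod>i\<in>Poly_Mapping.keys m. Poly_Mapping.single (Poly_Mapping.single i (Poly_Mapping.lookup m i)) (1::'a))"
    by (subst m) (simp add: single_sum_prod)
  also have "\<dots> = (\<Prod>i\<in>Poly_Mapping.keys m. vars N i ^ Poly_Mapping.lookup m i)"
  proof (intro prod.cong refl)
    fix i assume "i \<in> Poly_Mapping.keys m"
    hence "i \<in> {1..N}" using assms by auto
    hence "(vars N i :: 'a mpol) = Poly_Mapping.single (Poly_Mapping.single i 1) 1" by (simp add: vars_def)
    thus "Poly_Mapping.single (Poly_Mapping.single i (Poly_Mapping.lookup m i)) (1::'a) = vars N i ^ Poly_Mapping.lookup m i"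
      by (simp only: single_power[of i "Poly_Mapping.lookup m i"])
  qed
  finally show ?thesis .
qed

lemma h_det_span_mult:
  assumes "r \<ge> 1" "\<And>f. f \<in> J \<Longrightarrow> - X_times f \<in> J" "x \<in> h_det_span n r J" "b \<in> Br_set n r"
  shows "b * x \<in> h_det_span n r J"
proof -
  have pow: "vars r i ^ k * x \<in> h_det_span n r J" if "x \<in> h_det_span n r J" for i k x
    using that by (induction k) (auto simp: mult.assoc intro: h_det_span_vars[OF assms(1,2)])
  have prd: "(\<Prod>i\<in>A. vars r i ^ k i) * x \<in> h_det_span n r J" if "finite A" for A k
    using that by (induction A) (auto simp: mult.assoc assms(3) intro: pow)
  have "(\<Sum>m\<in>A. Poly_Mapping.single m (Poly_Mapping.lookup b m) * x) \<in> h_det_span n r J"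
    if "finite A" "A \<subseteq> Poly_Mapping.keys b" for A
    using that
  proof (induction A rule: finite_induct)
    case empty
    show ?case by (simp add: h_det_span.zero)
  next
    case (insert m A)
    have "Poly_Mapping.keys m \<subseteq> {1..r}" "Poly_Mapping.lookup b m \<in> B0_set n"
      using insert.prems assms(4) by (auto simp: mpols_def)
    hence "Poly_Mapping.single m (Poly_Mapping.lookup b m) * x \<in> h_det_span n r J"
      unfolding single_eq_prod_vars[of m r, OF \<open>Poly_Mapping.keys m \<subseteq> {1..r}\<close>] mult.assoc
      by (intro h_det_span_cst prd) auto
    thus ?case using insert by (simp add: h_det_span_add)
  qed
  from this[of "Poly_Mapping.keys b"] show ?thesis
    using mpol_sum_singles[of b] by (simp flip: sum_distrib_right)
qed

lemma hc_0: "hc n r 0 = 1"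
  by (simp add: hc_def cE_def)

lemma hc_neg: "j < 0 \<Longrightarrow> hc n r j = 0" by (simp add: hc_def)

text \<open>
  The matrix is lower triangular with diagonal \<open>h\<^sub>j, 1, \<dots>, 1\<close>. This puts both \<open>1 = h\<^sub>0\<close> and the
  generators of \<open>I\<^bsub>r,n\<^esub>(c)\<close> into the span of the \<open>D(f)\<close>.
\<close>

lemma hc_as_h_det:
  assumes "r \<ge> 1"
  shows "hc n r (int j) = h_det r (\<lambda>i. Xc n (if i = 0 then r - 1 + j else r - 1 - i))"
proof -
  let ?M = "mat r r (\<lambda>(k, i). h_row r k (Xc n (if i = 0 then r - 1 + j else r - 1 - i)))"
  have ent: "?M $$ (k, i) = (if i = 0 then hc n r (int j + int k) else hc n r (int k - int i))"
    if "k < r" "i < r" for k i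
    using that by (auto simp: h_row_Xc of_nat_diff algebra_simps intro!: arg_cong[of _ _ "hc n r"])
  have "det ?M = prod_list (diag_mat ?M)"
    by (rule det_lower_triangular[where n = r]) (auto simp: ent hc_neg simp del: index_mat)
  also have "\<dots> = (\<Prod>k<r. ?M $$ (k, k))"
    by (simp add: diag_mat_def prod.list_conv_set_nth atLeast0LessThan)
  also have "\<dots> = (\<Prod>k<r. if k = 0 then hc n r (int j) else 1)"
    by (intro prod.cong refl) (auto simp: ent hc_0 simp del: index_mat)
  also have "\<dots> = hc n r (int j)" using assms by (simp add: prod.delta)
  finally show ?thesis by (simp add: h_det_def)
qed

section \<open>Pluecker coordinates\<close>

text \<open>
  Linear independence of the Schur determinants is proved by adjoining the roots of \<open>E\<^sub>r\<close>: the \<open>e\<^sub>i\<close>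
  are replaced by the elementary symmetric polynomials in new variables \<open>x\<^sub>1, \<dots>, x\<^sub>r\<close>. These live
  in the same type as \<open>B\<^sub>r(c)\<close>; the index \<open>i\<close> counts from \<open>0\<close> and stands for \<open>x\<^bsub>i+1\<^esub>\<close>.
\<close>

definition root_factor :: "nat \<Rightarrow> br fps" where
  "root_factor i = 1 - fps_const (vars (Suc i) (Suc i)) * fps_X"

lemma root_factor_prod_degree:
  assumes "finite A" "p > card A"
  shows "fps_nth (\<Prod>i\<in>A. root_factor i) p = 0"
  using assms
proof (induction A arbitrary: p rule: finite_induct)
  case (insert x A)
  obtain q where p: "p = Suc q" using insert.prems by (cases p) auto
  have "fps_nth (\<Prod>i\<in>insert x A. root_factor i) p =
      fps_nth (\<Prod>i\<in>A. root_factor i) p - vars (Suc x) (Suc x) * fps_nth (\<Prod>i\<in>A. root_factor i) q"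
    using insert.hyps by (simp add: root_factor_def left_diff_distrib mult.assoc p)
  thus ?case using insert by (simp add: p)
qed simp

lemma root_factor_prod_0: "fps_nth (\<Prod>i\<in>A. root_factor i) 0 = 1"
  by (induction A rule: infinite_finite_induct) (auto simp: root_factor_def)

definition root_var :: "nat \<Rightarrow> br" where "root_var i = vars (Suc i) (Suc i)"

lemma root_factor_geometric: "root_factor i * Abs_fps (\<lambda>m. root_var i ^ m) = 1"
  by (rule fps_ext) (auto simp: root_factor_def root_var_def left_diff_distrib mult.assoc gr0_conv_Suc split: nat.splits
      simp flip: neq0_conv)

definition elem_eval :: "nat \<Rightarrow> br \<Rightarrow> br" where
  "elem_eval r = cst.msubst (\<lambda>i. (- 1) ^ i * fps_nth (\<Prod>l<r. root_factor l) i)"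

lemma elem_eval_hom: "comm_ring_hom (elem_eval r)"
  unfolding elem_eval_def by (rule cst.msubst_hom)

lemma elem_eval_cst [simp]: "elem_eval r (cst a) = cst a"
  unfolding elem_eval_def by (rule cst.msubst_cst)

lemma elem_eval_alt: "elem_eval r ((- 1) ^ i * vars r i) = fps_nth (\<Prod>l<r. root_factor l) i"
proof -
  interpret h: comm_ring_hom "elem_eval r" by (rule elem_eval_hom)
  have "elem_eval r (vars r i) = (- 1) ^ i * fps_nth (\<Prod>l<r. root_factor l) i"
    by (auto simp: elem_eval_def cst.msubst_vars root_factor_prod_0 root_factor_prod_degree)
  thus ?thesis by (simp add: h.hom_mult h.hom_power h.hom_uminus mult.assoc[symmetric] flip: power_add)
qed

definition elem_eval_fps :: "nat \<Rightarrow> br fps \<Rightarrow> br fps" where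
  "elem_eval_fps r F = Abs_fps (\<lambda>i. elem_eval r (fps_nth F i))"

lemma elem_eval_fps_mult: "elem_eval_fps r (F * G) = elem_eval_fps r F * elem_eval_fps r G"
proof -
  interpret h: comm_ring_hom "elem_eval r" by (rule elem_eval_hom)
  show ?thesis by (rule fps_ext) (simp add: elem_eval_fps_def fps_mult_nth h.hom_sum h.hom_mult)
qed

lemma root_factor_prod_elem_eval_fps_inv: "(\<Prod>l<r. root_factor l) * elem_eval_fps r (inv_gf r) = 1"
proof -
  interpret h: comm_ring_hom "elem_eval r" by (rule elem_eval_hom)
  have "elem_eval_fps r (alt_gf r) = (\<Prod>l<r. root_factor l)"
    by (rule fps_ext) (simp add: elem_eval_fps_def elem_eval_alt)
  moreover have "elem_eval_fps r (alt_gf r * inv_gf r) = 1"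
    by (rule fps_ext) (simp add: elem_eval_fps_def alt_inv_gf)
  ultimately show ?thesis by (simp add: elem_eval_fps_mult)
qed

definition omit_coeff :: "nat \<Rightarrow> nat \<Rightarrow> nat \<Rightarrow> br" where
  "omit_coeff r i k = fps_nth (\<Prod>l\<in>{..<r} - {i}. root_factor l) (r - 1 - k)"

text \<open>
  After the substitution \<open>E\<^sub>r(z)\<close> is \<open>\<Prod>\<^sub>l (1 - x\<^sub>l z)\<close>; read off coefficients in
  \<open>1 / (1 - x\<^sub>i z) = (\<Prod>\<^bsub>l\<noteq>i\<^esub> (1 - x\<^sub>l z)) \<cdot> 1 / E\<^sub>r(z)\<close>. The point is that the
  coefficients of the product depend on \<open>i\<close> and \<open>k\<close> but not on \<open>m\<close>.
\<close>

lemma root_var_power: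
  assumes "i < r"
  shows "root_var i ^ m = (\<Sum>k<r. omit_coeff r i k * elem_eval r (complete_h r (int m - int r + 1 + int k)))"
proof -
  interpret h: comm_ring_hom "elem_eval r" by (rule elem_eval_hom)
  let ?P = "\<Prod>l\<in>{..<r} - {i}. root_factor l"
  let ?Q = "elem_eval_fps r (inv_gf r)"
  let ?X = "Abs_fps (\<lambda>m. root_var i ^ m)"
  have "root_factor i * (?P * ?Q) = 1"
    using root_factor_prod_elem_eval_fps_inv[of r] assms by (simp add: prod.remove[of _ i] mult.assoc)
  hence "?X = (root_factor i * (?P * ?Q)) * ?X" by simp
  also have "\<dots> = (root_factor i * ?X) * (?P * ?Q)" by (simp only: mult_ac)
  also have "\<dots> = ?P * ?Q" by (simp add: root_factor_geometric)
  finally have "icoef (?P * ?Q) (int m) = root_var i ^ m" by (metis fps_nth_Abs_fps icoef_of_nat)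
  also have "icoef (?P * ?Q) (int m) = (\<Sum>p\<le>r - 1. fps_nth ?P p * icoef ?Q (int m - int p))"
  proof (rule icoef_mult[symmetric])
    fix p assume "p > r - 1"
    moreover have "card ({..<r} - {i}) = r - 1" using assms by simp
    ultimately show "fps_nth ?P p = 0 \<or> int p > int m"
      using root_factor_prod_degree[of "{..<r} - {i}" p] by simp
  qed
  also have "\<dots> = (\<Sum>k<r. omit_coeff r i k * icoef ?Q (int m - int r + 1 + int k))"
    by (rule sum.reindex_bij_witness[of _ "\<lambda>k. r - 1 - k" "\<lambda>p. r - 1 - p"])
      (use assms in \<open>auto simp: omit_coeff_def of_nat_diff algebra_simps\<close>)
  also have "icoef ?Q = (\<lambda>j. elem_eval r (complete_h r j))"
    by (rule ext) (simp add: icoef_def elem_eval_fps_def)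
  finally show ?thesis ..
qed

definition root_eval :: "nat \<Rightarrow> b0 poly \<Rightarrow> br" where
  "root_eval i = poly_fun cst (\<lambda>m. root_var i ^ m)"

lemma root_eval_eq:
  assumes "i < r"
  shows "root_eval i f = (\<Sum>k<r. omit_coeff r i k * elem_eval r (h_row r k f))"
proof -
  interpret h: comm_ring_hom "elem_eval r" by (rule elem_eval_hom)
  have "elem_eval r (h_row r k f) = poly_fun cst (\<lambda>m. elem_eval r (complete_h r (int m - int r + 1 + int k))) f" for k
    unfolding h_row_def poly_fun_def by (simp add: h.hom_sum h.hom_mult)
  thus ?thesis unfolding root_eval_def root_var_power[OF assms] by (simp only: cst.poly_fun_lincomb)
qed

text \<open>
  The determinant is, up to sign, the Vandermonde determinant of the \<open>x\<^sub>i\<close>, and the factor turns symmetric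
  polynomials into antisymmetric ones.
\<close>

definition antisym_lift :: "nat \<Rightarrow> br \<Rightarrow> br" where
  "antisym_lift r b = det (mat r r (\<lambda>(i, k). omit_coeff r i k)) * elem_eval r b"

text \<open>
  By \<open>root_eval_eq\<close> the matrix of all \<open>f\<^sub>j(x\<^sub>i)\<close> is the product of the matrix of \<open>omit_coeff\<close> and the
  matrix behind \<open>D(f)\<close> with the \<open>e\<^sub>i\<close> substituted.
\<close>

lemma antisym_lift_h_det: "antisym_lift r (h_det r f) = det (mat r r (\<lambda>(i, j). root_eval i (f j)))"
proof -
  interpret h: comm_ring_hom "elem_eval r" by (rule elem_eval_hom)
  let ?G = "mat r r (\<lambda>(i, k). omit_coeff r i k)"
  let ?L = "mat r r (\<lambda>(k, j). h_row r k (f j))"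
  have "antisym_lift r (h_det r f) = det ?G * det (map_mat (elem_eval r) ?L)"
    unfolding antisym_lift_def h_det_def h.hom_det ..
  also have "\<dots> = det (?G * map_mat (elem_eval r) ?L)"
    by (rule det_mult[symmetric, of _ r]) auto
  also have "?G * map_mat (elem_eval r) ?L = mat r r (\<lambda>(i, j). root_eval i (f j))"
    by (rule eq_matI) (auto simp: scalar_prod_def root_eval_eq[of _ r] atLeast0LessThan)
  finally show ?thesis .
qed

text \<open>
  The tensor product of the dual basis functionals in the separate variables: the coefficient of
  \<open>X\<^bsup>a\<^sub>0\<^esup>(c)(x\<^sub>1) \<cdots> X\<^bsup>a\<^bsub>r-1\<^esub>\<^esup>(c)(x\<^sub>r)\<close>.
\<close>

definition coord :: "nat \<Rightarrow> nat \<Rightarrow> (nat \<Rightarrow> nat) \<Rightarrow> br \<Rightarrow> b0" where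
  "coord n r a = mpol_fun (\<lambda>x. x) (\<lambda>m. \<Prod>i<r. s_coeff n (int (Poly_Mapping.lookup m (Suc i)) - int (a i)))"

text \<open>
  The functional dual to \<open>X\<^sup>a(c)\<close>: as \<open>\<Sum>\<^sub>j X\<^sup>j z\<^sup>j = (1 / c(z)) \<Sum>\<^sub>m X\<^sup>m(c) z\<^sup>m\<close>, the coefficient of
  \<open>X\<^sup>a(c)\<close> in \<open>X\<^sup>m\<close> is \<open>s\<^bsub>m-a\<^esub>\<close>.
\<close>

definition dual_fun :: "nat \<Rightarrow> nat \<Rightarrow> b0 poly \<Rightarrow> b0" where
  "dual_fun n a = poly_fun (\<lambda>x. x) (\<lambda>m. s_coeff n (int m - int a))"

lemma coord_add: "coord n r a (p + q) = coord n r a p + coord n r a q"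
  unfolding coord_def by (rule coeff_hom.mpol_fun_add[OF coeff_hom_id])
lemma coord_sum: "coord n r a (\<Sum>i\<in>A. p i) = (\<Sum>i\<in>A. coord n r a (p i))"
  unfolding coord_def by (rule coeff_hom.mpol_fun_sum[OF coeff_hom_id])
lemma coord_cst: "coord n r a (cst c * p) = c * coord n r a p"
  unfolding coord_def by (rule coeff_hom.mpol_fun_cst_mult[OF coeff_hom_id])

lemma coord_prod_root_eval: "coord n r a (\<Prod>i<r. root_eval i (g i)) = (\<Prod>i<r. dual_fun n (a i) (g i))"
proof -
  let ?A = "Pi\<^sub>E {..<r} (\<lambda>i. {..Polynomial.degree (g i)})"
  let ?c = "\<lambda>i m. Polynomial.coeff (g i) m"
  have monom: "coord n r a (\<Prod>i<r. cst (?c i (\<mu> i)) * root_var i ^ \<mu> i) = (\<Prod>i<r. ?c i (\<mu> i) * s_coeff n (int (\<mu> i) - int (a i)))" for \<mu>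
  proof -
    let ?m = "\<Sum>i<r. Poly_Mapping.single (Suc i) (\<mu> i)"
    have "(\<Prod>i<r. cst (?c i (\<mu> i)) * root_var i ^ \<mu> i) = (\<Prod>i<r. cst (?c i (\<mu> i))) * (\<Prod>i<r. root_var i ^ \<mu> i)"
      by (rule prod.distrib)
    also have "(\<Prod>i<r. cst (?c i (\<mu> i))) = (cst (\<Prod>i<r. ?c i (\<mu> i)) :: br)"
      by (induction r) (auto simp: cst_mult)
    also have "(\<Prod>i<r. root_var i ^ \<mu> i) = (\<Prod>i<r. Poly_Mapping.single (Poly_Mapping.single (Suc i) (\<mu> i)) 1)"
    proof (intro prod.cong refl)
      fix i
      show "root_var i ^ \<mu> i = Poly_Mapping.single (Poly_Mapping.single (Suc i) (\<mu> i)) 1"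
        unfolding single_power[of "Suc i" "\<mu> i"] by (simp add: root_var_def vars_def)
    qed
    also have "\<dots> = Poly_Mapping.single ?m 1"
      by (rule single_sum_prod[symmetric]) simp
    finally have "coord n r a (\<Prod>i<r. cst (?c i (\<mu> i)) * root_var i ^ \<mu> i) =
        (\<Prod>i<r. ?c i (\<mu> i)) * coord n r a (Poly_Mapping.single ?m 1)" by (simp add: coord_cst)
    also have "coord n r a (Poly_Mapping.single ?m 1) = (\<Prod>i<r. s_coeff n (int (Poly_Mapping.lookup ?m (Suc i)) - int (a i)))"
      unfolding coord_def coeff_hom.mpol_fun_single[OF coeff_hom_id] by simp
    also have "\<dots> = (\<Prod>i<r. s_coeff n (int (\<mu> i) - int (a i)))"
      by (intro prod.cong refl) (simp add: lookup_sum lookup_single when_def)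
    finally show ?thesis by (simp only: prod.distrib)
  qed
  have "(\<Prod>i<r. root_eval i (g i)) = (\<Sum>\<mu>\<in>?A. \<Prod>i<r. cst (?c i (\<mu> i)) * root_var i ^ \<mu> i)"
    unfolding root_eval_def poly_fun_def by (rule prod_sum_PiE) auto
  hence "coord n r a (\<Prod>i<r. root_eval i (g i)) = (\<Sum>\<mu>\<in>?A. \<Prod>i<r. ?c i (\<mu> i) * s_coeff n (int (\<mu> i) - int (a i)))"
    by (simp only: coord_sum monom)
  also have "\<dots> = (\<Prod>i<r. dual_fun n (a i) (g i))"
    unfolding dual_fun_def poly_fun_def by (rule prod_sum_PiE[symmetric]) auto
  finally show ?thesis .
qed

text \<open>
  With \<open>B\<^sub>r(c)\<close> spanned by the \<open>D(f)\<close>, this is the coordinate of \<open>b\<close> at \<open>X\<^bsup>a\<^sub>0\<^esup>(c) \<and> \<dots> \<and> X\<^bsup>a\<^bsub>r-1\<^esub>\<^esup>(c)\<close>.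
\<close>

definition pluecker :: "nat \<Rightarrow> nat \<Rightarrow> (nat \<Rightarrow> nat) \<Rightarrow> br \<Rightarrow> b0" where
  "pluecker n r a b = coord n r a (antisym_lift r b)"

lemma pluecker_add: "pluecker n r a (x + y) = pluecker n r a x + pluecker n r a y"
proof -
  interpret h: comm_ring_hom "elem_eval r" by (rule elem_eval_hom)
  show ?thesis by (simp add: pluecker_def antisym_lift_def h.hom_add distrib_left coord_add)
qed

lemma pluecker_0 [simp]: "pluecker n r a 0 = 0"
  using pluecker_add[of n r a 0 0] by simp

lemma pluecker_cst: "pluecker n r a (cst c * x) = c * pluecker n r a x"
proof -
  interpret h: comm_ring_hom "elem_eval r" by (rule elem_eval_hom)
  have "antisym_lift r (cst c * x) = cst c * antisym_lift r x"
    by (simp add: antisym_lift_def h.hom_mult mult.left_commute)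
  thus ?thesis by (simp add: pluecker_def coord_cst)
qed

text \<open>
  The right-hand side is the coordinate of \<open>f\<^sub>0 \<and> \<dots> \<and> f\<^bsub>r-1\<^esub>\<close>. That it is the value at \<open>D(f)\<close> of one
  linear map, the same for all \<open>f\<close>, is what makes the Schur determinants linearly independent.
\<close>

lemma pluecker_h_det: "pluecker n r a (h_det r f) = det (mat r r (\<lambda>(i, j). dual_fun n (a i) (f j)))"
proof -
  have sgn: "(of_int (sign p) :: br) = cst (of_int (sign p))" for p :: "nat \<Rightarrow> nat"
    by (cases p rule: sign_cases) (auto simp: cst_uminus)
  have "pluecker n r a (h_det r f) = coord n r a (\<Sum>p | p permutes {0..<r}.
      of_int (sign p) * (\<Prod>i = 0..<r. mat r r (\<lambda>(i, j). root_eval i (f j)) $$ (i, p i)))"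
    unfolding pluecker_def antisym_lift_h_det by (subst det_def'[of _ r]) auto
  also have "\<dots> = (\<Sum>p | p permutes {0..<r}. of_int (sign p) * coord n r a (\<Prod>i<r. root_eval i (f (p i))))"
    unfolding coord_sum sgn coord_cst
  proof (intro sum.cong refl arg_cong2[of _ _ _ _ "(*)"] arg_cong[of _ _ "coord n r a"])
    fix p assume "p \<in> {p. p permutes {0..<r}}"
    hence "p i < r" if "i < r" for i using permutes_in_image[of p "{0..<r}" i] that by auto
    thus "(\<Prod>i = 0..<r. mat r r (\<lambda>(i, j). root_eval i (f j)) $$ (i, p i)) = (\<Prod>i<r. root_eval i (f (p i)))"
      by (intro prod.cong) auto
  qed
  also have "\<dots> = (\<Sum>p | p permutes {0..<r}. of_int (sign p) * (\<Prod>i = 0..<r. mat r r (\<lambda>(i, j). dual_fun n (a i) (f j)) $$ (i, p i)))"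
  proof (intro sum.cong refl arg_cong2[of _ _ _ _ "(*)"])
    fix p assume "p \<in> {p. p permutes {0..<r}}"
    hence "p i < r" if "i < r" for i using permutes_in_image[of p "{0..<r}" i] that by auto
    thus "coord n r a (\<Prod>i<r. root_eval i (f (p i))) = (\<Prod>i = 0..<r. mat r r (\<lambda>(i, j). dual_fun n (a i) (f j)) $$ (i, p i))"
      unfolding coord_prod_root_eval by (intro prod.cong) auto
  qed
  also have "\<dots> = det (mat r r (\<lambda>(i, j). dual_fun n (a i) (f j)))"
    by (rule det_def'[symmetric]) simp
  finally show ?thesis .
qed

section \<open>The ideal of \<open>X\<^sup>n(c)\<close> and the dual basis\<close>

lemma (in coeff_hom) poly_fun_mult:
  "poly_fun \<phi> u (h * q) = (\<Sum>t\<le>Polynomial.degree q. \<phi> (Polynomial.coeff q t) * poly_fun \<phi> u (Polynomial.monom 1 t * h))"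
proof -
  have "h * q = (\<Sum>t\<le>Polynomial.degree q. Polynomial.smult (Polynomial.coeff q t) (Polynomial.monom 1 t * h))"
  proof -
    have "h * q = h * (\<Sum>t\<le>Polynomial.degree q. Polynomial.monom (Polynomial.coeff q t) t)"
      by (simp only: poly_as_sum_of_monoms)
    also have "\<dots> = (\<Sum>t\<le>Polynomial.degree q. h * Polynomial.monom (Polynomial.coeff q t) t)"
      by (rule sum_distrib_left)
    also have "\<dots> = (\<Sum>t\<le>Polynomial.degree q. Polynomial.smult (Polynomial.coeff q t) (Polynomial.monom 1 t * h))"
      by (intro sum.cong refl) (simp only: mult.commute[of h] mult_smult_left[symmetric] smult_monom mult_1_right)
    finally show ?thesis .
  qed
  thus ?thesis by (simp only: poly_fun_sum poly_fun_smult)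
qed

definition Xn_mult :: "nat \<Rightarrow> b0 poly set" where "Xn_mult n = {Xc n n * q | q. q \<in> V_set n}"

lemma dual_fun_add: "dual_fun n a (f + g) = dual_fun n a f + dual_fun n a g"
  unfolding dual_fun_def by (rule coeff_hom.poly_fun_add[OF coeff_hom_id])

lemma dual_fun_smult: "dual_fun n a (Polynomial.smult c f) = c * dual_fun n a f"
  unfolding dual_fun_def by (rule coeff_hom.poly_fun_smult[OF coeff_hom_id])

lemma dual_fun_Xc: "dual_fun n a (Xc n m) = (if m = a then 1 else 0)"
proof -
  have "dual_fun n a (Xc n m) = dual_fun n a (Polynomial.monom 1 0 * Xc n m)" by simp
  also have "\<dots> = (\<Sum>i\<le>m. (- 1) ^ i * cc n i * s_coeff n (int (0 + m - i) - int a))"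
    unfolding dual_fun_def by (rule poly_fun_Xc_shift[OF coeff_hom_id])
  also have "\<dots> = (\<Sum>i\<le>m. (- 1) ^ i * cc n i * s_coeff n ((int m - int a) - int i))"
    by (intro sum.cong refl arg_cong2[of _ _ _ _ "(*)"] arg_cong[of _ _ "s_coeff n"]) auto
  also have "\<dots> = (if int m - int a = 0 then 1 else 0)"
    by (rule s_coeff_conv) auto
  finally show ?thesis by simp
qed

text \<open>
  For \<open>a < n\<close> the product \<open>X\<^sup>n(c) X\<^sup>t = \<Sum>\<^sub>i (-1)\<^sup>i c\<^sub>i X\<^bsup>n+t-i\<^esup>\<close> is sent to the coefficient of
  \<open>c(z) \<cdot> 1 / c(z)\<close> at the positive index \<open>n + t - a\<close>.
\<close>

lemma dual_fun_Xn_mult: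
  assumes "a < n" "f \<in> Xn_mult n"
  shows "dual_fun n a f = 0"
proof -
  obtain q where q: "f = Xc n n * q" using assms by (auto simp: Xn_mult_def)
  have "dual_fun n a (Polynomial.monom 1 t * Xc n n) = 0" for t
  proof -
    have "dual_fun n a (Polynomial.monom 1 t * Xc n n) = (\<Sum>i\<le>n. (- 1) ^ i * cc n i * s_coeff n (int (t + n - i) - int a))"
      unfolding dual_fun_def by (rule poly_fun_Xc_shift[OF coeff_hom_id])
    also have "\<dots> = (\<Sum>i\<le>n. (- 1) ^ i * cc n i * s_coeff n ((int t + int n - int a) - int i))"
      by (intro sum.cong refl arg_cong2[of _ _ _ _ "(*)"] arg_cong[of _ _ "s_coeff n"]) auto
    also have "\<dots> = (if int t + int n - int a = 0 then 1 else 0)"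
      by (rule s_coeff_conv) auto
    finally show ?thesis using assms(1) by simp
  qed
  moreover have "dual_fun n a f = (\<Sum>t\<le>Polynomial.degree q. Polynomial.coeff q t * dual_fun n a (Polynomial.monom 1 t * Xc n n))"
    unfolding q dual_fun_def by (rule coeff_hom.poly_fun_mult[OF coeff_hom_id])
  ultimately show ?thesis by (simp only: mult_zero_right sum.neutral_const)
qed

lemma V_set_subring: "is_subring (V_set n)"
proof -
  note K = is_subringD[OF B0_set_subring[of n]]
  have "p * q \<in> V_set n" if "p \<in> V_set n" "q \<in> V_set n" for p q
    using that by (auto simp: V_set_def coeff_mult intro!: is_subring_sum B0_set_subring K(4))
  thus ?thesis using K by (auto simp: is_subring_def V_set_def coeff_1)
qed

lemma Xc_V_set: "Xc n m \<in> V_set n"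
  unfolding Xc_def
  by (intro is_subring_sum V_set_subring)
    (use is_subringD(1)[OF B0_set_subring] in \<open>auto simp: V_set_def coeff_monom intro!: sign_mult_subring B0_set_subring cc_closed\<close>)

lemma X_times_Xn_mult: "f \<in> Xn_mult n \<Longrightarrow> - X_times f \<in> Xn_mult n"
proof -
  assume "f \<in> Xn_mult n"
  then obtain q where q: "f = Xc n n * q" "q \<in> V_set n" by (auto simp: Xn_mult_def)
  hence "- X_times f = Xc n n * (- X_times q)" by simp
  thus "- X_times f \<in> Xn_mult n" using V_set_X_times[OF q(2)] unfolding Xn_mult_def by blast
qed

lemma dual_fun_closed: "f \<in> V_set n \<Longrightarrow> dual_fun n a f \<in> B0_set n"
  unfolding dual_fun_def poly_fun_def
  by (intro is_subring_sum B0_set_subring is_subringD(4)[OF B0_set_subring] s_coeff_closed) (auto simp: V_set_def)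

lemma h_row_closed: "f \<in> V_set n \<Longrightarrow> h_row r k f \<in> Br_set n r"
  unfolding h_row_def poly_fun_def
  by (intro is_subring_sum Br_set_subring is_subringD(4)[OF Br_set_subring] complete_h_closed mpols_cst B0_set_subring)
    (auto simp: V_set_def)

lemma h_det_closed: "(\<And>j. j < r \<Longrightarrow> f j \<in> V_set n) \<Longrightarrow> h_det r f \<in> Br_set n r"
  unfolding h_det_def by (intro is_subring_det Br_set_subring h_row_closed)

lemma pluecker_h_det_span_closed: "x \<in> h_det_span n r J \<Longrightarrow> pluecker n r a x \<in> B0_set n"
proof (induction rule: h_det_span.induct)
  case (step f i c y)
  have "pluecker n r a (h_det r f) \<in> B0_set n"
    unfolding pluecker_h_det by (intro is_subring_det B0_set_subring dual_fun_closed step)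
  thus ?case using step is_subringD(3,4)[OF B0_set_subring] by (simp add: pluecker_add pluecker_cst)
qed (simp add: is_subringD(1)[OF B0_set_subring])

lemma det_zero_col:
  fixes f :: "nat \<Rightarrow> nat \<Rightarrow> 'a::comm_ring_1"
  assumes "j < r" "\<And>i. i < r \<Longrightarrow> f i j = 0"
  shows "det (mat r r (\<lambda>(i, j). f i j)) = 0"
proof -
  have "det (mat r r (\<lambda>(i, j). f i j)) = (\<Sum>i<r. mat r r (\<lambda>(i, j). f i j) $$ (i, j) * cofactor (mat r r (\<lambda>(i, j). f i j)) i j)"
    by (rule laplace_expansion_column) (use assms in auto)
  thus ?thesis using assms by simp
qed

text \<open>
  An argument divisible by \<open>X\<^sup>n(c)\<close> gives a zero column in \<open>pluecker_h_det\<close>. Hence the coordinates with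
  all \<open>a\<^sub>i < n\<close> are defined on \<open>B\<^bsub>r,n\<^esub>(c)\<close>.
\<close>

lemma pluecker_h_det_span_Xn_mult:
  assumes "x \<in> h_det_span n r (Xn_mult n)" "\<And>i. i < r \<Longrightarrow> a i < n"
  shows "pluecker n r a x = 0"
  using assms(1)
proof (induction rule: h_det_span.induct)
  case (step f i c y)
  have "pluecker n r a (h_det r f) = 0"
    unfolding pluecker_h_det by (rule det_zero_col[of i]) (use step assms(2) in \<open>auto intro: dual_fun_Xn_mult\<close>)
  thus ?case using step by (simp add: pluecker_add pluecker_cst)
qed simp

text \<open>
  The matrix has entries \<open>\<delta>(a\<^sub>i, b\<^sub>j)\<close>. If the decreasing sequences differ, the larger of the two
  values at the first difference does not occur in the other sequence, which makes a row or a column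
  vanish.
\<close>

lemma pluecker_h_det_Xc:
  assumes "strict_antimono_on {..<r} a" "strict_antimono_on {..<r} b"
  shows "pluecker n r a (h_det r (\<lambda>j. Xc n (b j))) = (if \<forall>i<r. a i = b i then 1 else 0)"
proof -
  let ?M = "mat r r (\<lambda>(i, j). dual_fun n (a i) (Xc n (b j)))"
  show ?thesis
  proof (cases "\<forall>i<r. a i = b i")
    case True
    have inj: "b i = b j \<longleftrightarrow> i = j" if "i < r" "j < r" for i j
      using assms(2) that by (auto simp: monotone_on_def) (metis lessThan_iff less_irrefl nat_neq_iff)
    have "?M = 1\<^sub>m r" by (rule eq_matI) (use True inj in \<open>auto simp: dual_fun_Xc\<close>)
    thus ?thesis using True by (simp add: pluecker_h_det)
  next
    case False
    \<comment> \<open>The first difference.\<close>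
    define i where "i = (LEAST i. i < r \<and> a i \<noteq> b i)"
    have ex: "\<exists>i. i < r \<and> a i \<noteq> b i" using False by blast
    have i: "i < r" "a i \<noteq> b i" using LeastI_ex[OF ex] by (simp_all add: i_def)
    have least: "a k = b k" if "k < i" for k
      using not_less_Least[of k "\<lambda>i. i < r \<and> a i \<noteq> b i"] that i(1) by (auto simp: i_def)
    have am: "a k < a l" "b k < b l" if "l < k" "k < r" for k l
      using assms that by (auto simp: monotone_on_def)
    have "det ?M = 0"
    proof (cases "a i < b i")
      case True
      have "a k \<noteq> b i" if "k < r" for k
      proof (cases "k < i")
        case True thus ?thesis using least[OF True] am(2)[OF True i(1)] by simp
      next
        case False
        hence "a k \<le> a i" using am(1)[of i k] that by (cases "k = i") auto
        thus ?thesis using \<open>a i < b i\<close> by simp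
      qed
      hence "dual_fun n (a k) (Xc n (b i)) = 0" if "k < r" for k using that by (simp add: dual_fun_Xc eq_commute)
      thus ?thesis by (intro det_zero_col[OF i(1)])
    next
      case False
      hence lt: "b i < a i" using i(2) by simp
      have ne: "b k \<noteq> a i" if "k < r" for k
      proof (cases "k < i")
        case True thus ?thesis using least[OF True] am(1)[OF True i(1)] by simp
      next
        case False
        hence "b k \<le> b i" using am(2)[of i k] that by (cases "k = i") auto
        thus ?thesis using lt by simp
      qed
      have "det ?M = det (transpose_mat ?M)" by (rule det_transpose[symmetric, of _ r]) simp
      also have "transpose_mat ?M = mat r r (\<lambda>(k, j). dual_fun n (a j) (Xc n (b k)))" by auto
      also have "det \<dots> = 0"
        by (rule det_zero_col[OF i(1)]) (use ne in \<open>simp add: dual_fun_Xc\<close>)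
      finally show ?thesis .
    qed
    thus ?thesis using False by (simp add: pluecker_h_det)
  qed
qed

section \<open>Quotient algebras\<close>

definition alg_on :: "('k \<Rightarrow> 'a::comm_ring_1) \<Rightarrow> 'a set \<Rightarrow> ('k, 'a) module" where
  "alg_on \<iota> S = \<lparr>carrier = S, mult = (*), one = 1, zero = 0, add = (+), smult = (\<lambda>k x. \<iota> k * x)\<rparr>"

lemma alg_on_sel [simp]:
  "carrier (alg_on \<iota> S) = S" "zero (alg_on \<iota> S) = 0"
  "add (alg_on \<iota> S) = (+)" "smult (alg_on \<iota> S) = (\<lambda>k x. \<iota> k * x)"
  by (simp_all add: alg_on_def)

lemma ring_on_sel [simp]:
  "carrier (ring_on S) = S" "zero (ring_on S) = 0" "one (ring_on S) = 1"
  "add (ring_on S) = (+)" "mult (ring_on S) = (*)"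
  by (simp_all add: ring_on_def)

lemma alg_on_module:
  assumes "coeff_hom \<iota>" "is_subring K" "is_subring S" "\<And>k. k \<in> K \<Longrightarrow> \<iota> k \<in> S"
  shows "module (ring_on K) (alg_on \<iota> S)"
proof (rule moduleI)
  interpret coeff_hom \<iota> by fact
  note S = is_subringD[OF assms(3)]
  show "cring (ring_on K)" by (rule cring_ring_on) fact
  show "abelian_group (alg_on \<iota> S)"
    by (rule abelian_groupI) (use S in \<open>auto simp: add_ac intro: bexI[of _ "- _"]\<close>)
qed (use is_subringD[OF assms(3)] assms(4) in \<open>auto simp: coeff_hom.add[OF assms(1)] coeff_hom.mult[OF assms(1)]
   coeff_hom.one[OF assms(1)] distrib_left distrib_right mult.assoc\<close>)

text \<open>
  The common situation of \<open>V\<^sub>n(c)\<close> and \<open>B\<^bsub>r,n\<^esub>(c)\<close>: an ideal generated inside a subring of a type.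
\<close>

locale subring_ideal =
  fixes S :: "'a::comm_ring_1 set" and G I :: "'a set"
  assumes S: "is_subring S" and GS: "G \<subseteq> S" and I_def: "I = Idl\<^bsub>ring_on S\<^esub> G"
begin

lemma cring: "cring (ring_on S)" by (rule cring_ring_on[OF S])

lemma ideal: "ideal I (ring_on S)"
proof -
  interpret R: cring "ring_on S" by (rule cring)
  show ?thesis unfolding I_def by (rule R.genideal_ideal) (use GS in simp)
qed

lemma I_subset: "I \<subseteq> S"
  and I_add: "x \<in> I \<Longrightarrow> y \<in> I \<Longrightarrow> x + y \<in> I"
  and I_0: "0 \<in> I"
  and I_mult: "s \<in> S \<Longrightarrow> x \<in> I \<Longrightarrow> s * x \<in> I"
proof -
  interpret ideal I "ring_on S" by (rule ideal)
  show "I \<subseteq> S" using a_subset by simp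
  show "x \<in> I \<Longrightarrow> y \<in> I \<Longrightarrow> x + y \<in> I" using subgroup.m_closed[OF a_subgroup, of x y] by simp
  show "0 \<in> I" using subgroup.one_closed[OF a_subgroup] by simp
  show "s \<in> S \<Longrightarrow> x \<in> I \<Longrightarrow> s * x \<in> I" using I_l_closed[of x s] by simp
qed

lemma I_uminus: "x \<in> I \<Longrightarrow> - x \<in> I"
  using I_mult[of "- 1" x] is_subringD[OF S] by simp

lemma I_diff: "x \<in> I \<Longrightarrow> y \<in> I \<Longrightarrow> x - y \<in> I"
  using I_add[of x "- y"] I_uminus[of y] by simp

lemma I_sum: "(\<And>i. i \<in> A \<Longrightarrow> f i \<in> I) \<Longrightarrow> sum f A \<in> I"
  by (induction A rule: infinite_finite_induct) (auto simp: I_0 I_add)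

lemma I_gen: "G \<subseteq> I"
proof -
  interpret R: cring "ring_on S" by (rule cring)
  show ?thesis unfolding I_def by (rule R.genideal_self) (use GS in simp)
qed

lemma I_least:
  assumes "J \<subseteq> S" "0 \<in> J" "\<And>x y. x \<in> J \<Longrightarrow> y \<in> J \<Longrightarrow> x + y \<in> J"
    "\<And>s x. s \<in> S \<Longrightarrow> x \<in> J \<Longrightarrow> s * x \<in> J" "G \<subseteq> J"
  shows "I \<subseteq> J"
proof -
  interpret R: cring "ring_on S" by (rule cring)
  have inv: "\<ominus>\<^bsub>ring_on S\<^esub> x = - x" if "x \<in> S" for x
    by (rule R.minus_equality) (use that is_subringD[OF S] in auto)
  have neg: "- x \<in> J" if "x \<in> J" for x
    using assms(4)[of "- 1" x] is_subringD[OF S] that by simp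
  have "ideal J (ring_on S)"
  proof (rule idealI)
    show "ring (ring_on S)" by (rule R.ring_axioms)
    show "subgroup J (add_monoid (ring_on S))"
    proof (rule group.subgroupI[OF R.a_group])
      show "inv\<^bsub>add_monoid (ring_on S)\<^esub> x \<in> J" if "x \<in> J" for x
        using inv[of x] neg[OF that] that assms(1) unfolding a_inv_def by auto
    qed (use assms in auto)
    fix a x assume a: "a \<in> J" and x: "x \<in> carrier (ring_on S)"
    show "x \<otimes>\<^bsub>ring_on S\<^esub> a \<in> J" using assms(4)[of x a] a x by simp
    show "a \<otimes>\<^bsub>ring_on S\<^esub> x \<in> J" using assms(4)[of x a] a x by (simp add: mult.commute)
  qed
  thus ?thesis unfolding I_def by (rule R.genideal_minimal) fact
qed

abbreviation pr :: "'a \<Rightarrow> 'a set" where "pr x \<equiv> I +>\<^bsub>ring_on S\<^esub> x"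

lemma pr_eq_iff:
  assumes "x \<in> S" "y \<in> S"
  shows "pr x = pr y \<longleftrightarrow> x - y \<in> I"
proof -
  have pr: "pr z = (\<lambda>i. i + z) ` I" for z by (auto simp: a_r_coset_def')
  show ?thesis
  proof
    assume "pr x = pr y"
    moreover have "x \<in> pr x" unfolding pr using I_0 by force
    ultimately show "x - y \<in> I" unfolding pr by force
  next
    assume d: "x - y \<in> I"
    have "i + x \<in> pr y" if "i \<in> I" for i
      unfolding pr using I_add[OF that d] by (intro image_eqI[of _ _ "i + (x - y)"]) auto
    moreover have "i + y \<in> pr x" if "i \<in> I" for i
      unfolding pr using I_diff[OF that d] by (intro image_eqI[of _ _ "i - (x - y)"]) auto
    ultimately show "pr x = pr y" unfolding pr by auto
  qed
qed

lemma pr_0: "pr 0 = I"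
  by (auto simp: a_r_coset_def')

lemma pr_surj: "pr ` S = carrier (quot_alg \<iota> (ring_on S) I)"
  by (auto simp: quot_alg_def FactRing_def A_RCOSETS_def')

lemma quot_alg_props:
  assumes "coeff_hom \<iota>" "is_subring K" "\<And>k. k \<in> K \<Longrightarrow> \<iota> k \<in> S"
  shows "module (ring_on K) (quot_alg \<iota> (ring_on S) I)"
    and "pr \<in> mod_hom (ring_on K) (alg_on \<iota> S) (quot_alg \<iota> (ring_on S) I)"
proof -
  interpret ideal I "ring_on S" by (rule ideal)
  have add: "pr (x \<oplus>\<^bsub>alg_on \<iota> S\<^esub> y) = pr x \<oplus>\<^bsub>quot_alg \<iota> (ring_on S) I\<^esub> pr y"
    if "x \<in> carrier (alg_on \<iota> S)" "y \<in> carrier (alg_on \<iota> S)" for x y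
    using that a_rcos_sum[of x y] by (simp add: quot_alg_def FactRing_def)
  have sm: "pr (k \<odot>\<^bsub>alg_on \<iota> S\<^esub> x) = k \<odot>\<^bsub>quot_alg \<iota> (ring_on S) I\<^esub> pr x"
    if "k \<in> carrier (ring_on K)" "x \<in> carrier (alg_on \<iota> S)" for k x
    using that rcoset_mult_add[of "\<iota> k" x] assms(3) by (simp add: quot_alg_def FactRing_def)
  have zero: "pr \<zero>\<^bsub>alg_on \<iota> S\<^esub> = \<zero>\<^bsub>quot_alg \<iota> (ring_on S) I\<^esub>"
    by (simp add: quot_alg_def FactRing_def pr_0)
  have surj: "pr ` carrier (alg_on \<iota> S) = carrier (quot_alg \<iota> (ring_on S) I)"
    using pr_surj by simp
  show "module (ring_on K) (quot_alg \<iota> (ring_on S) I)"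
    and "pr \<in> mod_hom (ring_on K) (alg_on \<iota> S) (quot_alg \<iota> (ring_on S) I)"
    using module_surj_image[where p = pr, OF alg_on_module[OF assms(1,2) S assms(3)] surj add sm zero] by blast+
qed

lemma det_cong:
  assumes "\<And>i j. i < r \<Longrightarrow> j < r \<Longrightarrow> f i j \<in> S" "\<And>i j. i < r \<Longrightarrow> j < r \<Longrightarrow> g i j \<in> S"
    "\<And>i j. i < r \<Longrightarrow> j < r \<Longrightarrow> f i j - g i j \<in> I"
  shows "det (mat r r (\<lambda>(i, j). f i j)) - det (mat r r (\<lambda>(i, j). g i j)) \<in> I"
proof -
  note SS = is_subringD[OF S]
  have sgn: "of_int (sign p) \<in> S" for p :: "nat \<Rightarrow> nat"
    using SS by (cases p rule: sign_cases) auto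
  have prd: "(\<Prod>i\<in>A. u i) - (\<Prod>i\<in>A. v i) \<in> I"
    if "\<And>i. i \<in> A \<Longrightarrow> u i \<in> S \<and> v i \<in> S \<and> u i - v i \<in> I" for u v :: "nat \<Rightarrow> 'a" and A
    using that
  proof (induction A rule: infinite_finite_induct)
    case (insert x A)
    have "(\<Prod>i\<in>insert x A. u i) - (\<Prod>i\<in>insert x A. v i) =
        u x * ((\<Prod>i\<in>A. u i) - (\<Prod>i\<in>A. v i)) + (\<Prod>i\<in>A. v i) * (u x - v x)"
      using insert.hyps by (simp add: algebra_simps)
    also have "\<dots> \<in> I" using insert by (intro I_add I_mult is_subring_prod S) auto
    finally show ?case .
  qed (auto simp: I_0)
  have "det (mat r r (\<lambda>(i, j). f i j)) - det (mat r r (\<lambda>(i, j). g i j)) =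
      (\<Sum>p | p permutes {0..<r}. of_int (sign p) *
        ((\<Prod>i = 0..<r. mat r r (\<lambda>(i, j). f i j) $$ (i, p i)) - (\<Prod>i = 0..<r. mat r r (\<lambda>(i, j). g i j) $$ (i, p i))))"
    by (subst (1 2) det_def'[of _ r]) (simp_all add: right_diff_distrib sum_subtractf)
  also have "\<dots> \<in> I"
  proof (intro I_sum I_mult sgn prd)
    fix p i assume "p \<in> {p. p permutes {0..<r}}" and i: "i \<in> {0..<r}"
    hence "p i < r" using permutes_in_image[of p "{0..<r}" i] by auto
    thus "mat r r (\<lambda>(i, j). f i j) $$ (i, p i) \<in> S \<and> mat r r (\<lambda>(i, j). g i j) $$ (i, p i) \<in> S \<and>
      mat r r (\<lambda>(i, j). f i j) $$ (i, p i) - mat r r (\<lambda>(i, j). g i j) $$ (i, p i) \<in> I"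
      using assms i by simp
  qed
  finally show ?thesis .
qed

end

section \<open>The module \<open>V\<^sub>n(c)\<close>\<close>

lemma Vring_eq: "Vring n = ring_on (V_set n)"
  by (simp add: Vring_def V_set_def B0_carrier)

lemma Xc_shift: "Xc n (n + t) = Polynomial.monom 1 t * Xc n n"
proof -
  have "Xc n (n + t) = (\<Sum>i\<le>n. Polynomial.monom ((- 1) ^ i * cc n i) (n + t - i))"
    unfolding Xc_def by (rule sum.mono_neutral_right) (auto simp: cc_def)
  also have "\<dots> = Polynomial.monom 1 t * Xc n n"
    unfolding Xc_def sum_distrib_left by (intro sum.cong refl) (simp add: mult_monom add.commute)
  finally show ?thesis .
qed

lemma coeff_hom_pconst: "coeff_hom (\<lambda>k :: b0. [:k:])"
  by (rule coeff_hom.intro) auto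

lemma pconst_V_set: "k \<in> B0_set n \<Longrightarrow> [:k:] \<in> V_set n"
  using is_subringD(1)[OF B0_set_subring] by (auto simp: V_set_def coeff_pCons split: nat.splits)

lemma monom_V_set: "k \<in> B0_set n \<Longrightarrow> Polynomial.monom k i \<in> V_set n"
  using is_subringD(1)[OF B0_set_subring] by (auto simp: V_set_def coeff_monom)

interpretation V_ideal: subring_ideal "V_set n" "{Xc n n}" "Videal n" for n
  by (rule subring_ideal.intro) (use Xc_V_set in \<open>auto simp: Videal_def Vring_eq V_set_subring\<close>)

lemma Videal_eq: "Videal n = Xn_mult n"
proof
  note S = is_subringD[OF V_set_subring[of n]]
  show "Videal n \<subseteq> Xn_mult n"
  proof (rule V_ideal.I_least)
    show "Xn_mult n \<subseteq> V_set n" using Xc_V_set S by (auto simp: Xn_mult_def)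
    show "0 \<in> Xn_mult n" unfolding Xn_mult_def using S(1) by (auto intro: exI[of _ 0])
    show "x + y \<in> Xn_mult n" if "x \<in> Xn_mult n" "y \<in> Xn_mult n" for x y
    proof -
      obtain p q where "x = Xc n n * p" "y = Xc n n * q" "p \<in> V_set n" "q \<in> V_set n"
        using \<open>x \<in> Xn_mult n\<close> \<open>y \<in> Xn_mult n\<close> by (auto simp: Xn_mult_def)
      hence "x + y = Xc n n * (p + q)" "p + q \<in> V_set n" using S(3) by (simp_all add: distrib_left)
      thus ?thesis unfolding Xn_mult_def by blast
    qed
    show "s * x \<in> Xn_mult n" if "s \<in> V_set n" "x \<in> Xn_mult n" for s x
    proof -
      obtain p where "x = Xc n n * p" "p \<in> V_set n" using \<open>x \<in> Xn_mult n\<close> by (auto simp: Xn_mult_def)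
      hence "s * x = Xc n n * (s * p)" "s * p \<in> V_set n" using S(4) that(1) by (simp_all add: mult.left_commute)
      thus ?thesis unfolding Xn_mult_def by blast
    qed
    show "{Xc n n} \<subseteq> Xn_mult n" unfolding Xn_mult_def using S(2) by (auto intro: exI[of _ 1])
  qed
  show "Xn_mult n \<subseteq> Videal n"
    using V_ideal.I_mult[of _ n "Xc n n"] V_ideal.I_gen by (auto simp: Xn_mult_def mult.commute)
qed

definition V_class :: "nat \<Rightarrow> b0 poly \<Rightarrow> b0 poly set" where
  "V_class n p = Videal n +>\<^bsub>Vring n\<^esub> p"

lemma V_class_eq: "V_class n = V_ideal.pr n" by (rule ext) (simp add: V_class_def Vring_eq)

lemma Xcl_eq: "Xcl n i = V_class n (Xc n i)" by (simp add: Xcl_def V_class_def)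

lemma Vn_props:
  shows "module (B0 n) (Vn n)" "V_class n \<in> mod_hom (B0 n) (alg_on (\<lambda>k. [:k:]) (V_set n)) (Vn n)"
    "V_class n ` V_set n = carrier (Vn n)"
  unfolding V_class_eq B0_eq Vn_def Vring_eq
  using V_ideal.quot_alg_props[OF coeff_hom_pconst B0_set_subring pconst_V_set] V_ideal.pr_surj by blast+

lemma V_class_eq_iff: "p \<in> V_set n \<Longrightarrow> q \<in> V_set n \<Longrightarrow> V_class n p = V_class n q \<longleftrightarrow> p - q \<in> Xn_mult n"
  unfolding V_class_eq Videal_eq[symmetric] by (rule V_ideal.pr_eq_iff)

lemma V_class_add: "p \<in> V_set n \<Longrightarrow> q \<in> V_set n \<Longrightarrow> V_class n (p + q) = V_class n p \<oplus>\<^bsub>Vn n\<^esub> V_class n q"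
  and V_class_smult: "k \<in> B0_set n \<Longrightarrow> q \<in> V_set n \<Longrightarrow> V_class n (Polynomial.smult k q) = k \<odot>\<^bsub>Vn n\<^esub> V_class n q"
  using mod_hom_add[OF Vn_props(2)] mod_hom_smult[OF Vn_props(2)] by (auto simp: B0_carrier)

lemma V_class_closed: "p \<in> V_set n \<Longrightarrow> V_class n p \<in> carrier (Vn n)"
  using Vn_props(3) by blast

lemma Xcl_closed: "Xcl n i \<in> carrier (Vn n)"
  unfolding Xcl_eq by (intro V_class_closed Xc_V_set)

text \<open>
  \<open>X\<^sup>m(c)\<close> is monic of degree \<open>m\<close>, so the \<open>X\<^sup>m(c)\<close> span all polynomials, and those with \<open>m \<ge> n\<close> are
  multiples of \<open>X\<^sup>n(c)\<close>.
\<close>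

lemma Vn_span:
  assumes N: "submodule N (B0 n) (Vn n)" and X: "Xcl n ` {..<n} \<subseteq> N"
  shows "N = carrier (Vn n)"
proof -
  interpret M: module "B0 n" "Vn n" by (rule Vn_props)
  note sub = M.submoduleE[OF N]
  have zN: "\<zero>\<^bsub>Vn n\<^esub> \<in> N"
    using submodule.axioms(1)[OF N] subgroup.one_closed by force
  note VS = is_subringD[OF V_set_subring[of n]]
  have z: "V_class n 0 = \<zero>\<^bsub>Vn n\<^esub>"
    using mod_hom_zero[OF alg_on_module[OF coeff_hom_pconst B0_set_subring V_set_subring pconst_V_set] Vn_props(1)[unfolded B0_eq] Vn_props(2)[unfolded B0_eq]]
    by simp
  define T where "T = {p \<in> V_set n. V_class n p \<in> N}"
  have T0: "0 \<in> T" using z zN VS by (simp add: T_def)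
  have Tadd: "p + q \<in> T" if "p \<in> T" "q \<in> T" for p q
    using that sub(5) VS by (simp add: T_def V_class_add)
  have Tsm: "Polynomial.smult k p \<in> T" if "k \<in> B0_set n" "p \<in> T" for k p
    using that sub(4)[of k "V_class n p"] VS(4)[OF pconst_V_set, of k p] by (simp add: T_def V_class_smult B0_carrier)
  have Tsum: "sum f A \<in> T" if "\<And>i. i \<in> A \<Longrightarrow> f i \<in> T" for f :: "nat \<Rightarrow> b0 poly" and A
    using that by (induction A rule: infinite_finite_induct) (auto simp: T0 Tadd)
  have XT: "Xc n m \<in> T" for m
  proof (cases "m < n")
    case True
    thus ?thesis using X Xc_V_set by (auto simp: T_def Xcl_eq)
  next
    case False
    then obtain t where m: "m = n + t" using le_Suc_ex not_less by blast
    have "Xc n m \<in> Xn_mult n"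
      unfolding m Xc_shift Xn_mult_def using monom_V_set[OF is_subringD(2)[OF B0_set_subring]] by (auto simp: mult.commute)
    hence "V_class n (Xc n m) = V_class n 0" using V_class_eq_iff[OF Xc_V_set VS(1)] by simp
    thus ?thesis using zN z Xc_V_set by (simp add: T_def)
  qed
  have mT: "Polynomial.monom 1 m \<in> T" for m
  proof (induction m rule: less_induct)
    case (less m)
    have "Xc n m = Polynomial.monom 1 m + (\<Sum>i\<in>{1..m}. Polynomial.smult ((- 1) ^ i * cc n i) (Polynomial.monom 1 (m - i)))"
      unfolding Xc_def by (simp add: sum.atLeast_Suc_atMost smult_monom cc_def flip: atLeast0AtMost)
    hence "Polynomial.monom 1 m = Xc n m + Polynomial.smult (- 1) (\<Sum>i\<in>{1..m}. Polynomial.smult ((- 1) ^ i * cc n i) (Polynomial.monom 1 (m - i)))"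
      by simp
    also have "\<dots> \<in> T"
      by (intro Tadd Tsm Tsum XT less sign_mult_subring B0_set_subring cc_closed is_subringD(5)[OF B0_set_subring] is_subringD(2)[OF B0_set_subring]) auto
    finally show ?case .
  qed
  have "p \<in> T" if "p \<in> V_set n" for p
  proof -
    have "(\<Sum>i\<le>Polynomial.degree p. Polynomial.smult (Polynomial.coeff p i) (Polynomial.monom 1 i)) \<in> T"
      by (intro Tsum Tsm mT) (use that in \<open>auto simp: V_set_def\<close>)
    thus ?thesis by (simp add: smult_monom poly_as_sum_of_monoms)
  qed
  hence "V_class n ` V_set n \<subseteq> N" by (auto simp: T_def)
  hence "carrier (Vn n) \<subseteq> N" unfolding Vn_props(3) .
  thus ?thesis using sub(1) by blast
qed

text \<open>
  The functionals \<open>dual_fun\<close> descend to \<open>V\<^sub>n(c)\<close>, so the choice in \<open>dual_s\<close> has something to choose.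
\<close>

lemma dual_s_props:
  assumes "j < n"
  shows "dual_s n j \<in> dual_mod (B0 n) (Vn n)" "i < n \<Longrightarrow> dual_s n j (Xcl n i) = (if i = j then 1 else 0)"
proof -
  define B :: "(b0, b0) module" where "B = alg_on (\<lambda>k. k) (B0_set n)"
  have h: "dual_fun n j \<in> mod_hom (B0 n) (alg_on (\<lambda>k. [:k:]) (V_set n)) B"
    by (rule mod_homI) (auto simp: B_def B0_carrier dual_fun_closed dual_fun_add dual_fun_smult)
  have mod: "module (B0 n) (alg_on (\<lambda>k. [:k:]) (V_set n))"
    unfolding B0_eq by (rule alg_on_module[OF coeff_hom_pconst B0_set_subring V_set_subring pconst_V_set])
  have surj: "V_class n ` carrier (alg_on (\<lambda>k. [:k:]) (V_set n)) = carrier (Vn n)"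
    using Vn_props(3) by simp
  have wd: "dual_fun n j x = dual_fun n j y" if "x \<in> carrier (alg_on (\<lambda>k. [:k:]) (V_set n))"
    "y \<in> carrier (alg_on (\<lambda>k. [:k:]) (V_set n))" "V_class n x = V_class n y" for x y
  proof -
    have "x - y \<in> Xn_mult n" using that V_class_eq_iff by simp
    hence "dual_fun n j (y + (x - y)) = dual_fun n j y" unfolding dual_fun_add by (simp add: dual_fun_Xn_mult[OF assms])
    thus ?thesis by simp
  qed
  obtain f where f: "f \<in> mod_hom (B0 n) (Vn n) B"
      "\<And>x. x \<in> carrier (alg_on (\<lambda>k. [:k:]) (V_set n)) \<Longrightarrow> f (V_class n x) = dual_fun n j x"
    using mod_hom_factor[OF mod Vn_props(2) surj h wd] by blast
  have "f \<in> dual_mod (B0 n) (Vn n)"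
    using f(1) by (simp add: mod_hom_def dual_mod_def B_def B0_eq)
  moreover have "\<forall>i<n. f (Xcl n i) = (if i = j then 1 else 0)"
    by (simp add: Xcl_eq f(2) Xc_V_set dual_fun_Xc eq_commute)
  ultimately have "\<exists>f. f \<in> dual_mod (B0 n) (Vn n) \<and> (\<forall>i<n. f (Xcl n i) = (if i = j then 1 else 0))"
    by blast
  from someI_ex[OF this, folded dual_s_def]
  show "dual_s n j \<in> dual_mod (B0 n) (Vn n)" "i < n \<Longrightarrow> dual_s n j (Xcl n i) = (if i = j then 1 else 0)"
    by auto
qed

section \<open>The ring \<open>B\<^bsub>r,n\<^esub>(c)\<close> and the exterior power\<close>

interpretation Br_ideal: subring_ideal "Br_set n r" "{hc n r (int j) | j. n - r + 1 \<le> j \<and> j \<le> n}" "Irn n r" for n r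
  by (rule subring_ideal.intro) (use hc_closed in \<open>auto simp: Irn_def Br_eq Br_set_subring\<close>)

lemma proj_eq: "proj n r = Br_ideal.pr n r" by (rule ext) (simp add: proj_def Br_eq)

lemma Brn_props:
  shows "module (B0 n) (Brn n r)" "proj n r \<in> mod_hom (B0 n) (alg_on cst (Br_set n r)) (Brn n r)"
    "proj n r ` Br_set n r = carrier (Brn n r)"
  unfolding proj_eq B0_eq Brn_def Br_eq
  using Br_ideal.quot_alg_props[OF coeff_hom_cst B0_set_subring mpols_cst[OF B0_set_subring]] Br_ideal.pr_surj by blast+

lemma proj_eq_iff: "x \<in> Br_set n r \<Longrightarrow> y \<in> Br_set n r \<Longrightarrow> proj n r x = proj n r y \<longleftrightarrow> x - y \<in> Irn n r"
  unfolding proj_eq by (rule Br_ideal.pr_eq_iff)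

lemma proj_closed: "x \<in> Br_set n r \<Longrightarrow> proj n r x \<in> carrier (Brn n r)"
  using Brn_props(3) by blast

lemma proj_add: "x \<in> Br_set n r \<Longrightarrow> y \<in> Br_set n r \<Longrightarrow> proj n r (x + y) = proj n r x \<oplus>\<^bsub>Brn n r\<^esub> proj n r y"
  and proj_cst: "k \<in> B0_set n \<Longrightarrow> x \<in> Br_set n r \<Longrightarrow> proj n r (cst k * x) = k \<odot>\<^bsub>Brn n r\<^esub> proj n r x"
  using mod_hom_add[OF Brn_props(2)] mod_hom_smult[OF Brn_props(2)] by (auto simp: B0_carrier)

lemma proj_0: "proj n r 0 = \<zero>\<^bsub>Brn n r\<^esub>"
  by (simp add: proj_eq Br_ideal.pr_0 Brn_def quot_alg_def FactRing_def)

lemma proj_in_Irn: "x \<in> Irn n r \<Longrightarrow> proj n r x = \<zero>\<^bsub>Brn n r\<^esub>"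
  using proj_eq_iff[of x n r 0] Br_ideal.I_subset is_subringD(1)[OF Br_set_subring] by (auto simp: proj_0)

lemma proj_sum:
  assumes "finite A" "\<And>i. i \<in> A \<Longrightarrow> f i \<in> Br_set n r"
  shows "proj n r (\<Sum>i\<in>A. f i) = (\<Oplus>\<^bsub>Brn n r\<^esub>i\<in>A. proj n r (f i))"
  using assms
proof (induction A rule: finite_induct)
  case empty
  interpret M: module "B0 n" "Brn n r" by (rule Brn_props)
  show ?case by (simp add: proj_0)
next
  case (insert x A)
  interpret M: module "B0 n" "Brn n r" by (rule Brn_props)
  have "proj n r (\<Sum>i\<in>insert x A. f i) = proj n r (f x + (\<Sum>i\<in>A. f i))" using insert.hyps by simp
  also have "\<dots> = proj n r (f x) \<oplus>\<^bsub>Brn n r\<^esub> proj n r (\<Sum>i\<in>A. f i)"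
    by (rule proj_add) (use insert.prems in \<open>auto intro: is_subring_sum Br_set_subring\<close>)
  also have "\<dots> = (\<Oplus>\<^bsub>Brn n r\<^esub>i\<in>insert x A. proj n r (f i))"
    using insert by (subst M.finsum_insert) (auto intro: proj_closed)
  finally show ?case .
qed

text \<open>
  Beyond \<open>n\<close> the recursion with \<open>r\<close> preceding terms takes over; the \<open>r\<close> generators start it.
\<close>

lemma hc_Irn:
  assumes "r \<le> n" "N \<ge> int n - int r + 1"
  shows "hc n r N \<in> Irn n r"
proof -
  have "hc n r (int m) \<in> Irn n r" if "m \<ge> n - r + 1" for m
    using that
  proof (induction m rule: less_induct)
    case (less m)
    show ?case
    proof (cases "m \<le> n")
      case True
      thus ?thesis using Br_ideal.I_gen less.prems by blast
    next
      case False
      have "(\<Sum>i\<le>r. (- 1) ^ i * vars r i * hc n r (int m - int i)) = 0"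
        by (rule hc_rec) (use False in simp)
      hence "hc n r (int m) = - (\<Sum>i\<in>{1..r}. (- 1) ^ i * vars r i * hc n r (int m - int i))"
        by (simp add: sum.atLeast_Suc_atMost eq_neg_iff_add_eq_0 flip: atLeast0AtMost)
      also have "\<dots> \<in> Irn n r"
      proof (intro Br_ideal.I_uminus Br_ideal.I_sum Br_ideal.I_mult sign_mult_subring Br_set_subring mpols_vars B0_set_subring)
        fix i assume i: "i \<in> {1..r}"
        have "hc n r (int (m - i)) \<in> Irn n r"
          by (rule less.IH) (use i False assms(1) in auto)
        thus "hc n r (int m - int i) \<in> Irn n r" using i False assms(1) by (simp add: of_nat_diff)
      qed
      finally show ?thesis .
    qed
  qed
  from this[of "nat N"] show ?thesis using assms by (simp add: nat_le_iff le_nat_iff)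
qed

lemma h_row_Xn_mult:
  assumes "r \<le> n" "k < r" "f \<in> Xn_mult n"
  shows "h_row r k f \<in> Irn n r"
proof -
  obtain q where q: "f = Xc n n * q" "q \<in> V_set n" using assms(3) by (auto simp: Xn_mult_def)
  have "h_row r k f = (\<Sum>t\<le>Polynomial.degree q. cst (Polynomial.coeff q t) * h_row r k (Polynomial.monom 1 t * Xc n n))"
    unfolding q(1) h_row_def by (rule cst.poly_fun_mult)
  also have "\<dots> \<in> Irn n r"
  proof (intro Br_ideal.I_sum Br_ideal.I_mult mpols_cst B0_set_subring)
    fix t show "Polynomial.coeff q t \<in> B0_set n" using q(2) by (simp add: V_set_def)
    show "h_row r k (Polynomial.monom 1 t * Xc n n) \<in> Irn n r"
      by (subst h_row_Xc_shift[OF assms(2)]) (use assms in \<open>auto intro!: hc_Irn\<close>)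
  qed
  finally show ?thesis .
qed

text \<open>
  Modulo \<open>I\<^bsub>r,n\<^esub>(c)\<close>, \<open>D(f)\<close> depends only on the classes of the \<open>f\<^sub>j\<close> in \<open>V\<^sub>n(c)\<close>.
\<close>

lemma h_det_cong:
  assumes "r \<le> n" "\<And>j. j < r \<Longrightarrow> f j \<in> V_set n" "\<And>j. j < r \<Longrightarrow> g j \<in> V_set n" "\<And>j. j < r \<Longrightarrow> f j - g j \<in> Xn_mult n"
  shows "proj n r (h_det r f) = proj n r (h_det r g)"
proof -
  have "h_det r f - h_det r g \<in> Irn n r"
    unfolding h_det_def
  proof (rule Br_ideal.det_cong)
    fix k j assume kj: "k < r" "j < r"
    have "h_row r k (f j) - h_row r k (g j) = h_row r k (f j - g j)"
      using h_row_add[of r k "f j - g j" "g j"] by simp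
    thus "h_row r k (f j) - h_row r k (g j) \<in> Irn n r" using h_row_Xn_mult[OF assms(1) kj(1) assms(4)[OF kj(2)]] by simp
  qed (auto intro: h_row_closed assms)
  thus ?thesis using proj_eq_iff[OF h_det_closed h_det_closed] assms(2,3) by blast
qed

lemma h_det_span_subset: "x \<in> h_det_span n r J \<Longrightarrow> x \<in> Br_set n r"
proof (induction rule: h_det_span.induct)
  case (step f i a y)
  thus ?case
    by (intro is_subringD(3,4)[OF Br_set_subring] mpols_cst B0_set_subring h_det_closed) auto
qed (rule is_subringD(1)[OF Br_set_subring])

lemma hc_h_det_span_Xn_mult:
  assumes "1 \<le> r" "n - r + 1 \<le> j" "r \<le> n"
  shows "hc n r (int j) \<in> h_det_span n r (Xn_mult n)"
  unfolding hc_as_h_det[OF assms(1)]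
proof (rule h_det_span_h_det[where i = 0])
  obtain t where t: "r - 1 + j = n + t" using assms that[of "r - 1 + j - n"] by simp
  have "Polynomial.monom 1 t \<in> V_set n" by (rule monom_V_set[OF is_subringD(2)[OF B0_set_subring]])
  moreover have "Xc n (n + t) = Xc n n * Polynomial.monom 1 t" by (simp only: Xc_shift mult.commute)
  ultimately have "Xc n (n + t) \<in> Xn_mult n" unfolding Xn_mult_def by blast
  thus "Xc n (if 0 = 0 then r - 1 + j else r - 1 - 0) \<in> Xn_mult n" using t by simp
qed (use assms Xc_V_set in auto)

text \<open>
  The generators are \<open>h\<^sub>j = D(X\<^bsup>r-1+j\<^esup>(c), \<dots>)\<close> with \<open>r - 1 + j \<ge> n\<close>, and the span is an ideal.
\<close>

lemma Irn_h_det_span: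
  assumes "1 \<le> r" "r \<le> n"
  shows "Irn n r \<subseteq> h_det_span n r (Xn_mult n)"
proof (rule Br_ideal.I_least)
  show "h_det_span n r (Xn_mult n) \<subseteq> Br_set n r" using h_det_span_subset by blast
  show "{hc n r (int j) |j. n - r + 1 \<le> j \<and> j \<le> n} \<subseteq> h_det_span n r (Xn_mult n)"
    using hc_h_det_span_Xn_mult assms by blast
qed (auto intro: h_det_span.zero h_det_span_add h_det_span_mult[OF assms(1) X_times_Xn_mult])

lemma Br_set_h_det_span:
  assumes "1 \<le> r" "b \<in> Br_set n r"
  shows "b \<in> h_det_span n r (V_set n)"
proof -
  have "hc n r (int 0) \<in> h_det_span n r (V_set n)"
    unfolding hc_as_h_det[OF assms(1)] by (rule h_det_span_h_det[where i = 0]) (use assms Xc_V_set in auto)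
  hence "b * 1 \<in> h_det_span n r (V_set n)"
    using assms V_set_X_times by (intro h_det_span_mult) (auto simp: hc_0)
  thus ?thesis by simp
qed

lemma h_row_0: "h_row r k 0 = 0"
  by (simp add: h_row_def)

lemma h_det_col_add:
  assumes "i < r"
  shows "h_det r (f(i := x + y)) = h_det r (f(i := x)) + h_det r (f(i := y))"
proof -
  have "h_det r (f(i := x + y)) = h_det r (f(i := x)) + 1 * h_det r (f(i := y))"
    unfolding h_det_def by (rule det_col_linear[of _ r _ _ i]) (use assms in \<open>auto simp: h_row_add\<close>)
  thus ?thesis by simp
qed

lemma h_det_col_smult:
  assumes "i < r"
  shows "h_det r (f(i := Polynomial.smult k x)) = cst k * h_det r (f(i := x))"
proof -
  have "h_det r (f(i := Polynomial.smult k x)) = h_det r (f(i := 0)) + cst k * h_det r (f(i := x))"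
    unfolding h_det_def by (rule det_col_linear[of _ r _ _ i]) (use assms in \<open>auto simp: h_row_smult h_row_0\<close>)
  moreover have "h_det r (f(i := 0)) = 0"
    unfolding h_det_def by (rule det_zero_col[OF assms]) (simp add: h_row_0)
  ultimately show ?thesis by simp
qed

lemma h_det_eq_cols:
  assumes "i < r" "j < r" "i \<noteq> j" "f i = f j"
  shows "h_det r f = 0"
  unfolding h_det_def
  by (rule det_identical_columns[of _ r i j]) (use assms in \<open>auto simp: col_def\<close>)

text \<open>
  The map \<open>u\<^sub>1 \<and> \<dots> \<and> u\<^sub>r \<mapsto> D(u\<^sub>1, \<dots>, u\<^sub>r)\<close> from the exterior power to \<open>B\<^bsub>r,n\<^esub>(c)\<close>, computed with
  representatives of the classes \<open>u\<^sub>i\<close>. It is the inverse of the identification \<open>phi\<close>. Working with it has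
  the advantage that its value is known on every wedge and not only on the sorted wedges of basis
  vectors.
\<close>

lemma psi_exists:
  assumes "r \<le> n"
  obtains psi where "psi \<in> mod_hom (B0 n) (ext_power (B0 n) (Vn n) r) (Brn n r)"
    "\<And>f. (\<And>j. j < r \<Longrightarrow> f j \<in> V_set n) \<Longrightarrow>
      psi (wedge (B0 n) (Vn n) (map (\<lambda>j. V_class n (f j)) [0..<r])) = proj n r (h_det r f)"
proof -
  let ?R = "B0 n" and ?M = "Vn n" and ?B = "Brn n r"
  interpret M: module ?R ?M by (rule Vn_props)
  interpret Br: module ?R ?B by (rule Brn_props)
  define rep where "rep = (\<lambda>C. SOME p. p \<in> V_set n \<and> V_class n p = C)"
  have rep: "rep C \<in> V_set n" "V_class n (rep C) = C" if "C \<in> carrier ?M" for C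
  proof -
    have "C \<in> V_class n ` V_set n" using that by (simp only: Vn_props(3))
    hence "\<exists>p. p \<in> V_set n \<and> V_class n p = C" by blast
    hence "rep C \<in> V_set n \<and> V_class n (rep C) = C" unfolding rep_def by (rule someI_ex)
    thus "rep C \<in> V_set n" "V_class n (rep C) = C" by simp_all
  qed
  define g where "g = (\<lambda>us. proj n r (h_det r (\<lambda>j. rep (us ! j))))"
  have g: "g us = proj n r (h_det r f)"
    if "us \<in> tuples ?M r" "\<And>j. j < r \<Longrightarrow> f j \<in> V_set n" "\<And>j. j < r \<Longrightarrow> V_class n (f j) = us ! j" for us f
    unfolding g_def
  proof (rule h_det_cong[OF assms])
    fix j assume j: "j < r"
    have us: "us ! j \<in> carrier ?M" using that(1) j by (rule tuples_nth)
    show "rep (us ! j) \<in> V_set n" by (rule rep[OF us])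
    show "f j \<in> V_set n" by (rule that(2)[OF j])
    show "rep (us ! j) - f j \<in> Xn_mult n"
      using V_class_eq_iff[OF rep(1)[OF us] that(2)[OF j]] rep(2)[OF us] that(3)[OF j] by simp
  qed
  have upd: "g (us[i := V_class n p]) = proj n r (h_det r ((\<lambda>j. rep (us ! j))(i := p)))"
    if us: "us \<in> tuples ?M r" and "i < r" and p: "p \<in> V_set n" for us i p
  proof (rule g)
    show "us[i := V_class n p] \<in> tuples ?M r" by (intro tuples_update us V_class_closed p)
    fix j assume "j < r"
    hence "us ! j \<in> carrier ?M" using us by (intro tuples_nth)
    thus "((\<lambda>j. rep (us ! j))(i := p)) j \<in> V_set n" "V_class n (((\<lambda>j. rep (us ! j))(i := p)) j) = us[i := V_class n p] ! j"
      using p rep \<open>j < r\<close> tuples_length[OF us] by (auto simp: nth_list_update)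
  qed
  have Br_set: "h_det r ((\<lambda>j. rep (us ! j))(i := p)) \<in> Br_set n r" if "us \<in> tuples ?M r" "p \<in> V_set n" for us i p
    using that rep tuples_nth[OF that(1)] by (intro h_det_closed) auto
  have 1: "multilinear ?R ?M r ?B g"
    unfolding multilinear_def
  proof (intro conjI ballI allI impI)
    show "g \<in> tuples ?M r \<rightarrow> carrier ?B"
    proof (intro Pi_I)
      fix us assume "us \<in> tuples ?M r"
      thus "g us \<in> carrier ?B" unfolding g_def by (intro proj_closed h_det_closed rep tuples_nth)
    qed
  next
    fix us i x y assume us: "us \<in> tuples ?M r" "i < r" and x: "x \<in> carrier ?M" and y: "y \<in> carrier ?M"
    note rx = rep[OF x] and ry = rep[OF y]
    have sum: "rep x + rep y \<in> V_set n" using is_subringD(3)[OF V_set_subring] rx ry by blast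
    have "g (us[i := x \<oplus>\<^bsub>?M\<^esub> y]) = g (us[i := V_class n (rep x + rep y)])"
      by (simp add: V_class_add rx ry)
    also have "\<dots> = g (us[i := V_class n (rep x)]) \<oplus>\<^bsub>?B\<^esub> g (us[i := V_class n (rep y)])"
      unfolding upd[OF us sum] upd[OF us rx(1)] upd[OF us ry(1)] h_det_col_add[OF us(2)]
      by (intro proj_add Br_set us rx ry)
    finally show "g (us[i := x \<oplus>\<^bsub>?M\<^esub> y]) = g (us[i := x]) \<oplus>\<^bsub>?B\<^esub> g (us[i := y])" by (simp add: rx ry)
  next
    fix us i k x assume us: "us \<in> tuples ?M r" "i < r" and k: "k \<in> carrier ?R" and x: "x \<in> carrier ?M"
    note rx = rep[OF x]
    have k': "k \<in> B0_set n" using k by (simp add: B0_carrier)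
    have sm: "Polynomial.smult k (rep x) \<in> V_set n"
      using is_subringD(4)[OF V_set_subring pconst_V_set[OF k'] rx(1)] by simp
    have "g (us[i := k \<odot>\<^bsub>?M\<^esub> x]) = g (us[i := V_class n (Polynomial.smult k (rep x))])"
      by (simp add: V_class_smult rx k')
    also have "\<dots> = k \<odot>\<^bsub>?B\<^esub> g (us[i := V_class n (rep x)])"
      unfolding upd[OF us sm] upd[OF us rx(1)] h_det_col_smult[OF us(2)]
      by (intro proj_cst Br_set us rx k')
    finally show "g (us[i := k \<odot>\<^bsub>?M\<^esub> x]) = k \<odot>\<^bsub>?B\<^esub> g (us[i := x])" by (simp add: rx)
  qed
  have 2: "adj_alternating ?M r ?B g"
    unfolding adj_alternating_def
  proof (intro ballI allI impI)
    fix us i assume "us \<in> tuples ?M r" "Suc i < r" "us ! i = us ! Suc i"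
    hence "h_det r (\<lambda>j. rep (us ! j)) = 0" by (intro h_det_eq_cols[of i r "Suc i"]) auto
    thus "g us = \<zero>\<^bsub>?B\<^esub>" by (simp add: g_def proj_0)
  qed
  obtain psi where psi: "psi \<in> mod_hom ?R (ext_power ?R ?M r) ?B"
    "\<And>us. us \<in> tuples ?M r \<Longrightarrow> psi (wedge ?R ?M us) = g us"
    using ext_power_universal[OF M.module_axioms Br.module_axioms 1 2] by blast
  show ?thesis
  proof (rule that[OF psi(1)])
    fix f assume f: "\<And>j. j < r \<Longrightarrow> f j \<in> V_set n"
    have us: "map (\<lambda>j. V_class n (f j)) [0..<r] \<in> tuples ?M r"
      using f V_class_closed by (auto simp: tuples_def)
    show "psi (wedge ?R ?M (map (\<lambda>j. V_class n (f j)) [0..<r])) = proj n r (h_det r f)"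
      unfolding psi(2)[OF us] by (rule g[OF us f]) auto
  qed
qed

text \<open>
  The exponents \<open>r - 1 - j + \<lambda>\<^sub>j\<close>; partitions in the box correspond to decreasing sequences below \<open>n\<close>.
\<close>

definition wedge_index :: "nat \<Rightarrow> nat list \<Rightarrow> nat \<Rightarrow> nat" where
  "wedge_index r lam j = r - 1 - j + lam ! j"

lemma Delta_eq: "Delta n r lam = h_det r (\<lambda>j. Xc n (wedge_index r lam j))"
  unfolding Delta_def h_det_def
  by (intro arg_cong[of _ _ det] eq_matI)
    (auto simp: h_row_Xc wedge_index_def of_nat_diff intro!: arg_cong[of _ _ "hc n r"])

lemma wedge_of_eq: "wedge_of n r lam = wedge (B0 n) (Vn n) (map (\<lambda>j. V_class n (Xc n (wedge_index r lam j))) [0..<r])"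
  by (simp add: wedge_of_def Xcl_eq wedge_index_def)

lemma wedge_of_closed: "wedge_of n r lam \<in> carrier (ext_power (B0 n) (Vn n) r)"
  unfolding wedge_of_eq
  by (rule wedge_closed[OF Vn_props(1)]) (auto simp: tuples_def intro!: V_class_closed Xc_V_set)

lemma box_partitions_finite: "finite (box_partitions r n)"
  by (rule finite_subset[OF _ finite_lists_length_eq[of "{..n - r}" r]]) (auto simp: box_partitions_def)

lemma wedge_index_decreasing:
  assumes "lam \<in> box_partitions r n"
  shows "strict_antimono_on {..<r} (wedge_index r lam)"
proof (rule monotone_onI)
  fix i j assume ij: "i \<in> {..<r}" "j \<in> {..<r}" "i < j"
  have "lam ! i \<ge> lam ! j"
    using assms ij by (auto simp: box_partitions_def sorted_wrt_iff_nth_less)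
  thus "wedge_index r lam j < wedge_index r lam i" using ij by (auto simp: wedge_index_def)
qed

lemma wedge_index_less:
  assumes "lam \<in> box_partitions r n" "r \<le> n" "i < r"
  shows "wedge_index r lam i < n"
proof -
  have "lam ! i \<le> n - r" using assms by (auto simp: box_partitions_def)
  thus ?thesis using assms by (auto simp: wedge_index_def)
qed

lemma decreasing_wedge_index:
  assumes "length ms = r" "sorted_wrt (>) ms" "set ms \<subseteq> {..<n}" "r \<le> n"
  obtains lam where "lam \<in> box_partitions r n" "\<And>i. i < r \<Longrightarrow> wedge_index r lam i = ms ! i"
proof -
  have dec: "ms ! j < ms ! i" if "i < j" "j < r" for i j
    using assms(1,2) that by (auto simp: sorted_wrt_iff_nth_less)
  have lo: "r - 1 - i \<le> ms ! i" if "i < r" for i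
    using that
  proof (induction "r - 1 - i" arbitrary: i)
    case (Suc d)
    have "r - 1 - Suc i \<le> ms ! Suc i" using Suc by (intro Suc.hyps) auto
    moreover have "Suc i < r" using Suc.hyps(2) by simp
    ultimately show ?case using dec[of i "Suc i"] by linarith
  qed auto
  have hi: "ms ! i + i < n" if "i < r" for i
    using that
  proof (induction i)
    case 0
    thus ?case using assms(1,3) by (auto simp: subset_iff)
  next
    case (Suc i)
    thus ?case using dec[of i "Suc i"] by auto
  qed
  define lam where "lam = map (\<lambda>i. ms ! i - (r - 1 - i)) [0..<r]"
  have nth: "lam ! i = ms ! i - (r - 1 - i)" if "i < r" for i using that by (simp add: lam_def)
  have "lam \<in> box_partitions r n"
    unfolding box_partitions_def
  proof safe
    show "length lam = r" by (simp add: lam_def)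
    have step: "lam ! i \<ge> lam ! Suc i" if "Suc i < r" for i
      using that dec[of i "Suc i"] lo[of i] lo[of "Suc i"] by (simp add: nth)
    show "sorted_wrt (\<ge>) lam"
      by (subst sorted_wrt_iff_nth_Suc_transp) (use step in \<open>auto simp: transp_def lam_def\<close>)
    fix p assume "p \<in> set lam"
    then obtain i where "i < r" "p = ms ! i - (r - 1 - i)" by (auto simp: lam_def)
    thus "p \<le> n - r" using hi[of i] lo[of i] assms(4) by auto
  qed
  moreover have "wedge_index r lam i = ms ! i" if "i < r" for i
    using lo[OF that] that by (simp add: wedge_index_def nth)
  ultimately show ?thesis by (rule that)
qed

lemma ext_span:
  assumes "r \<le> n" "submodule N (B0 n) (ext_power (B0 n) (Vn n) r)"
    "\<And>lam. lam \<in> box_partitions r n \<Longrightarrow> wedge_of n r lam \<in> N"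
  shows "N = carrier (ext_power (B0 n) (Vn n) r)"
proof (rule wedge_span[OF Vn_props(1) Xcl_closed Vn_span assms(2)])
  fix ms assume "length ms = r" "sorted_wrt (>) ms" "set ms \<subseteq> {..<n}"
  then obtain lam where lam: "lam \<in> box_partitions r n" "\<And>i. i < r \<Longrightarrow> wedge_index r lam i = ms ! i"
    using decreasing_wedge_index assms(1) by metis
  have "map (Xcl n) ms = map (\<lambda>j. V_class n (Xc n (wedge_index r lam j))) [0..<r]"
    using \<open>length ms = r\<close> by (intro nth_equalityI) (auto simp: lam(2) Xcl_eq)
  thus "wedge (B0 n) (Vn n) (map (Xcl n) ms) \<in> N"
    using assms(3)[OF lam(1)] by (simp add: wedge_of_eq)
qed

text \<open>
  The candidate for \<open>phi\<close>: the sum of all wedges \<open>wedge_of n r \<lambda>\<close> weighted with the coordinates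
  \<open>pluecker\<close>. The coordinates vanish on \<open>I\<^bsub>r,n\<^esub>(c)\<close> and pick out a single Schur determinant.
\<close>

lemma kappa_exists:
  assumes "1 \<le> r" "r \<le> n"
  obtains kappa where "kappa \<in> mod_hom (B0 n) (Brn n r) (ext_power (B0 n) (Vn n) r)"
    "\<And>lam. lam \<in> box_partitions r n \<Longrightarrow> kappa (proj n r (Delta n r lam)) = wedge_of n r lam"
proof -
  let ?R = "B0 n" and ?B = "Brn n r" and ?E = "ext_power (B0 n) (Vn n) r" and ?A = "alg_on cst (Br_set n r)"
  interpret E: module ?R ?E by (rule ext_power_module[OF Vn_props(1)])
  have A: "module ?R ?A"
    unfolding B0_eq by (rule alg_on_module[OF coeff_hom_cst B0_set_subring Br_set_subring mpols_cst[OF B0_set_subring]])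
  note wc = wedge_of_closed
  let ?k = "\<lambda>lam. pluecker n r (wedge_index r lam)"
  have kc: "?k lam b \<in> carrier ?R" if "b \<in> Br_set n r" for lam b
    using pluecker_h_det_span_closed[OF Br_set_h_det_span[OF assms(1) that]] by (simp add: B0_carrier)
  define h where "h = (\<lambda>b. \<Oplus>\<^bsub>?E\<^esub>lam\<in>box_partitions r n. ?k lam b \<odot>\<^bsub>?E\<^esub> wedge_of n r lam)"
  have hh: "h \<in> mod_hom ?R ?A ?E"
  proof (rule mod_homI)
    fix b assume "b \<in> carrier ?A"
    thus "h b \<in> carrier ?E" unfolding h_def by (intro E.finsum_closed Pi_I E.smult_closed kc wc) simp
  next
    fix b c assume bc: "b \<in> carrier ?A" "c \<in> carrier ?A"
    have "h (b \<oplus>\<^bsub>?A\<^esub> c) = (\<Oplus>\<^bsub>?E\<^esub>lam\<in>box_partitions r n. ?k lam b \<odot>\<^bsub>?E\<^esub> wedge_of n r lam \<oplus>\<^bsub>?E\<^esub> ?k lam c \<odot>\<^bsub>?E\<^esub> wedge_of n r lam)"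
      unfolding h_def
    proof (rule E.finsum_cong'[OF refl])
      fix lam
      have "?k lam (b + c) = ?k lam b \<oplus>\<^bsub>?R\<^esub> ?k lam c" by (simp add: pluecker_add B0_eq)
      thus "?k lam (b \<oplus>\<^bsub>?A\<^esub> c) \<odot>\<^bsub>?E\<^esub> wedge_of n r lam =
          ?k lam b \<odot>\<^bsub>?E\<^esub> wedge_of n r lam \<oplus>\<^bsub>?E\<^esub> ?k lam c \<odot>\<^bsub>?E\<^esub> wedge_of n r lam"
        using bc kc wc by (simp add: E.smult_l_distr)
    qed (use bc in \<open>intro Pi_I E.a_closed E.smult_closed kc wc; simp\<close>)
    also have "\<dots> = h b \<oplus>\<^bsub>?E\<^esub> h c" unfolding h_def
      by (rule E.finsum_addf) (use bc in \<open>intro Pi_I E.smult_closed kc wc; simp\<close>)+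
    finally show "h (b \<oplus>\<^bsub>?A\<^esub> c) = \<dots>" .
  next
    fix k b assume k: "k \<in> carrier ?R" and b: "b \<in> carrier ?A"
    have "h (k \<odot>\<^bsub>?A\<^esub> b) = (\<Oplus>\<^bsub>?E\<^esub>lam\<in>box_partitions r n. k \<odot>\<^bsub>?E\<^esub> (?k lam b \<odot>\<^bsub>?E\<^esub> wedge_of n r lam))"
      unfolding h_def
    proof (rule E.finsum_cong'[OF refl])
      fix lam
      have "?k lam (cst k * b) = k \<otimes>\<^bsub>?R\<^esub> ?k lam b" by (simp add: pluecker_cst B0_eq)
      thus "?k lam (k \<odot>\<^bsub>?A\<^esub> b) \<odot>\<^bsub>?E\<^esub> wedge_of n r lam = k \<odot>\<^bsub>?E\<^esub> (?k lam b \<odot>\<^bsub>?E\<^esub> wedge_of n r lam)"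
        using b k kc wc by (simp add: E.smult_assoc1)
    qed (use b k in \<open>intro Pi_I E.smult_closed kc wc; simp\<close>)
    also have "\<dots> = k \<odot>\<^bsub>?E\<^esub> h b" unfolding h_def
      by (rule E.finsum_smult_ldistr[symmetric, OF box_partitions_finite k])
        (use b in \<open>intro Pi_I E.smult_closed kc wc; simp\<close>)
    finally show "h (k \<odot>\<^bsub>?A\<^esub> b) = \<dots>" .
  qed
  have wd: "h x = h y" if "x \<in> carrier ?A" "y \<in> carrier ?A" "proj n r x = proj n r y" for x y
  proof -
    have "x - y \<in> Irn n r" using that proj_eq_iff by simp
    hence xy: "x - y \<in> h_det_span n r (Xn_mult n)" using Irn_h_det_span[OF assms] by blast
    have "?k lam x = ?k lam y" if "lam \<in> box_partitions r n" for lam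
    proof -
      have "?k lam (x - y) = 0"
        by (rule pluecker_h_det_span_Xn_mult[OF xy]) (rule wedge_index_less[OF that assms(2)])
      thus ?thesis using pluecker_add[of n r "wedge_index r lam" "x - y" y] by simp
    qed
    thus ?thesis unfolding h_def
      using that(2) by (intro E.finsum_cong' refl) (auto intro!: E.smult_closed kc wc)
  qed
  have surj: "proj n r ` carrier ?A = carrier ?B" using Brn_props(3) by simp
  obtain kappa where kappa: "kappa \<in> mod_hom ?R ?B ?E" "\<And>b. b \<in> carrier ?A \<Longrightarrow> kappa (proj n r b) = h b"
    using mod_hom_factor[OF A Brn_props(2) surj hh wd] by blast
  show ?thesis
  proof (rule that[OF kappa(1)])
    fix lam assume lam: "lam \<in> box_partitions r n"
    have D: "Delta n r lam \<in> Br_set n r" unfolding Delta_eq by (intro h_det_closed Xc_V_set)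
    have kd: "?k mu (Delta n r lam) = (if mu = lam then 1 else 0)" if mu: "mu \<in> box_partitions r n" for mu
    proof -
      have "(\<forall>i<r. wedge_index r mu i = wedge_index r lam i) \<longleftrightarrow> mu = lam"
        using lam mu by (auto simp: wedge_index_def box_partitions_def intro!: nth_equalityI)
      thus ?thesis
        unfolding Delta_eq pluecker_h_det_Xc[OF wedge_index_decreasing[OF mu] wedge_index_decreasing[OF lam]] by simp
    qed
    have "kappa (proj n r (Delta n r lam)) = h (Delta n r lam)" using kappa(2) D by simp
    also have "\<dots> = (\<Oplus>\<^bsub>?E\<^esub>mu\<in>{lam}. ?k mu (Delta n r lam) \<odot>\<^bsub>?E\<^esub> wedge_of n r mu)"
      unfolding h_def
    proof (rule E.add.finprod_mono_neutral_cong_right[OF box_partitions_finite])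
      fix mu assume "mu \<in> box_partitions r n - {lam}"
      hence "?k mu (Delta n r lam) = \<zero>\<^bsub>?R\<^esub>" using kd by (simp add: B0_eq)
      thus "?k mu (Delta n r lam) \<odot>\<^bsub>?E\<^esub> wedge_of n r mu = \<zero>\<^bsub>?E\<^esub>" using wc by simp
    qed (use lam kc[OF D] wc in auto)
    also have "\<dots> = ?k lam (Delta n r lam) \<odot>\<^bsub>?E\<^esub> wedge_of n r lam"
      using kc[OF D] wc by simp
    also have "?k lam (Delta n r lam) = \<one>\<^bsub>?R\<^esub>" using kd[OF lam] by (simp add: B0_eq)
    finally show "kappa (proj n r (Delta n r lam)) = wedge_of n r lam" using wc by simp
  qed
qed

text \<open>
  Any homomorphism with the values prescribed for \<open>phi\<close> is a left inverse of \<open>psi\<close>, since the two sides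
  agree on the wedges of \<open>ext_span\<close>. As \<open>psi\<close> is also onto, the map of \<open>kappa_exists\<close> is an
  isomorphism, so the choice in \<open>phi\<close> succeeds, and the chosen map is again the inverse of \<open>psi\<close>.
\<close>

lemma phi_inverse:
  assumes "1 \<le> r" "r \<le> n" and psi: "psi \<in> mod_hom (B0 n) (ext_power (B0 n) (Vn n) r) (Brn n r)"
    "\<And>f. (\<And>j. j < r \<Longrightarrow> f j \<in> V_set n) \<Longrightarrow>
      psi (wedge (B0 n) (Vn n) (map (\<lambda>j. V_class n (f j)) [0..<r])) = proj n r (h_det r f)"
  shows "lam \<in> box_partitions r n \<Longrightarrow> phi n r (proj n r (Delta n r lam)) = wedge_of n r lam"
    and "w \<in> carrier (ext_power (B0 n) (Vn n) r) \<Longrightarrow> inv_into (carrier (Brn n r)) (phi n r) w = psi w"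
proof -
  let ?R = "B0 n" and ?B = "Brn n r" and ?E = "ext_power (B0 n) (Vn n) r"
  interpret E: module ?R ?E by (rule ext_power_module[OF Vn_props(1)])
  interpret Br: module ?R ?B by (rule Brn_props)
  have psi_wedge: "psi (wedge_of n r lam) = proj n r (Delta n r lam)" for lam
    unfolding wedge_of_eq Delta_eq by (rule psi(2)) (rule Xc_V_set)
  note wc = wedge_of_closed
  have left_inv: "f (psi w) = w"
    if f: "f \<in> mod_hom ?R ?B ?E" "\<And>lam. lam \<in> box_partitions r n \<Longrightarrow> f (proj n r (Delta n r lam)) = wedge_of n r lam"
      and w: "w \<in> carrier ?E" for f w
  proof -
    have id: "(\<lambda>x. x) \<in> mod_hom ?R ?E ?E" by (auto simp: mod_hom_def)
    have "{x \<in> carrier ?E. f (psi x) = x} = carrier ?E"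
    proof (rule ext_span[OF assms(2)])
      show "submodule {x \<in> carrier ?E. f (psi x) = x} ?R ?E"
        by (rule mod_hom_equalizer[OF E.module_axioms E.module_axioms mod_hom_compose[OF psi(1) f(1)] id])
    qed (simp add: wc psi_wedge f(2))
    thus ?thesis using w by blast
  qed
  have surj: "\<exists>u\<in>carrier ?E. psi u = proj n r b" if "b \<in> h_det_span n r (V_set n)" for b
    using that
  proof (induction rule: h_det_span.induct)
    case zero
    show ?case using mod_hom_zero[OF E.module_axioms Br.module_axioms psi(1)] by (auto simp: proj_0)
  next
    case (step f i a y)
    then obtain u where u: "u \<in> carrier ?E" "psi u = proj n r y" by blast
    let ?w = "wedge ?R (Vn n) (map (\<lambda>j. V_class n (f j)) [0..<r])"
    have w: "?w \<in> carrier ?E"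
      by (rule wedge_closed[OF Vn_props(1)]) (use step(1) V_class_closed in \<open>auto simp: tuples_def\<close>)
    have a: "a \<in> carrier ?R" using step(4) by (simp add: B0_carrier)
    have "psi (a \<odot>\<^bsub>?E\<^esub> ?w \<oplus>\<^bsub>?E\<^esub> u) = a \<odot>\<^bsub>?B\<^esub> proj n r (h_det r f) \<oplus>\<^bsub>?B\<^esub> proj n r y"
      using a w u step(1) by (simp add: mod_hom_add[OF psi(1)] mod_hom_smult[OF psi(1)] psi(2))
    also have "\<dots> = proj n r (cst a * h_det r f + y)"
      using step h_det_closed[of r f n] h_det_span_subset[OF step(5)] is_subringD(4)[OF Br_set_subring mpols_cst[OF B0_set_subring step(4)]]
      by (simp add: proj_add proj_cst)
    finally show ?case using a w u(1) by (intro bexI[of _ "a \<odot>\<^bsub>?E\<^esub> ?w \<oplus>\<^bsub>?E\<^esub> u"]) auto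
  qed
  obtain kappa where kappa: "kappa \<in> mod_hom ?R ?B ?E"
    "\<And>lam. lam \<in> box_partitions r n \<Longrightarrow> kappa (proj n r (Delta n r lam)) = wedge_of n r lam"
    using kappa_exists[OF assms(1,2)] by blast
  have "bij_betw kappa (carrier ?B) (carrier ?E)"
  proof (rule bij_betw_byWitness[where f' = psi])
    show "\<forall>w\<in>carrier ?E. kappa (psi w) = w" using left_inv[OF kappa] by blast
    show "\<forall>x\<in>carrier ?B. psi (kappa x) = x"
    proof
      fix x assume "x \<in> carrier ?B"
      then obtain b where "b \<in> Br_set n r" "x = proj n r b" using Brn_props(3)[of n r] by blast
      then obtain u where "u \<in> carrier ?E" "psi u = x" using surj Br_set_h_det_span[OF assms(1)] by metis
      thus "psi (kappa x) = x" using left_inv[OF kappa] by metis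
    qed
  qed (use mod_hom_closed[OF kappa(1)] mod_hom_closed[OF psi(1)] in auto)
  hence "\<exists>f. f \<in> mod_iso ?R ?B ?E \<and> (\<forall>lam\<in>box_partitions r n. f (proj n r (Delta n r lam)) = wedge_of n r lam)"
    using kappa by (auto simp: mod_iso_def)
  from someI_ex[OF this, folded phi_def]
  have phi: "phi n r \<in> mod_hom ?R ?B ?E" "bij_betw (phi n r) (carrier ?B) (carrier ?E)"
    "\<And>lam. lam \<in> box_partitions r n \<Longrightarrow> phi n r (proj n r (Delta n r lam)) = wedge_of n r lam"
    by (auto simp: mod_iso_def)
  show "lam \<in> box_partitions r n \<Longrightarrow> phi n r (proj n r (Delta n r lam)) = wedge_of n r lam"
    by (rule phi(3))
  show "w \<in> carrier ?E \<Longrightarrow> inv_into (carrier ?B) (phi n r) w = psi w"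
    by (rule inv_into_f_eq[OF bij_betw_imp_inj_on[OF phi(2)]])
      (use mod_hom_closed[OF psi(1)] left_inv[OF phi(1,3)] in auto)
qed

section \<open>The action on Schur determinants\<close>

text \<open>
  The determinant attached to \<open>X\<^sup>a(c) \<and> X\<^bsup>m\<^sub>0\<^esup>(c) \<and> \<dots>\<close> with the factor \<open>X\<^bsup>m\<^sub>k\<^esup>(c)\<close> omitted. The entries
  are written with \<open>h\<^sub>j\<close> at integer indices so that it makes sense for every integer \<open>a\<close>.
\<close>

definition repl_det :: "nat \<Rightarrow> nat \<Rightarrow> (nat \<Rightarrow> nat) \<Rightarrow> nat \<Rightarrow> int \<Rightarrow> br" where
  "repl_det n r m k a = det (mat r r (\<lambda>(i, j).
     hc n r ((if j = 0 then a else int (m (insert_index k (j - 1)))) - int r + 1 + int i)))"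

lemma repl_det_h_det:
  "repl_det n r m k (int p) = h_det r (\<lambda>j. Xc n (if j = 0 then p else m (insert_index k (j - 1))))"
  unfolding repl_det_def h_det_def
  by (intro arg_cong[of _ _ det] eq_matI) (auto simp: h_row_Xc)

lemma repl_det_closed: "repl_det n r m k a \<in> Br_set n r"
  unfolding repl_det_def by (intro is_subring_det Br_set_subring hc_closed)

lemma repl_det_neg:
  assumes "1 \<le> r" "a < 0"
  shows "repl_det n r m k a = 0"
  unfolding repl_det_def by (rule det_zero_col[of 0]) (use assms in \<open>auto intro: hc_neg\<close>)

text \<open>
  The first column then consists of \<open>h\<^sub>j\<close> with \<open>j \<ge> n - r + 1\<close>.
\<close>

lemma repl_det_large:
  assumes "1 \<le> r" "r \<le> n" "a \<ge> int n"
  shows "repl_det n r m k a \<in> Irn n r"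
proof -
  let ?f = "\<lambda>i j. hc n r ((if j = 0 then a else int (m (insert_index k (j - 1)))) - int r + 1 + int i)"
  let ?g = "\<lambda>i j. if j = 0 then 0 else ?f i j"
  have "det (mat r r (\<lambda>(i, j). ?f i j)) - det (mat r r (\<lambda>(i, j). ?g i j)) \<in> Irn n r"
  proof (rule Br_ideal.det_cong)
    show "?f i j - ?g i j \<in> Irn n r" for i j
      using assms hc_Irn[OF assms(2), of "a - int r + 1 + int i"] Br_ideal.I_0 by simp
  qed (auto intro: hc_closed is_subringD(1)[OF Br_set_subring])
  moreover have "det (mat r r (\<lambda>(i, j). ?g i j)) = 0"
    by (rule det_zero_col[of 0]) (use assms in auto)
  ultimately show ?thesis by (simp add: repl_det_def)
qed

lemma B0_sign: "(\<ominus>\<^bsub>B0 n\<^esub> \<one>\<^bsub>B0 n\<^esub>) [^]\<^bsub>B0 n\<^esub> k = (- 1) ^ (k :: nat)"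
proof -
  interpret R: cring "B0 n" unfolding B0_eq by (rule cring_ring_on[OF B0_set_subring])
  have "\<ominus>\<^bsub>B0 n\<^esub> \<one>\<^bsub>B0 n\<^esub> = - 1"
    by (rule R.minus_equality)
      (use is_subringD[OF B0_set_subring[of n]] in \<open>auto simp: B0_eq\<close>)
  thus ?thesis by (induction k) (simp_all add: B0_eq)
qed

text \<open>
  Contraction with \<open>\<partial>\<^sup>q(s)\<close> keeps the terms in which the omitted factor is \<open>X\<^sup>q(c)\<close>, multiplication
  puts \<open>X\<^sup>p(c)\<close> in front, and \<open>psi\<close> evaluates the resulting wedges to determinants.
\<close>

lemma gl_act_Delta:
  assumes "1 \<le> r" "r \<le> n" "lam \<in> box_partitions r n" "p < n" "q < n"
  defines "m \<equiv> wedge_index r lam"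
  shows "gl_act_Brn n r (Xcl n p) (dual_s n q) (proj n r (Delta n r lam)) =
    proj n r (\<Sum>k<r. if m k = q then (- 1) ^ k * repl_det n r m k (int p) else 0)"
proof -
  let ?R = "B0 n" and ?M = "Vn n" and ?B = "Brn n r"
  let ?E = "ext_power ?R ?M r" and ?E' = "ext_power ?R ?M (r - 1)"
  interpret M: module ?R ?M by (rule Vn_props)
  interpret E: module ?R ?E by (rule ext_power_module[OF Vn_props(1)])
  interpret E': module ?R ?E' by (rule ext_power_module[OF Vn_props(1)])
  interpret Br: module ?R ?B by (rule Brn_props)
  have r: "Suc (r - 1) = r" using assms(1) by simp
  obtain psi where psi: "psi \<in> mod_hom ?R ?E ?B"
    "\<And>f. (\<And>j. j < r \<Longrightarrow> f j \<in> V_set n) \<Longrightarrow> psi (wedge ?R ?M (map (\<lambda>j. V_class n (f j)) [0..<r])) = proj n r (h_det r f)"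
    using psi_exists[OF assms(2)] by blast
  have phi1: "phi n r (proj n r (Delta n r lam)) = wedge_of n r lam"
    by (rule phi_inverse(1)[OF assms(1,2) psi(1) _ assms(3)]) (rule psi(2), blast)
  have phi2: "inv_into (carrier ?B) (phi n r) w = psi w" if "w \<in> carrier ?E" for w
    by (rule phi_inverse(2)[OF assms(1,2) psi(1) _ that]) (rule psi(2), blast)
  define us where "us = map (\<lambda>j. V_class n (Xc n (m j))) [0..<r]"
  have us: "us \<in> tuples ?M r" by (auto simp: us_def tuples_def intro!: V_class_closed Xc_V_set)
  have w: "wedge_of n r lam = wedge ?R ?M us" by (simp add: wedge_of_eq us_def m_def)
  let ?om = "\<lambda>k. take k us @ drop (Suc k) us"
  define c where "c = (\<lambda>k. ((\<ominus>\<^bsub>?R\<^esub> \<one>\<^bsub>?R\<^esub>) [^]\<^bsub>?R\<^esub> k) \<otimes>\<^bsub>?R\<^esub> dual_s n q (us ! k))"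
  have ds: "dual_s n q (us ! k) = (if m k = q then 1 else 0)" if "k < r" for k
    using dual_s_props(2)[OF assms(5), of "m k"] wedge_index_less[OF assms(3,2) that] that
    by (simp add: us_def m_def Xcl_eq)
  have c: "c k = (if m k = q then (- 1) ^ k else 0)" if "k < r" for k
    unfolding c_def B0_sign ds[OF that] by (simp add: B0_eq)
  have cK: "c k \<in> B0_set n" if "k < r" for k
    unfolding c[OF that] using is_subringD[OF B0_set_subring[of n]] is_subring_power[OF B0_set_subring]
    by auto
  hence cR: "c k \<in> carrier ?R" if "k < r" for k using that by (simp add: B0_carrier)
  have omc: "?om k \<in> tuples ?M (r - 1)" if "k < r" for k
    by (rule omit_closed[OF Vn_props(1) us that])
  have om: "Xcl n p # ?om k = map (\<lambda>j. V_class n (Xc n (if j = 0 then p else m (insert_index k (j - 1))))) [0..<r]"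
    if k: "k < r" for k
  proof (rule nth_equalityI)
    have len: "length us = r" by (simp add: us_def)
    show l: "length (Xcl n p # ?om k) = length (map (\<lambda>j. V_class n (Xc n (if j = 0 then p else m (insert_index k (j - 1))))) [0..<r])"
      using k len by auto
    fix j assume "j < length (Xcl n p # ?om k)"
    hence j: "j < r" using l by simp
    show "(Xcl n p # ?om k) ! j = map (\<lambda>j. V_class n (Xc n (if j = 0 then p else m (insert_index k (j - 1))))) [0..<r] ! j"
    proof (cases j)
      case 0
      thus ?thesis using j by (simp add: Xcl_eq)
    next
      case (Suc i)
      have "?om k ! i = us ! insert_index k i"
        using k len j Suc by (auto simp: nth_append insert_index_def min_def)
      also have "\<dots> = V_class n (Xc n (m (insert_index k i)))"
        using j Suc k by (simp add: us_def insert_index_def)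
      finally show ?thesis using j Suc by simp
    qed
  qed
  have psi_term: "psi (wedge ?R ?M (Xcl n p # ?om k)) = proj n r (repl_det n r m k (int p))" if "k < r" for k
    unfolding om[OF that] repl_det_h_det by (rule psi(2)) (rule Xc_V_set)
  note d = dual_s_props(1)[OF assms(5)]
  note con = contract_props[OF Vn_props(1) d]
  have wl: "wedge_left ?R ?M (r - 1) (Xcl n p) \<in> mod_hom ?R ?E' ?E"
    using wedge_left_props(1)[OF Vn_props(1) Xcl_closed[of n p], of "r - 1"] unfolding r .
  have wcl: "wedge ?R ?M (Xcl n p # ?om k) \<in> carrier ?E" if "k < r" for k
    using mod_hom_closed[OF wl wedge_closed[OF Vn_props(1) omc[OF that]]]
    unfolding wedge_left_props(2)[OF Vn_props(1) Xcl_closed omc[OF that]] .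
  have "contract ?R ?M r (dual_s n q) (wedge ?R ?M us) =
      (\<Oplus>\<^bsub>?E'\<^esub> k\<in>{..<r}. c k \<odot>\<^bsub>?E'\<^esub> wedge ?R ?M (?om k))"
    unfolding c_def by (rule con(2)[OF us])
  hence "gl_act ?R ?M r (Xcl n p) (dual_s n q) (wedge ?R ?M us) =
      wedge_left ?R ?M (r - 1) (Xcl n p) (\<Oplus>\<^bsub>?E'\<^esub> k\<in>{..<r}. c k \<odot>\<^bsub>?E'\<^esub> wedge ?R ?M (?om k))"
    by (simp add: gl_act_def)
  also have "\<dots> = (\<Oplus>\<^bsub>?E\<^esub> k\<in>{..<r}. wedge_left ?R ?M (r - 1) (Xcl n p) (c k \<odot>\<^bsub>?E'\<^esub> wedge ?R ?M (?om k)))"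
    by (rule mod_hom_finsum[OF E'.module_axioms E.module_axioms wl finite_lessThan])
      (intro Pi_I E'.smult_closed cR wedge_closed[OF Vn_props(1)] omc; simp)
  also have "\<dots> = (\<Oplus>\<^bsub>?E\<^esub> k\<in>{..<r}. c k \<odot>\<^bsub>?E\<^esub> wedge ?R ?M (Xcl n p # ?om k))"
  proof (rule E.finsum_cong'[OF refl])
    fix k assume "k \<in> {..<r}"
    hence k: "k < r" by simp
    show "wedge_left ?R ?M (r - 1) (Xcl n p) (c k \<odot>\<^bsub>?E'\<^esub> wedge ?R ?M (?om k)) = c k \<odot>\<^bsub>?E\<^esub> wedge ?R ?M (Xcl n p # ?om k)"
      by (simp only: mod_hom_smult[OF wl cR[OF k] wedge_closed[OF Vn_props(1) omc[OF k]]]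
          wedge_left_props(2)[OF Vn_props(1) Xcl_closed omc[OF k]])
  qed (auto intro!: cR wcl)
  finally have act: "gl_act ?R ?M r (Xcl n p) (dual_s n q) (wedge ?R ?M us) = \<dots>" .
  have fc: "(\<Oplus>\<^bsub>?E\<^esub> k\<in>{..<r}. c k \<odot>\<^bsub>?E\<^esub> wedge ?R ?M (Xcl n p # ?om k)) \<in> carrier ?E"
    by (rule E.finsum_closed) (auto intro!: cR wcl)
  have "gl_act_Brn n r (Xcl n p) (dual_s n q) (proj n r (Delta n r lam)) =
      psi (\<Oplus>\<^bsub>?E\<^esub> k\<in>{..<r}. c k \<odot>\<^bsub>?E\<^esub> wedge ?R ?M (Xcl n p # ?om k))"
    unfolding gl_act_Brn_def phi1 w act by (rule phi2[OF fc])
  also have "\<dots> = (\<Oplus>\<^bsub>?B\<^esub> k\<in>{..<r}. psi (c k \<odot>\<^bsub>?E\<^esub> wedge ?R ?M (Xcl n p # ?om k)))"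
    by (rule mod_hom_finsum[OF E.module_axioms Br.module_axioms psi(1)]) (auto intro!: cR wcl)
  also have "\<dots> = (\<Oplus>\<^bsub>?B\<^esub> k\<in>{..<r}. proj n r (cst (c k) * repl_det n r m k (int p)))"
  proof (rule Br.finsum_cong'[OF refl])
    fix k assume "k \<in> {..<r}"
    hence k: "k < r" by simp
    show "psi (c k \<odot>\<^bsub>?E\<^esub> wedge ?R ?M (Xcl n p # ?om k)) = proj n r (cst (c k) * repl_det n r m k (int p))"
      by (simp only: mod_hom_smult[OF psi(1) cR[OF k] wcl[OF k]] psi_term[OF k] proj_cst[OF cK[OF k] repl_det_closed])
  qed (auto intro!: proj_closed is_subringD(4)[OF Br_set_subring] mpols_cst B0_set_subring cK repl_det_closed)
  also have "\<dots> = proj n r (\<Sum>k<r. cst (c k) * repl_det n r m k (int p))"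
    by (rule proj_sum[symmetric]) (auto intro!: is_subringD(4)[OF Br_set_subring] mpols_cst B0_set_subring cK repl_det_closed)
  also have "(\<Sum>k<r. cst (c k) * repl_det n r m k (int p)) =
      (\<Sum>k<r. if m k = q then (- 1) ^ k * repl_det n r m k (int p) else 0)"
    by (intro sum.cong refl) (simp add: c cst_power cst_uminus)
  finally show ?thesis .
qed

section \<open>The generating determinant as a Laurent series\<close>

lemma coeff_hom_b0_zw: "coeff_hom b0_zw"
  by (rule coeff_hom.intro)
    (simp_all add: b0_zw_def br_zw_def cst_add cst_mult fls_plus_const[symmetric])

lemma wneg_eq: "wneg n m = (\<Sum>i\<le>m. b0_zw ((- 1) ^ i * cc n i) * winv ^ (m - i))"
proof -
  interpret z: coeff_hom b0_zw by (rule coeff_hom_b0_zw)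
  have "wneg n m = (\<Sum>i\<le>Polynomial.degree (map_poly b0_zw (Xc n m)). b0_zw (Polynomial.coeff (Xc n m) i) * winv ^ i)"
    unfolding wneg_def poly_altdef by (simp add: coeff_map_poly z.zero)
  also have "\<dots> = poly_fun b0_zw (\<lambda>i. winv ^ i) (Xc n m)"
    unfolding poly_fun_def
    by (rule sum.mono_neutral_left) (auto simp: map_poly_degree_leq coeff_eq_0 z.zero
        coeff_map_poly[of b0_zw, OF z.zero, symmetric] simp del: z.zero)
  also have "\<dots> = (\<Sum>i\<le>m. b0_zw ((- 1) ^ i * cc n i) * winv ^ (m - i))"
    using poly_fun_Xc_shift[OF coeff_hom_b0_zw, of "\<lambda>i. winv ^ i" 0 n m] by simp
  finally show ?thesis .
qed

lemma ss_0: "ss n 0 = 1"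
  by (simp add: ss_def)

text \<open>
  Up to positive powers of \<open>w\<close>, \<open>w\<^bsup>-m\<^esup>(c)\<close> is \<open>w\<^bsup>-m\<^esup> c(w)\<close>. Since \<open>m < n\<close>, truncating \<open>1 / c(w)\<close> after
  \<open>w\<^bsup>n-1\<^esup>\<close> also changes the product in positive powers only, and \<open>w\<^bsup>-m\<^esup>\<close> is what remains.
\<close>

lemma s_wneg_nth:
  assumes "b \<le> 0" "m < n"
  shows "fls_nth ((1 + (\<Sum>i = 1..n - 1. b0_zw (ss n i) * wvar ^ i)) * wneg n m) b = (if b = - int m then 1 else 0)"
proof -
  interpret z: coeff_hom b0_zw by (rule coeff_hom_b0_zw)
  let ?S = "1 + (\<Sum>i = 1..n - 1. b0_zw (ss n i) * wvar ^ i)"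
  have S: "?S = (\<Sum>i<n. b0_zw (ss n i) * wvar ^ i)"
  proof -
    have "{..<n} = insert 0 {1..n - 1}" using assms(2) by auto
    thus ?thesis by (simp add: ss_0)
  qed
  have mono: "fls_nth (b0_zw x * (wvar ^ i * winv ^ k)) b = (if b = int i - int k then fls_const (cst x) else 0)" for x i k
    by (simp add: b0_zw_def br_zw_def wvar_def winv_def fls_X_power_times_conv_shift(1))
  have "?S * wneg n m = (\<Sum>l\<le>m. \<Sum>i<n. b0_zw ((- 1) ^ l * cc n l * ss n i) * (wvar ^ i * winv ^ (m - l)))"
    unfolding S wneg_eq sum_product
    by (subst sum.swap) (intro sum.cong refl, simp only: z.mult mult_ac)
  hence "fls_nth (?S * wneg n m) b = (\<Sum>l\<le>m. \<Sum>i<n. if b = int i - int (m - l) then fls_const (cst ((- 1) ^ l * cc n l * ss n i)) else 0)"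
    by (simp only: fls_nth_sum mono)
  also have "\<dots> = (\<Sum>l\<le>m. fls_const (cst ((- 1) ^ l * cc n l * s_coeff n ((b + int m) - int l))))"
  proof (intro sum.cong refl)
    fix l assume "l \<in> {..m}"
    hence l: "l \<le> m" by simp
    define j where "j = b + int m - int l"
    have jn: "nat j < n" using assms by (simp add: j_def nat_less_iff)
    have "(\<Sum>i<n. if b = int i - int (m - l) then fls_const (cst ((- 1) ^ l * cc n l * ss n i)) else 0 :: br fls) =
        (\<Sum>i<n. if j = int i then fls_const (cst ((- 1) ^ l * cc n l * ss n i)) else 0)"
      using l by (intro sum.cong refl if_cong) (auto simp: j_def of_nat_diff)
    also have "\<dots> = fls_const (cst ((- 1) ^ l * cc n l * s_coeff n j))"
    proof (cases "j < 0")
      case True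
      hence "\<And>i. j \<noteq> int i" by auto
      thus ?thesis using True by simp
    next
      case False
      hence "(\<Sum>i<n. if j = int i then fls_const (cst ((- 1) ^ l * cc n l * ss n i)) else 0 :: br fls) =
          (\<Sum>i<n. if i = nat j then fls_const (cst ((- 1) ^ l * cc n l * ss n i)) else 0)"
        by (intro sum.cong refl if_cong) auto
      also have "\<dots> = fls_const (cst ((- 1) ^ l * cc n l * ss n (nat j)))"
        using jn by simp
      finally show ?thesis using False by (simp add: icoef_def ss_eq)
    qed
    finally show "(\<Sum>i<n. if b = int i - int (m - l) then fls_const (cst ((- 1) ^ l * cc n l * ss n i)) else 0) =
      fls_const (cst ((- 1) ^ l * cc n l * s_coeff n (b + int m - int l)))" by (simp only: j_def)
  qed
  also have "\<dots> = fls_const (cst (\<Sum>l\<le>m. (- 1) ^ l * cc n l * s_coeff n ((b + int m) - int l)))"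
  proof -
    have "(\<Sum>l\<in>A. fls_const (cst (f l)) :: br fls) = fls_const (cst (\<Sum>l\<in>A. f l))" for A :: "nat set" and f :: "nat \<Rightarrow> b0"
      by (induction A rule: infinite_finite_induct) (simp_all add: cst_add fls_plus_const[symmetric])
    thus ?thesis .
  qed
  also have "(\<Sum>l\<le>m. (- 1) ^ l * cc n l * s_coeff n ((b + int m) - int l)) = (if b + int m = 0 then 1 else 0)"
    by (rule s_coeff_conv) (use assms(1) in auto)
  finally show ?thesis by (auto simp: eq_neg_iff_add_eq_0)
qed

text \<open>
  The entry of \<open>sigma_h\<close> at column \<open>j\<close> and row \<open>i\<close>, as a Laurent series in \<open>z\<close> alone and in terms of
  the exponents \<open>m\<^sub>j\<close>.
\<close>

definition sigma_entry :: "nat \<Rightarrow> nat \<Rightarrow> (nat \<Rightarrow> nat) \<Rightarrow> nat \<Rightarrow> nat \<Rightarrow> br fls" where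
  "sigma_entry n r m i j = fls_const (hc n r (int (m j) - int r + 1 + int i))
     - fls_const (hc n r (int (m j) - int r + int i)) * fls_X_inv"

definition sigma_minor :: "nat \<Rightarrow> nat \<Rightarrow> (nat \<Rightarrow> nat) \<Rightarrow> nat \<Rightarrow> br fls mat" where
  "sigma_minor n r m k = mat (r - 1) (r - 1) (\<lambda>(i, j). sigma_entry n r m (Suc i) (insert_index k j))"

text \<open>
  Summing \<open>repl_det\<close> over all \<open>a\<close> with weights \<open>z\<^sup>a\<close> gives a determinant whose first column is
  \<open>(c(z) / E\<^sub>r(z)) z\<^bsup>r-1-i\<^esup>\<close>, \<open>i = 0, \<dots>, r - 1\<close>. Subtracting \<open>z\<^sup>-\<^sup>1\<close> times the preceding row from every
  row clears this column below its top entry and applies \<open>\<sigma>\<^sub>-(z)\<close> to the remaining entries.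
\<close>

lemma repl_det_nth:
  assumes "1 \<le> r"
  shows "fls_nth (fls_X ^ (r - 1) * fps_to_fls (cE n r) *
      det (sigma_minor n r m k)) a = repl_det n r m k a"
proof -
  let ?C = "fps_to_fls (cE n r)"
  define h where "h = (\<lambda>i j. hc n r (int (m (insert_index k (j - 1))) - int r + 1 + int i))"
  define N :: "br fls mat" where "N = mat r r (\<lambda>(i, j). if j = 0 then ?C * fls_X ^ (r - 1 - i) else fls_const (h i j))"
  \<comment> \<open>Left multiplication by \<open>U\<close> performs the row operations.\<close>
  define U :: "br fls mat" where "U = mat r r (\<lambda>(i, l). if i = l then 1 else if i = Suc l then - fls_X_inv else 0)"
  have N: "N \<in> carrier_mat r r" and U: "U \<in> carrier_mat r r" by (auto simp: N_def U_def)
  have UN: "U * N \<in> carrier_mat r r" using U N by simp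
  have detU: "det U = 1"
  proof -
    have "det U = prod_list (diag_mat U)"
      by (rule det_lower_triangular[OF _ U]) (auto simp: U_def)
    also have "diag_mat U = replicate r 1"
      by (rule nth_equalityI) (auto simp: diag_mat_def U_def)
    finally show ?thesis by simp
  qed
  have ent: "(U * N) $$ (i, j) = (\<Sum>l<r. U $$ (i, l) * N $$ (l, j))" if "i < r" "j < r" for i j
    using that U N by (simp add: scalar_prod_def atLeast0LessThan)
  have r0: "0 < r" using assms by simp
  have row0: "(U * N) $$ (0, j) = N $$ (0, j)" if j: "j < r" for j
  proof -
    have "(U * N) $$ (0, j) = (\<Sum>l\<in>{0}. U $$ (0, l) * N $$ (l, j))"
      unfolding ent[OF r0 j]
      by (rule sum.mono_neutral_right) (use assms in \<open>auto simp: U_def\<close>)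
    thus ?thesis using assms by (simp add: U_def)
  qed
  have rowS: "(U * N) $$ (Suc i, j) = N $$ (Suc i, j) - fls_X_inv * N $$ (i, j)" if i: "Suc i < r" and j: "j < r" for i j
  proof -
    have "(U * N) $$ (Suc i, j) = (\<Sum>l\<in>{i, Suc i}. U $$ (Suc i, l) * N $$ (l, j))"
      unfolding ent[OF i j] by (rule sum.mono_neutral_right) (use i in \<open>auto simp: U_def\<close>)
    thus ?thesis using i by (simp add: U_def)
  qed
  have XX: "fls_X_inv * (fls_X * f) = f" for f :: "br fls"
    by (simp add: fls_X_times_conv_shift fls_X_inv_times_conv_shift)
  have col: "(U * N) $$ (Suc i, 0) = 0" if i: "Suc i < r" for i
  proof -
    have "r - 1 - i = Suc (r - 1 - Suc i)" using i by simp
    hence "fls_X_inv * N $$ (i, 0) = fls_X_inv * (fls_X * (?C * fls_X ^ (r - 1 - Suc i)))"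
      using i by (simp add: N_def mult_ac)
    also have "\<dots> = N $$ (Suc i, 0)" unfolding XX using i by (simp add: N_def)
    finally show ?thesis using rowS[OF i, of 0] assms by simp
  qed
  have ins: "insert_index 0 j = Suc j" for j by (simp add: insert_index_def)
  have del: "mat_delete (U * N) 0 0 = sigma_minor n r m k"
  proof (rule eq_matI)
    fix i j assume "i < dim_row (sigma_minor n r m k)" "j < dim_col (sigma_minor n r m k)"
    hence ij: "i < r - 1" "j < r - 1" by (simp_all add: sigma_minor_def)
    have "mat_delete (U * N) 0 0 $$ (i, j) = (U * N) $$ (Suc i, Suc j)"
      using mat_delete_index[of "U * N" "r - 1" 0 0 i j] UN ij assms by (simp add: ins)
    also have "\<dots> = N $$ (Suc i, Suc j) - fls_X_inv * N $$ (i, Suc j)" using ij by (intro rowS) auto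
    also have "\<dots> = sigma_entry n r m (Suc i) (insert_index k j)"
      using ij by (simp add: N_def sigma_entry_def h_def mult.commute algebra_simps)
    finally show "mat_delete (U * N) 0 0 $$ (i, j) = sigma_minor n r m k $$ (i, j)"
      using ij by (simp add: sigma_minor_def)
  qed (use UN in \<open>auto simp: sigma_minor_def\<close>)
  have "det N = det (U * N)" by (simp add: det_mult[OF U N] detU)
  also have "\<dots> = (\<Sum>i<r. (U * N) $$ (i, 0) * cofactor (U * N) i 0)"
    by (rule laplace_expansion_column[OF UN]) (use assms in auto)
  also have "\<dots> = (\<Sum>i\<in>{0}. (U * N) $$ (i, 0) * cofactor (U * N) i 0)"
  proof (rule sum.mono_neutral_right)
    show "\<forall>i\<in>{..<r} - {0}. (U * N) $$ (i, 0) * cofactor (U * N) i 0 = 0"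
    proof
      fix i assume "i \<in> {..<r} - {0}"
      then obtain i' where "i = Suc i'" "Suc i' < r" by (cases i) auto
      thus "(U * N) $$ (i, 0) * cofactor (U * N) i 0 = 0" by (simp only: col mult_zero_left)
    qed
  qed (use assms in auto)
  also have "\<dots> = fls_X ^ (r - 1) * ?C * det (sigma_minor n r m k)"
  proof -
    have "cofactor (U * N) 0 0 = det (sigma_minor n r m k)"
      unfolding cofactor_def del by simp
    moreover have "(U * N) $$ (0, 0) = fls_X ^ (r - 1) * ?C"
      unfolding row0[OF r0] using r0 by (simp add: N_def mult.commute)
    ultimately show ?thesis by simp
  qed
  finally have 1: "fls_X ^ (r - 1) * ?C * det (sigma_minor n r m k) = det N" ..
  define A where "A = mat r r (\<lambda>(i, j). hc n r ((if j = 0 then a else int (m (insert_index k (j - 1)))) - int r + 1 + int i))"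
  have A: "A \<in> carrier_mat r r" by (simp add: A_def)
  have hom: "comm_ring_hom (fls_const :: br \<Rightarrow> br fls)"
    by unfold_locales (auto simp: fls_plus_const[symmetric])
  have cof: "cofactor N i 0 = fls_const (cofactor A i 0)" if "i < r" for i
  proof -
    have "mat_delete N i 0 = map_mat fls_const (mat_delete A i 0)"
      using that assms by (auto simp: mat_delete_def N_def A_def h_def)
    hence "det (mat_delete N i 0) = fls_const (det (mat_delete A i 0))"
      using comm_ring_hom.hom_det[OF hom] by simp
    thus ?thesis by (cases "even i") (simp_all add: cofactor_def)
  qed
  have "det N = (\<Sum>i<r. N $$ (i, 0) * cofactor N i 0)"
    by (rule laplace_expansion_column[OF N]) (use assms in auto)
  hence "fls_nth (det N) a = (\<Sum>i<r. fls_nth (N $$ (i, 0)) a * cofactor A i 0)"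
    by (simp add: fls_nth_sum cof)
  also have "\<dots> = (\<Sum>i<r. A $$ (i, 0) * cofactor A i 0)"
  proof (intro sum.cong refl arg_cong2[of _ _ _ _ "(*)"])
    fix i assume "i \<in> {..<r}"
    hence i: "i < r" by simp
    have "N $$ (i, 0) = fls_shift (- int (r - 1 - i)) ?C"
      using i r0 by (simp add: N_def fls_X_power_times_conv_shift(2))
    hence "fls_nth (N $$ (i, 0)) a = fls_nth ?C (a + - int (r - 1 - i))"
      by (simp only: fls_shift_nth)
    also have "\<dots> = A $$ (i, 0)"
    proof -
      have "fls_nth ?C j = hc n r j" for j by (simp add: hc_def)
      moreover have "a + - int (r - 1 - i) = a - int r + 1 + int i" using i by simp
      ultimately show ?thesis using i r0 by (simp only: A_def index_mat prod.case if_True refl)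
    qed
    finally show "fls_nth (N $$ (i, 0)) a = A $$ (i, 0)" .
  qed
  also have "\<dots> = det A"
    by (rule laplace_expansion_column[OF A, symmetric]) (use assms in auto)
  finally show ?thesis unfolding 1 by (simp add: repl_det_def A_def)
qed

text \<open>
  Laplace expansion along the first row: the row contributes \<open>w\<close> only, through \<open>s_wneg_nth\<close>, and the
  minors contribute \<open>z\<close> only, through \<open>repl_det_nth\<close>.
\<close>

lemma rhs_coeff:
  assumes "1 \<le> r" "r \<le> n" "lam \<in> box_partitions r n" "b \<le> 0"
  defines "m \<equiv> wedge_index r lam"
  shows "coeff_zw
      (zvar ^ (r - 1) * winv ^ (r - 1) * (1 + (\<Sum>i = 1..n - 1. b0_zw (ss n i) * wvar ^ i)) *
        (cE_zw n r * Delta_w n r lam)) a b =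
    (\<Sum>k<r. if b = - int (m k) then (- 1) ^ k * repl_det n r m k a else 0)"
proof -
  let ?S = "1 + (\<Sum>i = 1..n - 1. b0_zw (ss n i) * wvar ^ i)"
  define M where "M = mat r r (\<lambda>(k, j). if k = 0 then wneg n (r - 1 - j + lam ! j)
        else sigma_h n r (int (lam ! j) - int j + int k))"
  have M: "M \<in> carrier_mat r r" by (simp add: M_def)
  let ?D = "\<lambda>k. det (sigma_minor n r m k)"
  let ?c = "\<lambda>k. (- 1) ^ k * (fls_X ^ (r - 1) * fps_to_fls (cE n r) * ?D k) :: br fls"
  have hom: "comm_ring_hom (fls_const :: br fls \<Rightarrow> zw)"
    by unfold_locales (auto simp: fls_plus_const[symmetric])
  interpret h: comm_ring_hom "fls_const :: br fls \<Rightarrow> zw" by (rule hom)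
  have ww: "winv ^ (r - 1) * wvar ^ (r - 1) = 1"
    by (simp add: winv_def wvar_def fls_X_inv_power_times_conv_shift fls_X_power_conv_shift_1)
  have sig: "sigma_h n r (int (lam ! j) - int j + int i) = fls_const (sigma_entry n r m i j)" if "j < r" for i j
  proof -
    have 1: "int (lam ! j) - int j + int i = int (m j) - int r + 1 + int i"
      and 2: "int (lam ! j) - int j + int i - 1 = int (m j) - int r + int i"
      using that by (auto simp: m_def wedge_index_def)
    show ?thesis
      unfolding sigma_h_def sigma_entry_def br_zw_def zinv_def 2 unfolding 1 h.hom_minus h.hom_mult ..
  qed
  have cof: "cofactor M 0 k = fls_const ((- 1) ^ k * ?D k)" if k: "k < r" for k
  proof -
    have "mat_delete M 0 k = map_mat fls_const (sigma_minor n r m k)"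
    proof (rule eq_matI)
      fix i j assume "i < dim_row (map_mat (fls_const :: br fls \<Rightarrow> zw) (sigma_minor n r m k))"
        "j < dim_col (map_mat (fls_const :: br fls \<Rightarrow> zw) (sigma_minor n r m k))"
      hence ij: "i < r - 1" "j < r - 1" by (simp_all add: sigma_minor_def)
      have ins: "insert_index k j < r" using ij k by (auto simp: insert_index_def)
      have "mat_delete M 0 k $$ (i, j) = M $$ (insert_index 0 i, insert_index k j)"
        using mat_delete_index[of M "r - 1" 0 k i j] M ij k assms(1) by simp
      also have "insert_index 0 i = Suc i" by (simp add: insert_index_def)
      also have "M $$ (Suc i, insert_index k j) = fls_const (sigma_entry n r m (Suc i) (insert_index k j))"
        using ij ins sig[OF ins, of "Suc i"] by (simp add: M_def)
      finally show "mat_delete M 0 k $$ (i, j) = map_mat fls_const (sigma_minor n r m k) $$ (i, j)"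
        using ij by (simp add: sigma_minor_def)
    qed (use M in \<open>auto simp: sigma_minor_def\<close>)
    hence "det (mat_delete M 0 k) = fls_const (?D k)" by simp
    thus ?thesis by (simp add: cofactor_def h.hom_mult h.hom_power h.hom_uminus)
  qed
  have "det M = (\<Sum>k<r. M $$ (0, k) * cofactor M 0 k)"
    by (rule laplace_expansion_row[OF M]) (use assms in auto)
  also have "\<dots> = (\<Sum>k<r. wneg n (m k) * fls_const ((- 1) ^ k * ?D k))"
    using assms(1) by (intro sum.cong refl) (simp add: cof, simp add: M_def m_def wedge_index_def)
  finally have detM: "det M = (\<Sum>k<r. wneg n (m k) * fls_const ((- 1) ^ k * ?D k))" .
  have "zvar ^ (r - 1) * winv ^ (r - 1) * ?S * (cE_zw n r * Delta_w n r lam) =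
      (winv ^ (r - 1) * wvar ^ (r - 1)) * (zvar ^ (r - 1) * cE_zw n r * (?S * det M))"
    by (simp only: Delta_w_def M_def[symmetric] mult_ac)
  also have "\<dots> = (\<Sum>k<r. zvar ^ (r - 1) * cE_zw n r * (?S * (wneg n (m k) * fls_const ((- 1) ^ k * ?D k))))"
    unfolding ww detM by (simp only: mult_1_left sum_distrib_left)
  also have "\<dots> = (\<Sum>k<r. (?S * wneg n (m k)) * fls_const (?c k))"
  proof (intro sum.cong refl)
    fix k
    have "zvar ^ (r - 1) * cE_zw n r = fls_const (fls_X ^ (r - 1) * fps_to_fls (cE n r))"
      by (simp only: zvar_def cE_zw_def h.hom_mult h.hom_power)
    hence "zvar ^ (r - 1) * cE_zw n r * (?S * (wneg n (m k) * fls_const ((- 1) ^ k * ?D k))) =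
        (?S * wneg n (m k)) * (fls_const (fls_X ^ (r - 1) * fps_to_fls (cE n r)) * fls_const ((- 1) ^ k * ?D k))"
      by (simp only: mult_ac)
    also have "fls_const (fls_X ^ (r - 1) * fps_to_fls (cE n r)) * fls_const ((- 1) ^ k * ?D k) = fls_const (?c k)"
      by (simp only: fls_const_mult_const mult_ac)
    finally show "zvar ^ (r - 1) * cE_zw n r * (?S * (wneg n (m k) * fls_const ((- 1) ^ k * ?D k))) =
      (?S * wneg n (m k)) * fls_const (?c k)" .
  qed
  finally have "coeff_zw (zvar ^ (r - 1) * winv ^ (r - 1) * ?S * (cE_zw n r * Delta_w n r lam)) a b =
      fls_nth (\<Sum>k<r. fls_nth (?S * wneg n (m k)) b * ?c k) a"
    by (simp only: coeff_zw_def fls_nth_sum fls_mult_const_nth)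
  also have "\<dots> = (\<Sum>k<r. fls_nth (if b = - int (m k) then ?c k else 0) a)"
    unfolding fls_nth_sum
  proof (intro sum.cong refl)
    fix k assume "k \<in> {..<r}"
    hence "m k < n" using wedge_index_less[OF assms(3,2)] by (simp add: m_def)
    note nth = s_wneg_nth[OF assms(4) this]
    show "fls_nth (fls_nth (?S * wneg n (m k)) b * ?c k) a = fls_nth (if b = - int (m k) then ?c k else 0) a"
      unfolding nth by (cases "b = - int (m k)") (simp_all only: if_True if_False refl mult_1_left mult_zero_left)
  qed
  also have "\<dots> = (\<Sum>k<r. if b = - int (m k) then (- 1) ^ k * repl_det n r m k a else 0)"
  proof (intro sum.cong refl)
    fix k
    have "fls_nth (?c k) a = (- 1) ^ k * repl_det n r m k a"
      using repl_det_nth[OF assms(1), of n m k a] by (cases "even k") simp_all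
    thus "fls_nth (if b = - int (m k) then ?c k else 0) a = (if b = - int (m k) then (- 1) ^ k * repl_det n r m k a else 0)"
      by simp
  qed
  finally show ?thesis .
qed

theorem theorem4p4:
  fixes n r :: nat and lam :: "nat list"
  assumes "1 \<le> r" and "r \<le> n"
    and "length lam = r" and "sorted_wrt (\<ge>) lam" and "lam ! 0 \<le> n - r"
  shows "\<forall>a b :: int. b \<le> 0 \<longrightarrow>
    gen_E n r (proj n r (Delta n r lam)) a b =
    proj n r (coeff_zw
      (zvar ^ (r - 1) * winv ^ (r - 1) * (1 + (\<Sum>i = 1..n - 1. b0_zw (ss n i) * wvar ^ i)) *
        (cE_zw n r * Delta_w n r lam)) a b)"
proof (intro allI impI)
  fix a b :: int assume b: "b \<le> 0"
  have "lam ! i \<le> lam ! 0" if "i < r" for i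
    using assms(3,4) that by (cases "i = 0") (auto simp: sorted_wrt_iff_nth_less)
  hence lam: "lam \<in> box_partitions r n"
    using assms by (force simp: box_partitions_def in_set_conv_nth)
  let ?m = "wedge_index r lam"
  let ?T = "\<Sum>k<r. if b = - int (?m k) then (- 1) ^ k * repl_det n r ?m k a else 0"
  have "gen_E n r (proj n r (Delta n r lam)) a b = proj n r ?T"
  proof (cases "0 \<le> a \<and> a \<le> int n - 1 \<and> - b \<le> int n - 1")
    case True
    hence "gen_E n r (proj n r (Delta n r lam)) a b =
        gl_act_Brn n r (Xcl n (nat a)) (dual_s n (nat (- b))) (proj n r (Delta n r lam))"
      using b by (simp add: gen_E_def)
    also have "\<dots> = proj n r (\<Sum>k<r. if ?m k = nat (- b) then (- 1) ^ k * repl_det n r ?m k (int (nat a)) else 0)"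
      using True b by (intro gl_act_Delta[OF assms(1,2) lam]) auto
    also have "(\<Sum>k<r. if ?m k = nat (- b) then (- 1) ^ k * repl_det n r ?m k (int (nat a)) else 0) = ?T"
      using True b by (intro sum.cong refl if_cong) auto
    finally show ?thesis .
  next
    case False
    have "?T \<in> Irn n r"
    proof (rule Br_ideal.I_sum)
      fix k assume "k \<in> {..<r}"
      hence "?m k < n" using wedge_index_less[OF lam assms(2)] by simp
      hence "a < 0 \<or> a \<ge> int n" if "b = - int (?m k)" using False that by auto
      thus "(if b = - int (?m k) then (- 1) ^ k * repl_det n r ?m k a else 0) \<in> Irn n r"
        using repl_det_neg[OF assms(1), of a n ?m k] repl_det_large[OF assms(1,2), of a ?m k]
          Br_ideal.I_0[of n r] Br_ideal.I_uminus[of "repl_det n r ?m k a" n r]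
        by (cases "even k") auto
    qed
    hence "proj n r ?T = \<zero>\<^bsub>Brn n r\<^esub>" by (rule proj_in_Irn)
    moreover have "gen_E n r (proj n r (Delta n r lam)) a b = \<zero>\<^bsub>Brn n r\<^esub>"
      using False b by (auto simp: gen_E_def)
    ultimately show ?thesis by simp
  qed
  thus "gen_E n r (proj n r (Delta n r lam)) a b =
    proj n r (coeff_zw
      (zvar ^ (r - 1) * winv ^ (r - 1) * (1 + (\<Sum>i = 1..n - 1. b0_zw (ss n i) * wvar ^ i)) *
        (cE_zw n r * Delta_w n r lam)) a b)"
    by (simp only: rhs_coeff[OF assms(1,2) lam b])
qed

end
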